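(* Let $m=n=2$ and let $M=N$ be the linear torus bundle over $B=S^1$ with gluing matrix $\overline A=\begin{pmatrix}0&-1\\1&0\end{pmatrix}$. Identify $\mathbb{Z}^2$ with the Gaussian integers $\mathbb{Z}\oplus i\mathbb{Z}\subset\mathbb{C}$, so that $\overline A$ is multiplication by $i$. Given fiberwise maps $f_1,f_2:M\to N$, let $(\overline L,[\overline v])$ be the classifying pair of $f=f_1-f_2$ (here $\overline L:\mathbb{Z}^2\to\mathbb{Z}^2$ is complex linear and the class of $\overline v=(\overline v_1,\overline v_2)$ corresponds to $[\overline v_1+\overline v_2]\in\mathbb{Z}_2$). Write $\overline L(1)=k+i\,l$ and $k^2+l^2=4q+r$ with integers $k,l,q,r$ satisfying $q\ge0$ and $r\in\{0,1,2\}$. Then $$\mathrm{MCC}_B(f_1,f_2)=\begin{cases}0&\text{if }k^2+l^2=0;\\ q>0&\text{if }k^2+l^2=4q>0\text{ and }\overline v_1\not\equiv\overline v_2\ (2);\\ q+2&\text{if }k^2+l^2>0\text{ is even and }\overline v_1\equiv\overline v_2\ (2);\\ q+1&\text{else.}\end{cases}$$ More precisely, if $\overline L\neq0$, then the selfmap $\beta_{\overline v}$ on $G:=\mathbb{Z}^2/\overline L(\mathbb{Z}^2)$ has only orbits of order $1$, $2$ and $4$. Their numbers $\nu_1,\nu_2,\nu_4$, respectively, as well as $\nu:=\nu_1+\nu_2+\nu_4$, depend only on the cardinality $k^2+l^2$ of $G$ and on the parity of $\overline v_1+\overline v_2$, and $(\nu_1,\nu_2,\nu_4;\nu)$ is given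 as follows. If $\overline v_1\equiv\overline v_2\ (2)$: $(2,1,q-1;\,q+2)$ when $k^2+l^2=4q>0$; $(1,0,q;\,q+1)$ when $k^2+l^2=4q+1$; $(2,0,q;\,q+2)$ when $k^2+l^2=4q+2$. If $\overline v_1\not\equiv\overline v_2\ (2)$: $(0,0,q;\,q)$ when $k^2+l^2=4q>0$; $(1,0,q;\,q+1)$ when $k^2+l^2=4q+1$; $(0,1,q;\,q+1)$ when $k^2+l^2=4q+2$. In particular, all odd order orbits consist of a single fixed point. Their number $\nu_1$ has the same parity as $\#G=k^2+l^2$ and can take only the values $0$, $1$ and $2$.
   Context: Let $T^2=\mathbb{R}^2/\mathbb{Z}^2$, $q_2:\mathbb{R}^2\to T^2$ the projection, $I=[0,1]$, $S^1=I/0\sim1$. The bundle is $M=N=(T^2\times I)/(x,1)\sim(A(x),0)$, with the obvious projection $p$ to $S^1$, where $A$ is the automorphism of $T^2$ induced by $\overline A$. Fibers are abelian groups written additively, so fiberwise maps can be subtracted. A continuous map $f:M\to N$ is fiberwise if $p\circ f=p$; fiberwise homotopies are homotopies through fiberwise maps. Classifying pair. $\overline L:\mathbb{Z}^2=\pi_1(T^2)\to\pi_1(T^2)=\mathbb{Z}^2$ is induced by the restriction of $f=f_1-f_2$ to the fiber $T^2\times\{1\}$; it commutes with $\overline A$, i.e. is complex linear. For $\overline v\in\mathbb{Z}^2$ let $s_{\overline v}$ be the section $s_{\overline v}([t])=[q_2(t\overline v),t]$; this induces a bijection from $\mathbb{Z}^2/(\overline A-\mathrm{id})\mathbb{Z}^2\cong\mathbb{Z}_2$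 (via $[\overline v]\mapsto[\overline v_1+\overline v_2]$) onto the homotopy classes of sections of $p$; $[\overline v]$ is the class corresponding to $f\circ s_0$, where $s_0([t])=[0,t]$ is the zero section. $\beta_{\overline v}$ is the bijection of $G=\mathbb{Z}^2/\overline L(\mathbb{Z}^2)$ given by $\beta_{\overline v}[\overline u]=[\overline A(\overline u-\overline v)]$; its orbits are those of the $\mathbb{Z}$-action given by its iterates, and the order of an orbit is its cardinality. $\mathrm{MCC}_B(f_1,f_2)$ is the minimum, over all pairs $(f_1',f_2')$ with $f_i'$ fiberwise homotopic to $f_i$, of the number of pathcomponents of $\{x\in M: f_1'(x)=f_2'(x)\}$. *)

theory Defs
  imports "HOL-Analysis.Analysis" "HOL-Number_Theory.Cong" "HOL-Library.Extended_Nat"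
begin

section \<open>Quotient spaces\<close>

definition quotient_topology :: "'a topology \<Rightarrow> ('a \<times> 'a) set \<Rightarrow> 'a set topology" where
  "quotient_topology X r = topology (\<lambda>U. U \<subseteq> topspace X // r \<and> openin X (\<Union>U))"

lemma openin_quotient_topology:
  assumes "equiv (topspace X) r"
  shows "openin (quotient_topology X r) U \<longleftrightarrow> U \<subseteq> topspace X // r \<and> openin X (\<Union>U)"
proof -
  have "istopology (\<lambda>U. U \<subseteq> topspace X // r \<and> openin X (\<Union>U))"
    unfolding istopology_def
  proof (intro conjI allI impI; (elim conjE)?)
    fix S T
    assume S: "S \<subseteq> topspace X // r" "openin X (\<Union>S)"
      and T: "T \<subseteq> topspace X // r" "openin X (\<Union>T)"
    show "S \<inter> T \<subseteq> topspace X // r" using S by blast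
    have "\<Union>(S \<inter> T) = \<Union>S \<inter> \<Union>T"
    proof
      show "\<Union>S \<inter> \<Union>T \<subseteq> \<Union>(S \<inter> T)"
      proof
        fix x assume "x \<in> \<Union>S \<inter> \<Union>T"
        then obtain A B where AB: "A \<in> S" "x \<in> A" "B \<in> T" "x \<in> B" by blast
        then have "A = B" using quotient_disj[OF assms, of A B] S T by blast
        then show "x \<in> \<Union>(S \<inter> T)" using AB by blast
      qed
    qed blast
    then show "openin X (\<Union>(S \<inter> T))" using S T by auto
  next
    fix K assume K: "\<forall>S\<in>K. S \<subseteq> topspace X // r \<and> openin X (\<Union>S)"
    then show "\<Union>K \<subseteq> topspace X // r" by blast
    have "\<Union>(\<Union>K) = \<Union>(Union ` K)" by blast
    then show "openin X (\<Union>(\<Union>K))" using K by auto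
  qed
  then show ?thesis unfolding quotient_topology_def by (simp add: topology_inverse')
qed

lemma topspace_quotient_topology:
  assumes "equiv (topspace X) r"
  shows "topspace (quotient_topology X r) = topspace X // r"
proof -
  have "openin (quotient_topology X r) (topspace X // r)"
    by (simp add: openin_quotient_topology[OF assms] Union_quotient[OF assms])
  moreover have "topspace (quotient_topology X r) \<subseteq> topspace X // r"
    using openin_quotient_topology[OF assms] openin_topspace by blast
  ultimately show ?thesis using openin_subset by blast
qed

lemma quotient_map_quotient_topology:
  assumes "equiv (topspace X) r"
  shows "quotient_map X (quotient_topology X r) (\<lambda>x. r `` {x})"
proof -
  have "{x \<in> topspace X. r `` {x} \<in> U} = \<Union>U" if U: "U \<subseteq> topspace X // r" for U
  proof (intro equalityI subsetI)
    fix x assume "x \<in> {x \<in> topspace X. r `` {x} \<in> U}"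
    then show "x \<in> \<Union>U" using equiv_class_self[OF assms, of x] by blast
  next
    fix x assume "x \<in> \<Union>U"
    then obtain A where A: "A \<in> U" "x \<in> A" by blast
    then have "A \<in> topspace X // r" using U by blast
    then obtain y where y: "y \<in> topspace X" "A = r `` {y}" by (rule quotientE)
    then have "(y, x) \<in> r" using A by blast
    then have "r `` {x} = A" using y equiv_class_eq[OF assms] by blast
    moreover have "x \<in> topspace X" using \<open>A \<in> topspace X // r\<close> A Union_quotient[OF assms] by blast
    ultimately show "x \<in> {x \<in> topspace X. r `` {x} \<in> U}" using A by simp
  qed
  then show ?thesis
    unfolding quotient_map_def topspace_quotient_topology[OF assms]
    by (auto simp: openin_quotient_topology[OF assms] quotient_def)
qed

definition generated_equiv :: "'a set \<Rightarrow> ('a \<Rightarrow> 'a \<Rightarrow> bool) \<Rightarrow> ('a \<times> 'a) set" where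
  "generated_equiv S R = {(a, b). a \<in> S \<and> b \<in> S \<and> equivclp R a b}"

lemma equiv_generated_equiv: "equiv S (generated_equiv S R)"
  by (auto simp: equiv_def refl_on_def sym_def trans_def generated_equiv_def
      intro: equivclp_sym equivclp_trans)


section \<open>The torus, the circle and the torus bundle\<close>

text \<open>
  Maps on quotients are written as unions over the representatives of a class
  (\<open>\<Union>x\<in>X. [\<dots>x\<dots>]\<close>), the usual idiom for well-defined maps on quotients: all
  members of the union are one and the same class.
\<close>

text \<open>The matrix of multiplication by \<open>i\<close>, used both on \<open>\<int>\<^sup>2\<close> and on \<open>\<real>\<^sup>2\<close>.\<close>

definition A_bar :: "'a::comm_ring_1 ^ 2 ^ 2" where
  "A_bar = vector [vector [0, -1], vector [1, 0]]"

definition real_vec :: "int ^ 2 \<Rightarrow> real ^ 2" where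
  "real_vec u = (\<chi> i. of_int (u $ i))"

definition torus_rel :: "((real ^ 2) \<times> (real ^ 2)) set" where
  "torus_rel = {(x, y). x - y \<in> range real_vec}"

type_synonym torus_pt = "(real ^ 2) set"

definition q2 :: "real ^ 2 \<Rightarrow> torus_pt" where
  "q2 x = torus_rel `` {x}"

definition torus :: "torus_pt topology" where
  "torus = quotient_topology euclidean torus_rel"

definition torus_minus :: "torus_pt \<Rightarrow> torus_pt \<Rightarrow> torus_pt" where
  "torus_minus X Y = (\<Union>x\<in>X. \<Union>y\<in>Y. q2 (x - y))"

definition A_torus :: "torus_pt \<Rightarrow> torus_pt" where
  "A_torus X = (\<Union>x\<in>X. q2 (A_bar *v x))"

definition circle_rel :: "(real \<times> real) set" where
  "circle_rel = generated_equiv {0..1} (\<lambda>s t. s = 0 \<and> t = 1)"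

definition circle :: "real set topology" where
  "circle = quotient_topology (top_of_set {0..1}) circle_rel"

type_synonym bundle_pt = "(torus_pt \<times> real) set"

definition bundle_rel :: "((torus_pt \<times> real) \<times> (torus_pt \<times> real)) set" where
  "bundle_rel = generated_equiv (topspace torus \<times> {0..1})
     (\<lambda>a b. \<exists>X\<in>topspace torus. a = (X, 1) \<and> b = (A_torus X, 0))"

definition torus_bundle :: "bundle_pt topology" where
  "torus_bundle = quotient_topology (prod_topology torus (top_of_set {0..1})) bundle_rel"

definition bundle_class :: "torus_pt \<Rightarrow> real \<Rightarrow> bundle_pt" where
  "bundle_class X t = bundle_rel `` {(X, t)}"

definition bundle_proj :: "bundle_pt \<Rightarrow> real set" where
  "bundle_proj c = (\<Union>(X, t)\<in>c. circle_rel `` {t})"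

text \<open>Subtraction in the fibers: the union runs over representatives with equal
  \<open>I\<close>-coordinate, so it is only meaningful for two points of the same fiber.\<close>

definition fiber_minus :: "bundle_pt \<Rightarrow> bundle_pt \<Rightarrow> bundle_pt" where
  "fiber_minus c d = \<Union>{bundle_class (torus_minus X Y) t | X Y t. (X, t) \<in> c \<and> (Y, t) \<in> d}"

lemma equiv_torus_rel: "equiv UNIV torus_rel"
proof -
  have rv0: "real_vec 0 = 0" by (simp add: real_vec_def vec_eq_iff)
  have rvm: "- real_vec u = real_vec (- u)" for u by (simp add: real_vec_def vec_eq_iff)
  have rva: "real_vec u + real_vec w = real_vec (u + w)" for u w
    by (simp add: real_vec_def vec_eq_iff)
  have 1: "x - x \<in> range real_vec" for x using rv0 by (metis diff_self rangeI)
  have 2: "y - x \<in> range real_vec" if "x - y \<in> range real_vec" for x y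
    using that rvm by (metis (no_types) imageE minus_diff_eq rangeI)
  have 3: "x - z \<in> range real_vec"
    if xyz: "x - y \<in> range real_vec" "y - z \<in> range real_vec" for x y z
  proof -
    obtain u w where "x - y = real_vec u" "y - z = real_vec w" using xyz by blast
    then have "x - z = real_vec (u + w)" by (metis rva diff_add_cancel add_diff_eq)
    then show ?thesis by blast
  qed
  show ?thesis
    unfolding equiv_def refl_on_def sym_def trans_def torus_rel_def using 1 2 3 by blast
qed

lemma equiv_circle_rel: "equiv (topspace (top_of_set {0..1})) circle_rel"
  by (simp add: circle_rel_def equiv_generated_equiv)

lemma equiv_bundle_rel: "equiv (topspace (prod_topology torus (top_of_set {0..1}))) bundle_rel"
  by (simp add: bundle_rel_def equiv_generated_equiv)


section \<open>Fiberwise maps and their minimal coincidence number\<close>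

definition fiberwise :: "(bundle_pt \<Rightarrow> bundle_pt) \<Rightarrow> bool" where
  "fiberwise f \<longleftrightarrow> continuous_map torus_bundle torus_bundle f \<and>
     (\<forall>c\<in>topspace torus_bundle. bundle_proj (f c) = bundle_proj c)"

definition fiberwise_homotopic ::
    "(bundle_pt \<Rightarrow> bundle_pt) \<Rightarrow> (bundle_pt \<Rightarrow> bundle_pt) \<Rightarrow> bool" where
  "fiberwise_homotopic f g \<longleftrightarrow> homotopic_with fiberwise torus_bundle torus_bundle f g"

definition coincidence_space ::
    "(bundle_pt \<Rightarrow> bundle_pt) \<Rightarrow> (bundle_pt \<Rightarrow> bundle_pt) \<Rightarrow> bundle_pt topology" where
  "coincidence_space f g = subtopology torus_bundle {c \<in> topspace torus_bundle. f c = g c}"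

text \<open>Cardinality with value \<open>\<infinity>\<close> (rather than \<open>0\<close>) on infinite sets, so that the
  minimum below is not spoilt by pairs with infinitely many pathcomponents.\<close>

definition ecard :: "'a set \<Rightarrow> enat" where
  "ecard S = (if finite S then enat (card S) else \<infinity>)"

text \<open>The index set is nonempty and \<open>enat\<close> is well-ordered, so the infimum is a minimum.\<close>

definition MCC_B :: "(bundle_pt \<Rightarrow> bundle_pt) \<Rightarrow> (bundle_pt \<Rightarrow> bundle_pt) \<Rightarrow> enat" where
  "MCC_B f1 f2 =
     (INF (g1, g2) \<in> {(g1, g2). fiberwise_homotopic f1 g1 \<and> fiberwise_homotopic f2 g2}.
        ecard (path_components_of (coincidence_space g1 g2)))"


section \<open>The classifying pair\<close>

text \<open>The selfmap of \<open>T\<^sup>2\<close> obtained by restricting a fiberwise map to the fiber \<open>T\<^sup>2 \<times> {1}\<close>.\<close>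

definition fiber_restriction :: "(bundle_pt \<Rightarrow> bundle_pt) \<Rightarrow> torus_pt \<Rightarrow> torus_pt" where
  "fiber_restriction f X =
     (THE Y. Y \<in> topspace torus \<and> f (bundle_class X 1) = bundle_class Y 1)"

text \<open>The loop \<open>t \<mapsto> X + q\<^sub>2(t u)\<close>. The identification \<open>\<int>\<^sup>2 = \<pi>\<^sub>1(T\<^sup>2, X)\<close>, compatible
  with change of base point, sends \<open>u\<close> to its homotopy class.\<close>

definition torus_loop :: "torus_pt \<Rightarrow> int ^ 2 \<Rightarrow> real \<Rightarrow> torus_pt" where
  "torus_loop X u t = (\<Union>x\<in>X. q2 (x + t *\<^sub>R real_vec u))"

text \<open>\<open>L\<close> is \<open>g\<^sub>* : \<pi>\<^sub>1(T\<^sup>2, 0) \<rightarrow> \<pi>\<^sub>1(T\<^sup>2, g 0)\<close> under these identifications; \<open>g\<close> need not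
  preserve the base point.\<close>

definition induces_on_pi1 :: "(torus_pt \<Rightarrow> torus_pt) \<Rightarrow> (int ^ 2 \<Rightarrow> int ^ 2) \<Rightarrow> bool" where
  "induces_on_pi1 g L \<longleftrightarrow>
     (\<forall>u. homotopic_with (\<lambda>\<gamma>. \<gamma> 0 = g (q2 0) \<and> \<gamma> 1 = g (q2 0)) (top_of_set {0..1}) torus
            (g \<circ> torus_loop (q2 0) u) (torus_loop (g (q2 0)) (L u)))"

definition bundle_section :: "int ^ 2 \<Rightarrow> real set \<Rightarrow> bundle_pt" where
  "bundle_section v b = (\<Union>t\<in>b. bundle_class (q2 (t *\<^sub>R real_vec v)) t)"

definition section_homotopic ::
    "(real set \<Rightarrow> bundle_pt) \<Rightarrow> (real set \<Rightarrow> bundle_pt) \<Rightarrow> bool" where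
  "section_homotopic s s' \<longleftrightarrow>
     homotopic_with (\<lambda>\<sigma>. \<forall>b\<in>topspace circle. bundle_proj (\<sigma> b) = b) circle torus_bundle s s'"

text \<open>\<open>v\<close> is any representative of the second component, a class in
  \<open>\<int>\<^sup>2 / (A - id) \<int>\<^sup>2\<close>.\<close>

definition classifying_pair ::
    "(bundle_pt \<Rightarrow> bundle_pt) \<Rightarrow> (int ^ 2 \<Rightarrow> int ^ 2) \<Rightarrow> int ^ 2 \<Rightarrow> bool" where
  "classifying_pair f L v \<longleftrightarrow>
     induces_on_pi1 (fiber_restriction f) L \<and>
     section_homotopic (f \<circ> bundle_section 0) (bundle_section v)"


section \<open>The selfmap of the cokernel and its orbits\<close>

definition coker_rel :: "(int ^ 2 \<Rightarrow> int ^ 2) \<Rightarrow> ((int ^ 2) \<times> (int ^ 2)) set" where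
  "coker_rel L = {(u, w). u - w \<in> range L}"

definition coker :: "(int ^ 2 \<Rightarrow> int ^ 2) \<Rightarrow> (int ^ 2) set set" where
  "coker L = UNIV // coker_rel L"

definition beta :: "(int ^ 2 \<Rightarrow> int ^ 2) \<Rightarrow> int ^ 2 \<Rightarrow> (int ^ 2) set \<Rightarrow> (int ^ 2) set" where
  "beta L v U = (\<Union>u\<in>U. coker_rel L `` {A_bar *v (u - v)})"

text \<open>The second disjunct accounts for the negative iterates of the bijection \<open>beta L v\<close>.\<close>

definition beta_orbit :: "(int ^ 2 \<Rightarrow> int ^ 2) \<Rightarrow> int ^ 2 \<Rightarrow> (int ^ 2) set \<Rightarrow> (int ^ 2) set set" where
  "beta_orbit L v U = {W \<in> coker L. \<exists>n. (beta L v ^^ n) U = W \<or> (beta L v ^^ n) W = U}"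

definition beta_orbits :: "(int ^ 2 \<Rightarrow> int ^ 2) \<Rightarrow> int ^ 2 \<Rightarrow> (int ^ 2) set set set" where
  "beta_orbits L v = beta_orbit L v ` coker L"

definition nu :: "(int ^ 2 \<Rightarrow> int ^ 2) \<Rightarrow> int ^ 2 \<Rightarrow> nat \<Rightarrow> nat" where
  "nu L v j = card {Q \<in> beta_orbits L v. card Q = j}"

definition nu_total :: "(int ^ 2 \<Rightarrow> int ^ 2) \<Rightarrow> int ^ 2 \<Rightarrow> nat" where
  "nu_total L v = nu L v 1 + nu L v 2 + nu L v 4"

definition nu_quadruple :: "(int ^ 2 \<Rightarrow> int ^ 2) \<Rightarrow> int ^ 2 \<Rightarrow> int \<times> int \<times> int \<times> int" where
  "nu_quadruple L v = (int (nu L v 1), int (nu L v 2), int (nu L v 4), int (nu_total L v))"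

end

theory Submission
  imports Defs
begin

text \<open>
  Lift \<open>f\<^sub>1, f\<^sub>2\<close> along \<open>\<real>\<^sup>2 \<times> I \<rightarrow> M\<close>. The difference \<open>G\<close> of the lifts is equivariant:
  \<open>G(x + u, t) = G(x, t) + L u\<close> and \<open>A G(x, 1) = G(A x, 0) + A v\<close>, and conversely the pair
  \<open>(L, v)\<close> determines the homotopy class of such a \<open>G\<close>, since equivariant maps with the same
  \<open>(L, v)\<close> are joined by a straight line homotopy. A coincidence is a point with
  \<open>G(x, t) = u \<in> \<int>\<^sup>2\<close>; changing the representative of the point moves \<open>[u]\<close> along its
  \<open>\<beta>\<close>-orbit. Nearby coincidences have the same label, and every label occurs on every
  fiber by Brouwer's fixed point theorem, so there are at least as many pathcomponents as
  orbits. For the affine map \<open>G(x, t) = L x + t v\<close> each orbit labels exactly one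
  pathcomponent, and for \<open>L = 0\<close> a segment that avoids \<open>\<int>\<^sup>2\<close> gives no coincidence at all.

  On Gaussian integers, \<open>\<beta>\<close> is \<open>u \<mapsto> i (u - v)\<close> modulo \<open>k + i l\<close>; since \<open>\<beta>\<^sup>4 = id\<close>, the orbit numbers
  follow from the numbers of solutions of \<open>(i - 1) u = i v\<close> and \<open>2 u = (1 - i) v\<close>.
\<close>

section \<open>Gaussian integers and the cokernel\<close>

text \<open>The vector v is not an invariant of a map. Replacing a lift G by G + w with w in the
  lattice changes v by an element of (A - id) Z^2, that is, by a vector with even coordinate sum.
  Hence a given classifying pair and a lift can only be compared through \<open>L\<close> and the
  parity of v, and the orbit numbers have to be expressed by the norm of \<open>a\<close> and this
  parity alone.

  A second obstacle is the gluing: the height t jumps where the ends of I meet, so it is not a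
  continuous function on the bundle. Continuity is therefore tested on R^2 x I, and every lift is
  taken over a prescribed continuous height. The lifts themselves are logarithms of characters of
  the torus, which exist on contractible domains.

  For the labels to survive the gluing, neighbourhoods of lattice points must be carried to
  neighbourhoods of the same size; this works because \<open>A_bar\<close> is an isometry that
  preserves the lattice.

  The orbit numbers solve a triangular system: fixed points of \<open>beta\<close> give nu_1, those
  of its square give nu_1 + 2 nu_2, and all of G gives nu_1 + 2 nu_2 + 4 nu_4.\<close>

lemma A_bar_nth [simp]:
  "(A_bar *v x) $ 1 = - (x $ 2)" "(A_bar *v x) $ 2 = x $ 1" for x :: "'a::comm_ring_1 ^ 2"
  by (simp_all add: A_bar_def matrix_vector_mult_def sum_2)

lemma vec2_eq_iff: "x = y \<longleftrightarrow> x $ 1 = y $ 1 \<and> x $ 2 = y $ 2" for x y :: "'a ^ 2"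
  by (simp add: vec_eq_iff forall_2)

lemma ex_vec2: "(\<exists>z :: 'a::zero ^ 2. P z) \<longleftrightarrow> (\<exists>x y. P (vector [x, y]))"
proof
  assume "\<exists>z. P z"
  then obtain z where "P z" ..
  moreover have "z = vector [z $ 1, z $ 2]" by (simp add: vec2_eq_iff)
  ultimately show "\<exists>x y. P (vector [x, y])" by metis
qed blast

text \<open>Inside the field of complex numbers, congruences modulo \<open>a\<close> become ring
  identities and nonzero factors can be cancelled.\<close>

definition gauss :: "int ^ 2 \<Rightarrow> complex" where
  "gauss u = Complex (of_int (u $ 1)) (of_int (u $ 2))"

definition gmul :: "int ^ 2 \<Rightarrow> int ^ 2 \<Rightarrow> int ^ 2" where
  "gmul a b = vector [a $ 1 * b $ 1 - a $ 2 * b $ 2, a $ 1 * b $ 2 + a $ 2 * b $ 1]"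

definition gnorm :: "int ^ 2 \<Rightarrow> int" where
  "gnorm a = (a $ 1)\<^sup>2 + (a $ 2)\<^sup>2"

lemma gauss_inject [simp]: "gauss u = gauss w \<longleftrightarrow> u = w"
  by (simp add: gauss_def vec2_eq_iff)

lemma gauss_eq_0_iff [simp]: "gauss u = 0 \<longleftrightarrow> u = 0"
  by (simp add: gauss_def vec2_eq_iff complex_eq_iff)

lemma gauss_simps [simp]:
  "gauss 0 = 0" "gauss (u + w) = gauss u + gauss w" "gauss (u - w) = gauss u - gauss w"
  "gauss (- u) = - gauss u" "gauss (gmul u w) = gauss u * gauss w"
  "gauss (A_bar *v u) = \<i> * gauss u"
  by (simp_all add: gauss_def gmul_def complex_eq_iff)

lemma gauss_vector: "gauss (vector [a, b]) = Complex (of_int a) (of_int b)"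
  by (simp add: gauss_def)

lemma gnorm_eq_0_iff [simp]: "gnorm a = 0 \<longleftrightarrow> a = 0"
  by (simp add: gnorm_def vec2_eq_iff sum_power2_eq_zero_iff)

lemma gnorm_nonneg [simp]: "0 \<le> gnorm a"
  by (simp add: gnorm_def)

lemma gauss_times_conj: "gauss a * gauss (vector [a $ 1, - a $ 2]) = of_int (gnorm a)"
  by (simp add: gauss_def gnorm_def complex_eq_iff power2_eq_square algebra_simps)

lemma gnorm_gmul: "gnorm (gmul a b) = gnorm a * gnorm b"
  by (simp add: gnorm_def gmul_def power2_eq_square algebra_simps)

lemma in_range_gmul: "x \<in> range (gmul a) \<longleftrightarrow> (\<exists>z. gauss x = gauss a * gauss z)"
  by (metis (no_types, opaque_lifting) gauss_inject gauss_simps(5) rangeE rangeI)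

lemma equiv_coker_rel: "equiv UNIV (coker_rel (gmul a))"
proof -
  have "x - x \<in> range (gmul a)" for x
    unfolding in_range_gmul by (auto intro: exI[of _ 0])
  moreover have "y - x \<in> range (gmul a)" if "x - y \<in> range (gmul a)" for x y
  proof -
    from that obtain z where "gauss (x - y) = gauss a * gauss z" unfolding in_range_gmul by blast
    then have "gauss (y - x) = gauss a * gauss (- z)" by (simp add: algebra_simps)
    then show ?thesis unfolding in_range_gmul by blast
  qed
  moreover have "x - z \<in> range (gmul a)"
    if "x - y \<in> range (gmul a)" "y - z \<in> range (gmul a)" for x y z
  proof -
    from that obtain p p' where "gauss (x - y) = gauss a * gauss p"
      "gauss (y - z) = gauss a * gauss p'" unfolding in_range_gmul by blast
    then have "gauss (x - z) = gauss a * gauss (p + p')" by (simp add: algebra_simps)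
    then show ?thesis unfolding in_range_gmul by blast
  qed
  ultimately show ?thesis
    unfolding equiv_def refl_on_def sym_def trans_def coker_rel_def by blast
qed

definition coker_class :: "int ^ 2 \<Rightarrow> int ^ 2 \<Rightarrow> (int ^ 2) set" where
  "coker_class a u = coker_rel (gmul a) `` {u}"

lemma coker_eq: "coker (gmul a) = range (coker_class a)"
  by (auto simp: coker_def quotient_def coker_class_def)

lemma coker_class_eq_iff: "coker_class a u = coker_class a w \<longleftrightarrow> (\<exists>z. gauss u - gauss w = gauss a * gauss z)"
proof -
  have "coker_class a u = coker_class a w \<longleftrightarrow> (u, w) \<in> coker_rel (gmul a)"
    unfolding coker_class_def using eq_equiv_class_iff[OF equiv_coker_rel] by blast
  then show ?thesis using in_range_gmul[of "u - w" a] by (simp add: coker_rel_def)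
qed

lemma in_coker_class_iff: "w \<in> coker_class a u \<longleftrightarrow> coker_class a w = coker_class a u"
  unfolding coker_class_def using eq_equiv_class_iff[OF equiv_coker_rel]
  by (metis Image_singleton_iff UNIV_I)

text \<open>Multiplication by i preserves the ideal of \<open>a\<close>, so the union in
  \<open>beta\<close> runs over copies of one single class.\<close>

lemma beta_coker_class: "beta (gmul a) v (coker_class a u) = coker_class a (A_bar *v (u - v))"
proof -
  have "coker_class a (A_bar *v (w - v)) = coker_class a (A_bar *v (u - v))" if "w \<in> coker_class a u" for w
  proof -
    from that obtain z where z: "gauss w - gauss u = gauss a * gauss z"
      unfolding in_coker_class_iff coker_class_eq_iff by blast
    have "gauss (A_bar *v (w - v)) - gauss (A_bar *v (u - v)) = gauss a * gauss (A_bar *v z)"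
      using arg_cong[OF z, of "\<lambda>x. \<i> * x"] by (simp add: algebra_simps)
    then show ?thesis unfolding coker_class_eq_iff by blast
  qed
  moreover have "u \<in> coker_class a u" by (simp add: in_coker_class_iff)
  ultimately show ?thesis unfolding beta_def coker_class_def[symmetric] by blast
qed

section \<open>The number of residue classes modulo a Gaussian integer\<close>

lemma finite_lattice_box: "finite {u :: int ^ 2. 0 \<le> u $ 1 \<and> u $ 1 < m \<and> 0 \<le> u $ 2 \<and> u $ 2 < n}"
  and card_lattice_box:
    "card {u :: int ^ 2. 0 \<le> u $ 1 \<and> u $ 1 < m \<and> 0 \<le> u $ 2 \<and> u $ 2 < n} = nat m * nat n"
proof -
  let ?S = "{u :: int ^ 2. 0 \<le> u $ 1 \<and> u $ 1 < m \<and> 0 \<le> u $ 2 \<and> u $ 2 < n}"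
  let ?f = "\<lambda>(x, y). vector [x, y] :: int ^ 2"
  have "u \<in> ?f ` ({0..<m} \<times> {0..<n})" if "u \<in> ?S" for u
    by (rule image_eqI[of _ _ "(u $ 1, u $ 2)"]) (use that in \<open>auto simp: vec2_eq_iff\<close>)
  then have eq: "?S = ?f ` ({0..<m} \<times> {0..<n})" by auto
  have inj: "inj_on ?f ({0..<m} \<times> {0..<n})"
    by (auto simp: inj_on_def vec2_eq_iff)
  show "finite ?S" unfolding eq by simp
  show "card ?S = nat m * nat n" unfolding eq card_image[OF inj] by (simp add: card_cartesian_product)
qed

text \<open>With \<open>g = gcd(k, l)\<close>, the lattice spanned by \<open>(k, l)\<close> and \<open>(-l, k)\<close> has a basis of the form
  \<open>((k\<^sup>2 + l\<^sup>2) / g, 0)\<close>, \<open>(x, g)\<close>, so a box with these sides is a set of representatives.\<close>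

lemma finite_coker_gmul: "a \<noteq> 0 \<Longrightarrow> finite (coker (gmul a))"
  and card_coker_gmul: "a \<noteq> 0 \<Longrightarrow> int (card (coker (gmul a))) = gnorm a"
proof -
  assume a: "a \<noteq> 0"
  define k l where kl: "k = a $ 1" "l = a $ 2"
  have kl0: "k \<noteq> 0 \<or> l \<noteq> 0" using a by (simp add: kl vec2_eq_iff)
  define g where "g = gcd k l"
  obtain k' l' where kl': "k = g * k'" "l = g * l'" "coprime k' l'"
    using kl0 gcd_coprime_exists[of k l] unfolding g_def by (metis gcd_eq_0_iff mult.commute)
  have gpos: "g > 0" using kl0 by (simp add: g_def)
  define M where "M = g * (k'\<^sup>2 + l'\<^sup>2)"
  have N: "gnorm a = M * g"
    by (simp add: gnorm_def kl[symmetric] kl' M_def power2_eq_square algebra_simps)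
  have "gnorm a > 0" using a gnorm_eq_0_iff[of a] gnorm_nonneg[of a] by linarith
  with N gpos have Mpos: "M > 0" by (simp add: zero_less_mult_iff)
  obtain s t where st: "l' * s + k' * t = 1"
    using \<open>coprime k' l'\<close> by (metis bezout_int coprime_iff_gcd_eq_1 gcd.commute mult.commute)
  let ?S = "{u :: int ^ 2. 0 \<le> u $ 1 \<and> u $ 1 < M \<and> 0 \<le> u $ 2 \<and> u $ 2 < g}"
  have rel: "coker_class a u = coker_class a w \<longleftrightarrow>
      (\<exists>x y. u $ 1 - w $ 1 = k * x - l * y \<and> u $ 2 - w $ 2 = k * y + l * x)" for u w
  proof -
    have "coker_class a u = coker_class a w \<longleftrightarrow> (\<exists>z. u - w = gmul a z)"
      unfolding coker_class_eq_iff by (metis gauss_inject gauss_simps(3,5))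
    also have "\<dots> \<longleftrightarrow> (\<exists>x y. u - w = gmul a (vector [x, y]))"
      by (rule ex_vec2)
    finally show ?thesis by (simp add: vec2_eq_iff gmul_def kl)
  qed
  have "inj_on (coker_class a) ?S"
  proof (rule inj_onI)
    fix u w assume uw: "u \<in> ?S" "w \<in> ?S" "coker_class a u = coker_class a w"
    then obtain x y where xy: "u $ 1 - w $ 1 = k * x - l * y" "u $ 2 - w $ 2 = k * y + l * x"
      unfolding rel by blast
    have d2: "u $ 2 - w $ 2 = g * (k' * y + l' * x)" by (simp add: xy kl' algebra_simps)
    then have "g dvd u $ 2 - w $ 2" by simp
    moreover have "\<bar>u $ 2 - w $ 2\<bar> < g" using uw by auto
    ultimately have e2: "u $ 2 = w $ 2"
      by (metis dvd_imp_le_int leD eq_iff_diff_eq_0 abs_of_pos gpos)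
    then have "g * (k' * y + l' * x) = 0" using d2 by simp
    then have z: "k' * y = - (l' * x)" using gpos by simp
    \<comment> \<open>The Bezout relation turns k' y = - l' x into a common factor: (x, y) is the
      multiple of (k', - l') by x t - y s.\<close>
    have "x = (l' * s + k' * t) * x" "y = (l' * s + k' * t) * y" by (simp_all add: st)
    with z have "x = k' * (x * t - y * s)" "y = - (l' * (x * t - y * s))" by algebra+
    then obtain m where "x = k' * m" "y = - (l' * m)" by blast
    then have "u $ 1 - w $ 1 = M * m"
      by (simp add: xy kl' M_def power2_eq_square algebra_simps)
    then have "M dvd u $ 1 - w $ 1" by simp
    moreover have "\<bar>u $ 1 - w $ 1\<bar> < M" using uw by auto
    ultimately have "u $ 1 = w $ 1"
      by (metis dvd_imp_le_int leD eq_iff_diff_eq_0 abs_of_pos Mpos)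
    with e2 show "u = w" by (simp add: vec2_eq_iff)
  qed
  moreover have "range (coker_class a) = coker_class a ` ?S"
  proof -
    have "coker_class a u \<in> coker_class a ` ?S" for u
    proof -
      \<comment> \<open>\<open>a\<close> times s + i t is the vector (k s - l t, g), and
        \<open>a\<close> times k' - i l' is (M, 0). Subtracting \<open>j\<close> copies of the first
        brings the second coordinate into the box; \<open>i\<close> copies of the second then reduce
        the first coordinate.\<close>
      define j where "j = u $ 2 div g"
      define i where "i = (u $ 1 - j * (k * s - l * t)) div M"
      define w :: "int ^ 2" where "w = vector [(u $ 1 - j * (k * s - l * t)) mod M, u $ 2 mod g]"
      have "w \<in> ?S" using gpos Mpos by (simp add: w_def)
      moreover have "coker_class a u = coker_class a w"
      proof -
        have 1: "u $ 1 - w $ 1 = j * (k * s - l * t) + M * i"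
          by (simp add: w_def i_def minus_mod_eq_mult_div [symmetric])
            
        have 2: "u $ 2 - w $ 2 = g * j * (l' * s + k' * t)"
          by (simp add: w_def j_def minus_mod_eq_mult_div st)
        have "u $ 1 - w $ 1 = k * (j * s + k' * i) - l * (j * t - l' * i)"
          unfolding 1 M_def by (simp add: kl' power2_eq_square algebra_simps)
        moreover have "u $ 2 - w $ 2 = k * (j * t - l' * i) + l * (j * s + k' * i)"
          unfolding 2 by (simp add: kl' algebra_simps)
        ultimately show ?thesis unfolding rel by blast
      qed
      ultimately show ?thesis by blast
    qed
    then show ?thesis by blast
  qed
  ultimately have *: "finite (coker (gmul a))" "card (coker (gmul a)) = nat M * nat g"
    using finite_lattice_box[of M g] card_lattice_box[of M g] by (simp_all add: coker_eq card_image)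
  then show "finite (coker (gmul a))" "int (card (coker (gmul a))) = gnorm a"
    using Mpos gpos N by simp_all
qed

section \<open>Orbits of the cokernel map\<close>

text \<open>Where the fourth iterate of \<open>b\<close> is the identity, this list is the whole
  orbit, possibly with repetitions.\<close>

definition orbit4 :: "('a \<Rightarrow> 'a) \<Rightarrow> 'a \<Rightarrow> 'a set" where
  "orbit4 b x = {x, b x, b (b x), b (b (b x))}"

context
  fixes b :: "'a \<Rightarrow> 'a" and C :: "'a set"
  assumes finC: "finite C" and bC: "\<And>x. x \<in> C \<Longrightarrow> b x \<in> C"
    and b4: "\<And>x. x \<in> C \<Longrightarrow> b (b (b (b x))) = x"
begin

lemma orbit4_eq:
  assumes "x \<in> C"
  shows "{W \<in> C. \<exists>n. (b ^^ n) x = W \<or> (b ^^ n) W = x} = orbit4 b x"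
proof -
  have fw: "(b ^^ n) y \<in> orbit4 b y" if "y \<in> C" for y n
    by (induction n) (use that b4 in \<open>auto simp: orbit4_def\<close>)
  have funC: "(b ^^ n) y \<in> C" if "y \<in> C" for y n
    by (induction n) (use that bC in auto)
  have b4n: "(b ^^ (4 * n)) y = y" if "y \<in> C" for y n
  proof (induction n)
    case (Suc n)
    have "4 * Suc n = Suc (Suc (Suc (Suc (4 * n))))" by simp
    then show ?case using Suc b4[OF that] by (simp only: funpow.simps comp_apply)
  qed simp
  have "W \<in> orbit4 b x" if "W \<in> C" "(b ^^ n) W = x" for W n
  proof -
    \<comment> \<open>A backward step equals three forward steps, so W is the iterate of order 3 n
      of x.\<close>
    have "(b ^^ (3 * n)) x = (b ^^ (3 * n + n)) W"
      using that by (simp only: funpow_add comp_apply)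
    then show ?thesis using b4n[OF \<open>W \<in> C\<close>, of n] fw[OF assms, of "3 * n"] by simp
  qed
  moreover have "\<exists>n. (b ^^ n) x = W" if "W \<in> orbit4 b x" for W
    using that unfolding orbit4_def
    by (auto intro: exI[of _ 0] exI[of _ 1] exI[of _ "Suc 1"] exI[of _ "Suc (Suc 1)"])
  moreover have "orbit4 b x \<subseteq> C" using assms bC by (auto simp: orbit4_def)
  ultimately show ?thesis using fw[OF assms] by blast
qed

lemma orbit4_cong: "x \<in> C \<Longrightarrow> y \<in> orbit4 b x \<Longrightarrow> orbit4 b y = orbit4 b x"
  using b4[of x] by (auto simp: orbit4_def)

lemma card_orbit4:
  assumes x: "x \<in> C"
  shows "card (orbit4 b x) = (if b x = x then 1 else if b (b x) = x then 2 else 4)"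
proof -
  have inj: "y = z" if "b y = b z" "y \<in> C" "z \<in> C" for y z
    using that b4 by metis
  show ?thesis
  proof (cases "b (b x) = x")
    case True
    then show ?thesis by (simp add: orbit4_def card_insert_if)
  next
    case False
    then have "b x \<noteq> x" by auto
    \<comment> \<open>Period 3 together with period 4 would force b x = x.\<close>
    moreover have "b (b (b x)) \<noteq> x" using \<open>b x \<noteq> x\<close> b4[OF x] by metis
    ultimately show ?thesis
      using False inj[of x "b x"] inj[of x "b (b x)"] inj[of "b x" "b (b x)"] x bC
      by (auto simp: orbit4_def card_insert_if)
  qed
qed

text \<open>Orbits of size \<open>j\<close> partition the set of points whose orbit has size
  \<open>j\<close>.\<close>

lemma card_orbits4:
  "j * card {Q \<in> orbit4 b ` C. card Q = j} = card {x \<in> C. card (orbit4 b x) = j}"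
proof -
  let ?S = "{Q \<in> orbit4 b ` C. card Q = j}"
  have sub: "x \<in> C" "x \<in> orbit4 b x" if "Q \<in> ?S" "x \<in> Q" for Q x
    using that bC by (auto simp: orbit4_def)
  have U: "\<Union>?S = {x \<in> C. card (orbit4 b x) = j}"
  proof (intro equalityI subsetI)
    fix x assume "x \<in> \<Union>?S"
    then obtain y where "y \<in> C" "x \<in> orbit4 b y" "card (orbit4 b y) = j" by auto
    then show "x \<in> {x \<in> C. card (orbit4 b x) = j}"
      using orbit4_cong[of y x] bC by (auto simp: orbit4_def)
  next
    fix x assume "x \<in> {x \<in> C. card (orbit4 b x) = j}"
    then show "x \<in> \<Union>?S" by (auto simp: orbit4_def)
  qed
  have "finite ?S" using finC by simp
  moreover have "finite (\<Union>?S)" unfolding U using finC by simp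
  moreover have "c1 \<inter> c2 = {}" if "c1 \<in> ?S" "c2 \<in> ?S" "c1 \<noteq> c2" for c1 c2
    using that orbit4_cong by blast
  ultimately have "j * card ?S = card (\<Union>?S)"
    by (intro card_partition) auto
  then show ?thesis unfolding U .
qed

text \<open>Points are easier to count than orbits. A point is fixed by b exactly if its orbit has
  size 1, and by b^2 exactly if the size is 1 or 2, so three point counts determine the three orbit
  numbers.\<close>

lemma orbit_counts:
  fixes orb defines "orb \<equiv> \<lambda>x. {W \<in> C. \<exists>n. (b ^^ n) x = W \<or> (b ^^ n) W = x}"
  defines "N \<equiv> \<lambda>j. card {Q \<in> orb ` C. card Q = j}"
  shows "\<And>Q. Q \<in> orb ` C \<Longrightarrow> card Q \<in> {1, 2, 4}"
    and "N 1 = card {x \<in> C. b x = x}"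
    and "N 1 + 2 * N 2 = card {x \<in> C. b (b x) = x}"
    and "N 1 + 2 * N 2 + 4 * N 4 = card C"
    and "card (orb ` C) = N 1 + N 2 + N 4"
proof -
  have im: "orb ` C = orbit4 b ` C" unfolding orb_def using orbit4_eq by (rule image_cong[OF refl])
  show Q: "card Q \<in> {1, 2, 4}" if "Q \<in> orb ` C" for Q
    using that card_orbit4 unfolding im by (auto split: if_splits)
  have N: "j * N j = card {x \<in> C. card (orbit4 b x) = j}" for j
    unfolding N_def im by (rule card_orbits4)
  have "{x \<in> C. card (orbit4 b x) = 1} = {x \<in> C. b x = x}" by (auto simp: card_orbit4 split: if_splits)
  with N[of 1] show 1: "N 1 = card {x \<in> C. b x = x}" by simp
  have "{x \<in> C. card (orbit4 b x) = 2} = {x \<in> C. b (b x) = x} - {x \<in> C. b x = x}"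
    by (auto simp: card_orbit4 split: if_splits)
  moreover have sub: "{x \<in> C. b x = x} \<subseteq> {x \<in> C. b (b x) = x}" by auto
  ultimately show 2: "N 1 + 2 * N 2 = card {x \<in> C. b (b x) = x}"
    using N[of 2] 1 finC card_mono[OF _ sub] by (simp add: card_Diff_subset)
  have "{x \<in> C. card (orbit4 b x) = 4} = C - {x \<in> C. b (b x) = x}"
    by (auto simp: card_orbit4 split: if_splits)
  moreover have sub': "{x \<in> C. b (b x) = x} \<subseteq> C" by auto
  ultimately show "N 1 + 2 * N 2 + 4 * N 4 = card C"
    using N[of 4] 2 finC card_mono[OF finC sub'] by (simp add: card_Diff_subset)
  have "orb ` C = {Q \<in> orb ` C. card Q = 1} \<union> ({Q \<in> orb ` C. card Q = 2} \<union> {Q \<in> orb ` C. card Q = 4})"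
    using Q by blast
  also have "card \<dots> = N 1 + (N 2 + N 4)"
    unfolding N_def using finC by (subst card_Un_disjoint; (subst card_Un_disjoint)?) auto
  finally show "card (orb ` C) = N 1 + N 2 + N 4" by simp
qed

end

section \<open>Fixed points of \<open>beta\<close> and of its square\<close>

lemma card_range_eq:
  assumes "\<And>x y. f x = f y \<longleftrightarrow> g x = g y"
  shows "card (range f) = card (range g)"
proof -
  have "bij_betw (\<lambda>y. g (inv f y)) (range f) (range g)"
    unfolding bij_betw_def inj_on_def
    using assms by (auto simp: image_iff) (metis f_inv_into_f rangeI)+
  then show ?thesis by (rule bij_betw_same_card)
qed

text \<open>Modulo a = d m, the coset of u0 modulo m is parametrised by u0 + m z, and z matters only
  modulo d. The solution sets of the fixed point equations below are such cosets.\<close>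

lemma card_coker_class_translate:
  assumes "a \<noteq> 0" and a: "a = gmul d m"
  shows "int (card (coker_class a ` {u. \<exists>z. gauss u - gauss u0 = gauss m * gauss z})) = gnorm d"
proof -
  have nz: "gauss d * gauss m \<noteq> 0" using assms by (metis gauss_eq_0_iff gauss_simps(5))
  then have "d \<noteq> 0" by auto
  have "(\<exists>z. gauss u - gauss u0 = gauss m * gauss z) \<longleftrightarrow> (\<exists>z. u = u0 + gmul m z)" for u
    by (metis add_diff_cancel_left' gauss_inject gauss_simps(2,3,5) diff_add_cancel add.commute)
  then have "coker_class a ` {u. \<exists>z. gauss u - gauss u0 = gauss m * gauss z} = range (\<lambda>z. coker_class a (u0 + gmul m z))"
    by auto
  also have "card \<dots> = card (range (coker_class d))"
  proof (rule card_range_eq)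
    fix x y
    have "gauss m * gauss x - gauss m * gauss y = gauss d * gauss m * gauss z \<longleftrightarrow>
      gauss x - gauss y = gauss d * gauss z" for z
    proof -
      have "gauss m * gauss x - gauss m * gauss y - gauss d * gauss m * gauss z
        = gauss m * (gauss x - gauss y - gauss d * gauss z)" by (simp add: algebra_simps)
      then show ?thesis using nz by (metis eq_iff_diff_eq_0 mult_eq_0_iff)
    qed
    then show "coker_class a (u0 + gmul m x) = coker_class a (u0 + gmul m y) \<longleftrightarrow> coker_class d x = coker_class d y"
      by (simp add: coker_class_eq_iff a)
  qed
  finally show ?thesis using card_coker_gmul[OF \<open>d \<noteq> 0\<close>] by (simp add: coker_eq)
qed

lemma fixed_coker_class:
  "{U \<in> coker (gmul a). beta (gmul a) v U = U} =
     coker_class a ` {u. \<exists>z. (\<i> - 1) * gauss u - \<i> * gauss v = gauss a * gauss z}"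
proof -
  have "beta (gmul a) v (coker_class a u) = coker_class a u \<longleftrightarrow>
      (\<exists>z. (\<i> - 1) * gauss u - \<i> * gauss v = gauss a * gauss z)" for u
    by (simp add: beta_coker_class coker_class_eq_iff algebra_simps)
  then show ?thesis by (auto simp: coker_eq)
qed

text \<open>The square of \<open>beta\<close> is the point reflection sending u to (1 - i) v - u, so
  its fixed points are governed by division by 2.\<close>

lemma fixed2_coker_class:
  "{U \<in> coker (gmul a). beta (gmul a) v (beta (gmul a) v U) = U} =
     coker_class a ` {u. \<exists>z. (1 - \<i>) * gauss v - 2 * gauss u = gauss a * gauss z}"
proof -
  have "gauss (A_bar *v (A_bar *v (u - v) - v)) - gauss u = (1 - \<i>) * gauss v - 2 * gauss u" for u
    by (simp add: algebra_simps)
  then have "beta (gmul a) v (beta (gmul a) v (coker_class a u)) = coker_class a u \<longleftrightarrow>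
      (\<exists>z. (1 - \<i>) * gauss v - 2 * gauss u = gauss a * gauss z)" for u
    by (simp only: beta_coker_class coker_class_eq_iff)
  then show ?thesis by (auto simp: coker_eq)
qed

lemma beta_in_coker: "U \<in> coker (gmul a) \<Longrightarrow> beta (gmul a) v U \<in> coker (gmul a)"
  by (auto simp: coker_eq beta_coker_class)

text \<open>The translation part of the fourth iterate is a multiple of 1 + i + i^2 + i^3 =
  0.\<close>

lemma beta_period4:
  assumes "U \<in> coker (gmul a)"
  shows "beta (gmul a) v (beta (gmul a) v (beta (gmul a) v (beta (gmul a) v U))) = U"
proof -
  obtain u where U: "U = coker_class a u" using assms by (auto simp: coker_eq)
  have "gauss (A_bar *v (A_bar *v (A_bar *v (A_bar *v (u - v) - v) - v) - v)) = gauss u"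
    by (simp add: algebra_simps)
  then show ?thesis by (simp only: U beta_coker_class gauss_inject)
qed

text \<open>\<open>e d = -2 m = 1 - N(a)\<close> makes \<open>e\<close> an inverse of \<open>d\<close> modulo \<open>a\<close>.\<close>

lemma solve_odd_norm:
  assumes N: "gnorm a = 2 * m + 1" and ed: "e * d = - 2 * of_int m"
    and e: "e = gauss e'" and d: "d = gauss d'"
  shows "(\<exists>z. d * gauss u - gauss w = gauss a * gauss z) \<longleftrightarrow>
    (\<exists>z. gauss u - gauss (gmul e' w) = gauss a * gauss z)"
proof -
  define s :: "int ^ 2" where "s = - vector [a $ 1, - a $ 2]"
  have "gauss a * gauss s = - of_int (gnorm a)"
    unfolding s_def using gauss_times_conj[of a] by simp
  then have eds: "e * d = 1 + gauss a * gauss s" unfolding N ed by simp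
  show ?thesis
  proof
    assume "\<exists>z. d * gauss u - gauss w = gauss a * gauss z"
    then obtain z where "d * gauss u - gauss w = gauss a * gauss z" ..
    then have w: "gauss w = d * gauss u - gauss a * gauss z" by (simp add: algebra_simps)
    have "gauss u - e * gauss w = gauss u - (e * d) * gauss u + gauss a * (e * gauss z)"
      unfolding w by (simp add: algebra_simps)
    then have "gauss u - gauss (gmul e' w) = gauss a * gauss (gmul e' z - gmul s u)"
      unfolding eds by (simp add: e algebra_simps)
    then show "\<exists>z. gauss u - gauss (gmul e' w) = gauss a * gauss z" ..
  next
    assume "\<exists>z. gauss u - gauss (gmul e' w) = gauss a * gauss z"
    then obtain z where "gauss u - gauss (gmul e' w) = gauss a * gauss z" ..
    then have u: "gauss u = e * gauss w + gauss a * gauss z" by (simp add: e algebra_simps)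
    have "d * gauss u - gauss w = (e * d) * gauss w - gauss w + gauss a * (d * gauss z)"
      unfolding u by (simp add: algebra_simps)
    then have "d * gauss u - gauss w = gauss a * gauss (gmul s w + gmul d' z)"
      unfolding eds by (simp add: d algebra_simps)
    then show "\<exists>z. d * gauss u - gauss w = gauss a * gauss z" ..
  qed
qed

lemma even_gnorm_iff: "even (gnorm a) \<longleftrightarrow> even (a $ 1 + a $ 2)"
  by (simp add: gnorm_def)

text \<open>Modulo i - 1 the Gaussian integers become the field with two elements; i reduces to 1,
  so x + i y reduces to x + y.\<close>

lemma even_sum_iff_dvd: "even (w $ 1 + w $ 2) \<longleftrightarrow> (\<exists>z. gauss w = (\<i> - 1) * gauss z)"
proof
  assume "even (w $ 1 + w $ 2)"
  then have "2 dvd w $ 2 - w $ 1" "2 dvd w $ 1 + w $ 2" by presburger+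
  then obtain x y where xy: "w $ 2 - w $ 1 = 2 * x" "w $ 1 + w $ 2 = 2 * y"
    by (elim dvdE)
  then have "w $ 1 = y - x" "w $ 2 = x + y" by auto
  \<comment> \<open>Dividing by i - 1 means multiplying by -(1 + i) / 2, which produces the
    coordinates x and - y.\<close>
  then have "gauss w = (\<i> - 1) * gauss (vector [x, - y])"
    by (simp add: gauss_vector complex_eq_iff gauss_def)
  then show "\<exists>z. gauss w = (\<i> - 1) * gauss z" ..
next
  assume "\<exists>z. gauss w = (\<i> - 1) * gauss z"
  then obtain z where "gauss w = (\<i> - 1) * gauss z" ..
  then have "real_of_int (w $ 1) = of_int (- z $ 1 - z $ 2)" "real_of_int (w $ 2) = of_int (z $ 1 - z $ 2)"
    by (auto simp add: complex_eq_iff gauss_def)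
  then have "w $ 1 = - z $ 1 - z $ 2" "w $ 2 = z $ 1 - z $ 2" by linarith+
  then show "even (w $ 1 + w $ 2)" by simp
qed

text \<open>An even norm means coordinates of equal parity, and two odd coordinates would give norm
  2 modulo 4.\<close>

lemma gnorm_mod4_eq_0:
  assumes "gnorm a = 4 * q"
  obtains m where "gauss a = 2 * gauss m"
proof -
  have 1: "even (a $ 1 + a $ 2)" using even_gnorm_iff[of a] assms by simp
  have "even (a $ 1) \<and> even (a $ 2)"
  proof (rule ccontr)
    assume "\<not> ?thesis"
    with 1 have "odd (a $ 1)" "odd (a $ 2)" by auto
    then obtain x y where "a $ 1 = 2 * x + 1" "a $ 2 = 2 * y + 1" by (auto elim!: oddE)
    then have "gnorm a = 4 * (x * x + x + y * y + y) + 2"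
      by (simp add: gnorm_def power2_eq_square algebra_simps)
    then show False using assms by presburger
  qed
  then obtain x y where "a $ 1 = 2 * x" "a $ 2 = 2 * y" by (auto elim!: evenE)
  then have "gauss a = 2 * gauss (vector [x, y])" by (simp add: gauss_def complex_eq_iff)
  then show thesis by (rule that)
qed

lemma gauss_consts:
  "gauss (vector [1, 0]) = 1" "gauss (vector [-1, 1]) = \<i> - 1" "gauss (vector [2, 0]) = 2"
  "gauss (vector [1, 1]) = 1 + \<i>"
  by (simp_all add: gauss_vector complex_eq_iff)

text \<open>For odd norm, i - 1 is invertible modulo \<open>a\<close> and the solution is unique.
  For even norm, i - 1 divides \<open>a\<close>, hence must divide v; the solutions then form a
  coset of a / (i - 1), and this coset meets as many classes as the norm of i - 1, which is
  2.\<close>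

lemma card_fixed:
  assumes a: "a \<noteq> 0"
  shows "int (card {U \<in> coker (gmul a). beta (gmul a) v U = U}) =
    (if odd (gnorm a) then 1 else if even (v $ 1 + v $ 2) then 2 else 0)"
proof (cases "odd (gnorm a)")
  case True
  then obtain m where m: "gnorm a = 2 * m + 1" by (auto elim: oddE)
  have "(\<exists>z. (\<i> - 1) * gauss u - \<i> * gauss v = gauss a * gauss z) \<longleftrightarrow>
      (\<exists>z. gauss u - gauss (gmul (vector [m, m]) (A_bar *v v)) = gauss a * gauss z)" for u
  proof -
    have "(\<exists>z. (\<i> - 1) * gauss u - gauss (A_bar *v v) = gauss a * gauss z) \<longleftrightarrow>
      (\<exists>z. gauss u - gauss (gmul (vector [m, m]) (A_bar *v v)) = gauss a * gauss z)"
      \<comment> \<open>The inverse of i - 1 comes from (m + i m) (i - 1) = - 2 m.\<close>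
      by (rule solve_odd_norm[OF m, of "gauss (vector [m, m])" _ _ "vector [-1, 1]"])
        (simp_all add: gauss_vector complex_eq_iff)
    then show ?thesis by simp
  qed
  moreover have "a = gmul (vector [1, 0]) a" by (simp add: gmul_def vec2_eq_iff)
  ultimately show ?thesis
    unfolding fixed_coker_class using True card_coker_class_translate[OF a, of "vector [1, 0]" a]
    by (simp add: gnorm_def del: gauss_simps)
next
  case False
  then obtain m where m: "gauss a = (\<i> - 1) * gauss m"
    using even_sum_iff_dvd[of a] even_gnorm_iff by blast
  show ?thesis
  proof (cases "even (v $ 1 + v $ 2)")
    case True
    then obtain w where w: "gauss v = (\<i> - 1) * gauss w" using even_sum_iff_dvd by blast
    have "(\<i> - 1) * gauss u - \<i> * gauss v = gauss a * gauss z \<longleftrightarrow>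
       gauss u - gauss (A_bar *v w) = gauss m * gauss z" for u z
    proof -
      have "(\<i> - 1) * gauss u - \<i> * gauss v - gauss a * gauss z =
        (\<i> - 1) * (gauss u - gauss (A_bar *v w) - gauss m * gauss z)"
        by (simp add: m w algebra_simps)
      moreover have "\<i> - 1 \<noteq> 0" by (simp add: complex_eq_iff)
      ultimately show ?thesis by (metis eq_iff_diff_eq_0 mult_eq_0_iff)
    qed
    moreover have "a = gmul (vector [-1, 1]) m"
      unfolding gauss_inject[symmetric] by (simp only: gauss_simps(5) gauss_consts m)
    ultimately show ?thesis
      unfolding fixed_coker_class using True False card_coker_class_translate[OF a, of "vector [-1, 1]" m]
      by (simp add: gnorm_def del: gauss_simps)
  next
    case odd: False
    have "(\<i> - 1) * gauss u - \<i> * gauss v \<noteq> gauss a * gauss z" for u z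
    proof
      assume "(\<i> - 1) * gauss u - \<i> * gauss v = gauss a * gauss z"
      then have "\<i> * gauss v = (\<i> - 1) * (gauss u - gauss m * gauss z)"
        by (simp add: m algebra_simps)
      then have "- (\<i> * (\<i> * gauss v)) = - (\<i> * ((\<i> - 1) * (gauss u - gauss m * gauss z)))" by simp
      then have "gauss v = (\<i> - 1) * gauss (- (A_bar *v (u - gmul m z)))"
        by (simp add: algebra_simps)
      then show False using odd even_sum_iff_dvd by blast
    qed
    then have "{U \<in> coker (gmul a). beta (gmul a) v U = U} = {}" unfolding fixed_coker_class by simp
    then show ?thesis using False odd by (simp only: card.empty) simp
  qed
qed

text \<open>For odd norm, 2 is invertible modulo \<open>a\<close>. For norm 2 modulo 4, cancelling i
  - 1 from 2 and from a = (i - 1) m leaves (1 + i) u = v modulo m, where m has odd norm, so one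
  class modulo m and two modulo \<open>a\<close>. For norm divisible by 4, a = 2 m, so 2 must divide
  (1 - i) v, which is the parity condition on v; the solutions form a coset of m, and 2 has norm
  4.\<close>

lemma card_fixed2:
  assumes a: "a \<noteq> 0"
  shows "int (card {U \<in> coker (gmul a). beta (gmul a) v (beta (gmul a) v U) = U}) =
    (if odd (gnorm a) then 1 else if \<not> 4 dvd gnorm a then 2
     else if even (v $ 1 + v $ 2) then 4 else 0)"
proof (cases "odd (gnorm a)")
  case True
  then obtain m where m: "gnorm a = 2 * m + 1" by (auto elim: oddE)
  let ?w = "gmul (vector [-1, 1]) v"
  have "(\<exists>z. (1 - \<i>) * gauss v - 2 * gauss u = gauss a * gauss z) \<longleftrightarrow>
      (\<exists>z. gauss u - gauss (gmul (vector [m, 0]) ?w) = gauss a * gauss z)" for u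
  proof -
    have "(\<exists>z. - 2 * gauss u - gauss ?w = gauss a * gauss z) \<longleftrightarrow>
      (\<exists>z. gauss u - gauss (gmul (vector [m, 0]) ?w) = gauss a * gauss z)"
      \<comment> \<open>Inverting - 2 rather than 2 gives the required product - 2 m with the plain
        factor m.\<close>
      by (rule solve_odd_norm[OF m, of "gauss (vector [m, 0])" _ _ "vector [-2, 0]"])
        (simp_all add: gauss_vector complex_eq_iff)
    moreover have "- 2 * gauss u - gauss ?w = (1 - \<i>) * gauss v - 2 * gauss u"
      by (simp add: gauss_consts algebra_simps)
    ultimately show ?thesis by metis
  qed
  moreover have "a = gmul (vector [1, 0]) a" by (simp add: gmul_def vec2_eq_iff)
  ultimately show ?thesis
    unfolding fixed2_coker_class using True card_coker_class_translate[OF a, of "vector [1, 0]" a]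
    by (simp add: gnorm_def del: gauss_simps)
next
  case even: False
  show ?thesis
  proof (cases "4 dvd gnorm a")
    case False
    obtain m where m: "gauss a = (\<i> - 1) * gauss m"
      using even even_sum_iff_dvd[of a] even_gnorm_iff by blast
    then have am: "a = gmul (vector [-1, 1]) m"
      unfolding gauss_inject[symmetric] by (simp only: gauss_simps(5) gauss_consts)
    then have "gnorm a = 2 * gnorm m" by (simp add: gnorm_gmul) (simp add: gnorm_def)
    then have "odd (gnorm m)" using False by presburger
    then obtain n where n: "gnorm m = 2 * n + 1" by (auto elim: oddE)
    have "(1 - \<i>) * gauss v - 2 * gauss u = gauss a * gauss z \<longleftrightarrow>
        (1 + \<i>) * gauss u - gauss v = gauss m * gauss z" for u z
    proof -
      have "(1 - \<i>) * gauss v - 2 * gauss u - gauss a * gauss z =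
        (\<i> - 1) * ((1 + \<i>) * gauss u - gauss v - gauss m * gauss z)"
        by (simp add: m algebra_simps)
      moreover have "\<i> - 1 \<noteq> 0" by (simp add: complex_eq_iff)
      ultimately show ?thesis by (metis eq_iff_diff_eq_0 mult_eq_0_iff)
    qed
    moreover have "(\<exists>z. (1 + \<i>) * gauss u - gauss v = gauss m * gauss z) \<longleftrightarrow>
      (\<exists>z. gauss u - gauss (gmul (vector [- n, n]) v) = gauss m * gauss z)" for u
      \<comment> \<open>Modulo m the inverse of 1 + i comes from (- n + i n) (1 + i) = - 2
        n.\<close>
      by (rule solve_odd_norm[OF n, of "gauss (vector [- n, n])" _ _ "vector [1, 1]"])
        (simp_all add: gauss_vector complex_eq_iff)
    ultimately show ?thesis
      unfolding fixed2_coker_class using even False card_coker_class_translate[OF a am]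
      by (simp add: gnorm_def del: gauss_simps)
  next
    case True
    then obtain q where "gnorm a = 4 * q" by blast
    then obtain m where m: "gauss a = 2 * gauss m" by (rule gnorm_mod4_eq_0)
    have am: "a = gmul (vector [2, 0]) m"
      unfolding gauss_inject[symmetric] by (simp only: gauss_simps(5) gauss_consts m)
    show ?thesis
    proof (cases "even (v $ 1 + v $ 2)")
      case ev: True
      then obtain w where w: "gauss v = (\<i> - 1) * gauss w" using even_sum_iff_dvd by blast
      have "(1 - \<i>) * gauss v - 2 * gauss u = gauss a * gauss z \<longleftrightarrow>
         gauss u - gauss (A_bar *v w) = gauss m * gauss (- z)" for u z
      proof -
        have "(1 - \<i>) * gauss v - 2 * gauss u - gauss a * gauss z =
          (- 2) * (gauss u - gauss (A_bar *v w) - gauss m * gauss (- z))"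
          by (simp add: m w algebra_simps)
        then show ?thesis by (metis eq_iff_diff_eq_0 mult_eq_0_iff neg_equal_0_iff_equal zero_neq_numeral)
      qed
      then have "(\<exists>z. (1 - \<i>) * gauss v - 2 * gauss u = gauss a * gauss z) \<longleftrightarrow>
        (\<exists>z. gauss u - gauss (A_bar *v w) = gauss m * gauss z)" for u
        by (metis minus_minus)
      then show ?thesis
        unfolding fixed2_coker_class using True even ev card_coker_class_translate[OF a am]
        by (simp add: gnorm_def del: gauss_simps)
    next
      case odd: False
      have "(1 - \<i>) * gauss v - 2 * gauss u \<noteq> gauss a * gauss z" for u z
      proof
        assume "(1 - \<i>) * gauss v - 2 * gauss u = gauss a * gauss z"
        then have "(1 - \<i>) * gauss v = 2 * (gauss u + gauss m * gauss z)"
          by (simp add: m algebra_simps)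
        \<comment> \<open>Since (1 + i) (1 - i) = 2, this factor makes both sides divisible by 2 and
          exposes i - 1 as a divisor of v.\<close>
        then have "(1 + \<i>) * ((1 - \<i>) * gauss v) = (1 + \<i>) * (2 * (gauss u + gauss m * gauss z))" by simp
        then have "2 * gauss v = 2 * ((1 + \<i>) * (gauss u + gauss m * gauss z))"
          by (simp add: algebra_simps)
        then have "gauss v = (1 + \<i>) * (gauss u + gauss m * gauss z)"
          by (simp only: mult_cancel_left) simp
        then have "gauss v = (\<i> - 1) * gauss (- (A_bar *v (u + gmul m z)))"
          by (simp add: algebra_simps)
        then show False using odd even_sum_iff_dvd by blast
      qed
      then have "{U \<in> coker (gmul a). beta (gmul a) v (beta (gmul a) v U) = U} = {}"
        unfolding fixed2_coker_class by simp
      then show ?thesis using even odd True by (simp only: card.empty) simp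
    qed
  qed
qed

section \<open>The orbit numbers of \<open>beta\<close>\<close>

lemma
  assumes a: "a \<noteq> 0"
  shows card_beta_orbit: "Q \<in> beta_orbits (gmul a) v \<Longrightarrow> card Q \<in> {1, 2, 4}"
    and card_beta_orbits: "card (beta_orbits (gmul a) v) = nu_total (gmul a) v"
    and finite_beta_orbits: "finite (beta_orbits (gmul a) v)"
    and nu_1: "int (nu (gmul a) v 1) =
      (if odd (gnorm a) then 1 else if even (v $ 1 + v $ 2) then 2 else 0)"
    and nu_2: "int (nu (gmul a) v 1) + 2 * int (nu (gmul a) v 2) =
      (if odd (gnorm a) then 1 else if \<not> 4 dvd gnorm a then 2
       else if even (v $ 1 + v $ 2) then 4 else 0)"
    and nu_4: "int (nu (gmul a) v 1) + 2 * int (nu (gmul a) v 2) + 4 * int (nu (gmul a) v 4) = gnorm a"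
proof -
  have "beta_orbit (gmul a) v = (\<lambda>x. {W \<in> coker (gmul a).
     \<exists>n. (beta (gmul a) v ^^ n) x = W \<or> (beta (gmul a) v ^^ n) W = x})"
    by (simp add: beta_orbit_def fun_eq_iff)
  note * = orbit_counts[OF finite_coker_gmul[OF a] beta_in_coker[where v = v] beta_period4[where v = v],
    folded this, folded beta_orbits_def, folded nu_def]
  show "Q \<in> beta_orbits (gmul a) v \<Longrightarrow> card Q \<in> {1, 2, 4}"
    by (rule *(1))
  show "card (beta_orbits (gmul a) v) = nu_total (gmul a) v"
    unfolding nu_total_def by (rule *(5))
  show "finite (beta_orbits (gmul a) v)"
    unfolding beta_orbits_def using finite_coker_gmul[OF a] by simp
  have "int (nu (gmul a) v 1) = int (card {U \<in> coker (gmul a). beta (gmul a) v U = U})"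
    by (subst *(2)) simp_all
  then show "int (nu (gmul a) v 1) =
      (if odd (gnorm a) then 1 else if even (v $ 1 + v $ 2) then 2 else 0)"
    unfolding card_fixed[OF a] .
  have "int (nu (gmul a) v 1 + 2 * nu (gmul a) v 2) =
    int (card {U \<in> coker (gmul a). beta (gmul a) v (beta (gmul a) v U) = U})"
    by (subst *(3)) simp_all
  then show "int (nu (gmul a) v 1) + 2 * int (nu (gmul a) v 2) =
      (if odd (gnorm a) then 1 else if \<not> 4 dvd gnorm a then 2
       else if even (v $ 1 + v $ 2) then 4 else 0)"
    unfolding card_fixed2[OF a] by simp
  have "int (nu (gmul a) v 1 + 2 * nu (gmul a) v 2 + 4 * nu (gmul a) v 4) = int (card (coker (gmul a)))"
    by (subst *(4)) simp_all
  then show "int (nu (gmul a) v 1) + 2 * int (nu (gmul a) v 2) + 4 * int (nu (gmul a) v 4) = gnorm a"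
    unfolding card_coker_gmul[OF a] by simp
qed

lemma nu_quadruple_gmul:
  assumes "a \<noteq> 0"
  shows "gnorm a = 4 * q \<Longrightarrow> nu_quadruple (gmul a) v =
      (if even (v $ 1 + v $ 2) then (2, 1, q - 1, q + 2) else (0, 0, q, q))"
    and "gnorm a = 4 * q + 1 \<Longrightarrow> nu_quadruple (gmul a) v = (1, 0, q, q + 1)"
    and "gnorm a = 4 * q + 2 \<Longrightarrow> nu_quadruple (gmul a) v =
      (if even (v $ 1 + v $ 2) then (2, 0, q, q + 2) else (0, 1, q, q + 1))"
  using nu_1[OF assms, of v] nu_2[OF assms, of v] nu_4[OF assms, of v]
  unfolding nu_quadruple_def nu_total_def
  by (auto split: if_splits; presburger)+

lemma odd_beta_orbit:
  assumes a: "a \<noteq> 0" and Q: "Q \<in> beta_orbits (gmul a) v" and "odd (card Q)"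
  shows "\<exists>U\<in>coker (gmul a). Q = {U} \<and> beta (gmul a) v U = U"
proof -
  obtain U where U: "U \<in> coker (gmul a)" "Q = beta_orbit (gmul a) v U"
    using Q by (auto simp: beta_orbits_def)
  have "card Q = 1" using card_beta_orbit[OF a Q] \<open>odd (card Q)\<close> by auto
  then obtain W where W: "Q = {W}" by (auto simp: card_1_singleton_iff)
  have "(beta (gmul a) v ^^ 0) U = U" "(beta (gmul a) v ^^ 1) U = beta (gmul a) v U" by simp_all
  then have "U \<in> Q" "beta (gmul a) v U \<in> Q"
    unfolding U(2) beta_orbit_def using U(1) beta_in_coker by blast+
  then have "U = W" "beta (gmul a) v U = W" unfolding W by blast+
  then show ?thesis using U(1) W by auto
qed

text \<open>Norm and parity fix the right-hand sides of the triangular system.\<close>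

lemma nu_quadruple_cong:
  assumes "a \<noteq> 0" "b \<noteq> 0" "gnorm a = gnorm b" "even (v $ 1 + v $ 2) \<longleftrightarrow> even (w $ 1 + w $ 2)"
  shows "nu_quadruple (gmul a) v = nu_quadruple (gmul b) w"
proof -
  have 1: "int (nu (gmul a) v 1) = int (nu (gmul b) w 1)"
    using assms(3,4) unfolding nu_1[OF assms(1)] nu_1[OF assms(2)] by (simp only:)
  have "int (nu (gmul a) v 1) + 2 * int (nu (gmul a) v 2) = int (nu (gmul b) w 1) + 2 * int (nu (gmul b) w 2)"
    using assms(3,4) unfolding nu_2[OF assms(1)] nu_2[OF assms(2)] by (simp only:)
  with 1 have 2: "int (nu (gmul a) v 2) = int (nu (gmul b) w 2)" by linarith
  have 4: "int (nu (gmul a) v 4) = int (nu (gmul b) w 4)"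
    using nu_4[OF assms(1), of v] nu_4[OF assms(2), of w] 1 2 assms(3) by linarith
  show ?thesis unfolding nu_quadruple_def nu_total_def of_nat_add 1 2 4 ..
qed

text \<open>A lift comes with its own lattice vector, which agrees with the given one only in
  parity; this transfers the count between the two.\<close>

lemma card_beta_orbits_cong:
  assumes "a \<noteq> 0" "even (v $ 1 + v $ 2) \<longleftrightarrow> even (w $ 1 + w $ 2)"
  shows "card (beta_orbits (gmul a) v) = nu_total (gmul a) w"
  using nu_quadruple_cong[OF assms(1) assms(1) refl assms(2)] card_beta_orbits[OF assms(1), of v]
  by (simp add: nu_quadruple_def)

section \<open>Points of the bundle\<close>

lemma continuous_on_vec2:
  assumes "continuous_on S f" "continuous_on S g"
  shows "continuous_on S (\<lambda>x. vector [f x, g x] :: real ^ 2)"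
proof -
  have eq: "(\<lambda>x. vector [f x, g x] :: real ^ 2) = (\<lambda>x. \<chi> i. if i = 1 then f x else g x)"
    by (auto simp: vec2_eq_iff fun_eq_iff)
  show ?thesis
    unfolding eq
  proof (rule continuous_on_vec_lambda)
    show "continuous_on S (\<lambda>x. if i = 1 then f x else g x)" for i :: 2
      using assms by (cases "i = 1") simp_all
  qed
qed

lemma real_vec_nth [simp]: "real_vec u $ i = of_int (u $ i)"
  by (simp add: real_vec_def)

lemma real_vec_simps [simp]:
  "real_vec 0 = 0" "real_vec (u + w) = real_vec u + real_vec w"
  "real_vec (u - w) = real_vec u - real_vec w" "real_vec (- u) = - real_vec u"
  "real_vec (A_bar *v u) = A_bar *v real_vec u"
  by (simp_all add: vec2_eq_iff)

lemma real_vec_inject [simp]: "real_vec u = real_vec w \<longleftrightarrow> u = w"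
  by (simp add: vec2_eq_iff)

lemma A_bar_distribs [simp]:
  "A_bar *v (x + y) = A_bar *v x + A_bar *v y" "A_bar *v (x - y) = A_bar *v x - A_bar *v y"
  "A_bar *v (- x) = - (A_bar *v x)" "A_bar *v 0 = 0"
  for x y :: "'a::comm_ring_1 ^ 2"
  by (simp_all add: vec2_eq_iff)

lemma A_bar_scaleR [simp]: "A_bar *v (c *\<^sub>R x) = c *\<^sub>R (A_bar *v x)" for x :: "real ^ 2"
  by (simp add: vec2_eq_iff)

lemma A_bar_pow4: "A_bar *v (A_bar *v (A_bar *v (A_bar *v x))) = x" for x :: "'a::comm_ring_1 ^ 2"
  by (simp add: vec2_eq_iff)

text \<open>The inverse of \<open>A_bar\<close> is its cube, again an integer matrix.\<close>

lemma A_bar_lattice_iff: "A_bar *v x \<in> range real_vec \<longleftrightarrow> x \<in> range real_vec"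
proof
  assume "A_bar *v x \<in> range real_vec"
  then obtain u where "A_bar *v x = real_vec u" by blast
  then have "A_bar *v (A_bar *v (A_bar *v (A_bar *v x))) = A_bar *v (A_bar *v (A_bar *v real_vec u))"
    by simp
  then have "x = real_vec (A_bar *v (A_bar *v (A_bar *v u)))" by (simp only: A_bar_pow4 real_vec_simps)
  then show "x \<in> range real_vec" by blast
next
  assume "x \<in> range real_vec"
  then obtain u where "x = real_vec u" by blast
  then have "A_bar *v x = real_vec (A_bar *v u)" by simp
  then show "A_bar *v x \<in> range real_vec" by blast
qed

lemma lattice_add_iff [simp]: "x + real_vec u \<in> range real_vec \<longleftrightarrow> x \<in> range real_vec"
proof
  assume "x + real_vec u \<in> range real_vec"
  then obtain w where "x + real_vec u = real_vec w" by blast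
  then have "x = real_vec (w - u)" by (simp add: algebra_simps)
  then show "x \<in> range real_vec" by blast
next
  assume "x \<in> range real_vec"
  then obtain w where "x = real_vec w" by blast
  then have "x + real_vec u = real_vec (w + u)" by simp
  then show "x + real_vec u \<in> range real_vec" by blast
qed

lemma q2_eq_iff: "q2 x = q2 y \<longleftrightarrow> x - y \<in> range real_vec"
  unfolding q2_def using eq_equiv_class_iff[OF equiv_torus_rel] by (auto simp: torus_rel_def)

lemma in_q2_iff: "x \<in> q2 y \<longleftrightarrow> q2 x = q2 y"
  unfolding q2_def using eq_equiv_class_iff[OF equiv_torus_rel] by (metis Image_singleton_iff UNIV_I)

lemma q2_add_lattice [simp]: "q2 (x + real_vec u) = q2 x"
  by (simp add: q2_eq_iff)

lemma q2_A_eq_iff: "q2 (A_bar *v x) = q2 (A_bar *v y) \<longleftrightarrow> q2 x = q2 y"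
  using A_bar_lattice_iff[of "x - y"] by (simp add: q2_eq_iff)

lemma A_torus_q2: "A_torus (q2 x) = q2 (A_bar *v x)"
proof -
  have "q2 (A_bar *v y) = q2 (A_bar *v x)" if "y \<in> q2 x" for y
    using that by (simp add: in_q2_iff q2_A_eq_iff)
  moreover have "x \<in> q2 x" by (simp add: in_q2_iff)
  ultimately show ?thesis unfolding A_torus_def by blast
qed

lemma torus_minus_q2: "torus_minus (q2 x) (q2 y) = q2 (x - y)"
proof -
  have "q2 (x' - y') = q2 (x - y)" if "x' \<in> q2 x" "y' \<in> q2 y" for x' y'
  proof -
    from that obtain u w where "x' - x = real_vec u" "y' - y = real_vec w"
      by (auto simp: in_q2_iff q2_eq_iff)
    then have "(x' - y') - (x - y) = real_vec (u - w)" by (simp add: algebra_simps)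
    then show ?thesis unfolding q2_eq_iff by blast
  qed
  moreover have "x \<in> q2 x" "y \<in> q2 y" by (simp_all add: in_q2_iff)
  ultimately show ?thesis unfolding torus_minus_def by blast
qed

lemma torus_loop_q2: "torus_loop (q2 x) u t = q2 (x + t *\<^sub>R real_vec u)"
proof -
  have "q2 (y + t *\<^sub>R real_vec u) = q2 (x + t *\<^sub>R real_vec u)" if "y \<in> q2 x" for y
    using that by (simp add: in_q2_iff q2_eq_iff)
  moreover have "x \<in> q2 x" by (simp add: in_q2_iff)
  ultimately show ?thesis unfolding torus_loop_def by blast
qed

lemma quotient_map_q2: "quotient_map euclidean torus q2"
proof -
  have "equiv (topspace euclidean) torus_rel" using equiv_torus_rel by simp
  then show ?thesis unfolding torus_def q2_def[abs_def] by (rule quotient_map_quotient_topology)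
qed

lemma topspace_torus: "topspace torus = range q2"
  using quotient_imp_surjective_map[OF quotient_map_q2] by simp

text \<open>In both gluings, no point is at once the source and the target of an identification.\<close>

lemma equivclp_matching:
  assumes "\<And>x y z. R x y \<Longrightarrow> R y z \<Longrightarrow> False"
    and "\<And>x y z. R x y \<Longrightarrow> R z y \<Longrightarrow> x = z" and "\<And>x y z. R x y \<Longrightarrow> R x z \<Longrightarrow> y = z"
  shows "equivclp R a b \<longleftrightarrow> a = b \<or> R a b \<or> R b a"
proof
  assume "equivclp R a b"
  then show "a = b \<or> R a b \<or> R b a"
    by (induction rule: equivclp_induct) (use assms in blast)+
next
  assume "a = b \<or> R a b \<or> R b a"
  then show "equivclp R a b" by (metis equivclp_refl equivclp_sym r_into_equivclp)
qed

section \<open>Coordinates on the circle and on the bundle\<close>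

definition circle_class :: "real \<Rightarrow> real set" where
  "circle_class t = circle_rel `` {t}"

lemma circle_class_eq_iff:
  assumes "s \<in> {0..1}" "t \<in> {0..1}"
  shows "circle_class s = circle_class t \<longleftrightarrow> s = t \<or> s = 0 \<and> t = 1 \<or> s = 1 \<and> t = 0"
proof -
  have "circle_class s = circle_class t \<longleftrightarrow> (s, t) \<in> circle_rel"
    unfolding circle_class_def using eq_equiv_class_iff[OF equiv_circle_rel, of s t] assms by simp
  also have "\<dots> \<longleftrightarrow> equivclp (\<lambda>s t :: real. s = 0 \<and> t = 1) s t"
    using assms by (simp add: circle_rel_def generated_equiv_def)
  also have "\<dots> \<longleftrightarrow> s = t \<or> (s = 0 \<and> t = 1) \<or> (t = 0 \<and> s = 1)"
    by (rule equivclp_matching) simp_all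
  finally show ?thesis by blast
qed

lemma in_circle_class_iff:
  assumes "t \<in> {0..1}"
  shows "s \<in> circle_class t \<longleftrightarrow> s \<in> {0..1} \<and> circle_class s = circle_class t"
proof -
  have "s \<in> {0..1}" if "s \<in> circle_class t"
    using that by (simp add: circle_class_def circle_rel_def generated_equiv_def)
  moreover have "s \<in> circle_class t \<longleftrightarrow> circle_class s = circle_class t" if "s \<in> {0..1}"
  proof -
    have "(t, s) \<in> circle_rel \<longleftrightarrow> circle_class t = circle_class s"
      unfolding circle_class_def using eq_equiv_class_iff[OF equiv_circle_rel, of t s] assms that by simp
    then show ?thesis unfolding circle_class_def by auto
  qed
  ultimately show ?thesis by blast
qed

lemma quotient_map_circle_class: "quotient_map (top_of_set {0..1}) circle circle_class"
  unfolding circle_def circle_class_def[abs_def] by (rule quotient_map_quotient_topology[OF equiv_circle_rel])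

lemma topspace_circle: "topspace circle = circle_class ` {0..1}"
  using quotient_imp_surjective_map[OF quotient_map_circle_class] by simp

definition bpt :: "real ^ 2 \<Rightarrow> real \<Rightarrow> bundle_pt" where
  "bpt x t = bundle_class (q2 x) t"

lemma bundle_class_eq_iff:
  assumes "s \<in> {0..1}" "t \<in> {0..1}" "X \<in> topspace torus" "Y \<in> topspace torus"
  shows "bundle_class X s = bundle_class Y t \<longleftrightarrow> (s = t \<and> X = Y) \<or>
    (s = 1 \<and> t = 0 \<and> Y = A_torus X) \<or> (s = 0 \<and> t = 1 \<and> X = A_torus Y)"
proof -
  let ?R = "\<lambda>a b. \<exists>X\<in>topspace torus. a = (X, 1::real) \<and> b = (A_torus X, 0::real)"
  have inj: "X = Y" if "A_torus X = A_torus Y" "X \<in> topspace torus" "Y \<in> topspace torus" for X Y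
    using that by (auto simp: topspace_torus A_torus_q2 q2_A_eq_iff)
  have "bundle_class X s = bundle_class Y t \<longleftrightarrow> ((X, s), (Y, t)) \<in> bundle_rel"
    unfolding bundle_class_def using eq_equiv_class_iff[OF equiv_bundle_rel, of "(X, s)" "(Y, t)"] assms by simp
  also have "\<dots> \<longleftrightarrow> equivclp ?R (X, s) (Y, t)"
    using assms by (simp add: bundle_rel_def generated_equiv_def)
  also have "\<dots> \<longleftrightarrow> (X, s) = (Y, t) \<or> ?R (X, s) (Y, t) \<or> ?R (Y, t) (X, s)"
    by (rule equivclp_matching) (use inj in auto)
  finally show ?thesis using assms by auto
qed

lemma in_bundle_class_iff:
  assumes "t \<in> {0..1}" "X \<in> topspace torus"
  shows "(Y, s) \<in> bundle_class X t \<longleftrightarrow>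
    Y \<in> topspace torus \<and> s \<in> {0..1} \<and> bundle_class Y s = bundle_class X t"
proof -
  have "Y \<in> topspace torus \<and> s \<in> {0..1}" if "(Y, s) \<in> bundle_class X t"
    using that unfolding bundle_class_def bundle_rel_def generated_equiv_def by blast
  moreover have "(Y, s) \<in> bundle_class X t \<longleftrightarrow> bundle_class Y s = bundle_class X t"
    if "Y \<in> topspace torus" "s \<in> {0..1}"
  proof -
    have "(Y, s) \<in> bundle_class X t \<longleftrightarrow> ((X, t), (Y, s)) \<in> bundle_rel"
      by (simp only: bundle_class_def Image_singleton_iff)
    also have "\<dots> \<longleftrightarrow> bundle_class X t = bundle_class Y s"
      unfolding bundle_class_def
      using eq_equiv_class_iff[OF equiv_bundle_rel, of "(X, t)" "(Y, s)"] assms that by simp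
    finally show ?thesis by (simp only: eq_commute)
  qed
  ultimately show ?thesis by blast
qed

lemma bpt_eq_iff:
  assumes "s \<in> {0..1}" "t \<in> {0..1}"
  shows "bpt x s = bpt y t \<longleftrightarrow> (s = t \<and> q2 x = q2 y) \<or>
    (s = 1 \<and> t = 0 \<and> q2 y = q2 (A_bar *v x)) \<or> (s = 0 \<and> t = 1 \<and> q2 x = q2 (A_bar *v y))"
  using assms by (simp add: bpt_def bundle_class_eq_iff topspace_torus A_torus_q2)

lemma bpt_eq_same [simp]: "t \<in> {0..1} \<Longrightarrow> bpt x t = bpt y t \<longleftrightarrow> q2 x = q2 y"
  using bpt_eq_iff[of t t x y] by (cases "t = 0") simp_all

lemma bpt_1: "bpt x 1 = bpt (A_bar *v x) 0"
  by (simp add: bpt_eq_iff)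

lemma bpt_0: "bpt x 0 = bpt (A_bar *v (A_bar *v (A_bar *v x))) 1"
  by (simp add: bpt_1 A_bar_pow4)

lemma bpt_add_lattice [simp]: "bpt (x + real_vec u) t = bpt x t"
  by (simp add: bpt_def)

lemma bundle_proj_bpt:
  assumes "t \<in> {0..1}"
  shows "bundle_proj (bpt x t) = circle_class t"
proof -
  have "circle_class s = circle_class t" if "(Y, s) \<in> bpt x t" for Y s
    using that assms unfolding bpt_def
    by (auto simp: in_bundle_class_iff topspace_torus bundle_class_eq_iff circle_class_eq_iff)
  moreover have "(q2 x, t) \<in> bpt x t" using assms by (simp add: bpt_def in_bundle_class_iff topspace_torus)
  ultimately show ?thesis unfolding bundle_proj_def circle_class_def[symmetric] by blast
qed

text \<open>On the gluing fiber both points may be represented at height 0 or at height 1;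
  additivity of \<open>A_bar\<close> makes the two differences the same point.\<close>

lemma fiber_minus_bpt:
  assumes t: "t \<in> {0..1}"
  shows "fiber_minus (bpt x t) (bpt y t) = bpt (x - y) t"
proof -
  have "bundle_class (torus_minus X Y) s = bpt (x - y) t" if "(X, s) \<in> bpt x t" "(Y, s) \<in> bpt y t" for X Y s
  proof -
    from that obtain x' y' where *: "X = q2 x'" "Y = q2 y'" "s \<in> {0..1}"
      "bpt x' s = bpt x t" "bpt y' s = bpt y t"
      using t unfolding bpt_def by (auto simp: in_bundle_class_iff topspace_torus)
    have "bpt (x' - y') s = bpt (x - y) t"
    proof (cases "s = t")
      case True
      then have "q2 (x' - y') = q2 (x - y)"
        using *(4,5) t by (simp flip: torus_minus_q2)
      then show ?thesis using True t by simp
    next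
      case False
      then consider "s = 1" "t = 0" "q2 x = q2 (A_bar *v x')" "q2 y = q2 (A_bar *v y')"
        | "s = 0" "t = 1" "q2 x' = q2 (A_bar *v x)" "q2 y' = q2 (A_bar *v y)"
        using *(4,5) unfolding bpt_eq_iff[OF *(3) t] by auto
      then show ?thesis
      proof cases
        case 1
        then have "q2 (x - y) = q2 (A_bar *v (x' - y'))" by (simp flip: torus_minus_q2)
        then show ?thesis using 1 by (simp add: bpt_eq_iff)
      next
        case 2
        then have "q2 (x' - y') = q2 (A_bar *v (x - y))" by (simp flip: torus_minus_q2)
        then show ?thesis using 2 by (simp add: bpt_eq_iff)
      qed
    qed
    then show ?thesis by (simp add: * torus_minus_q2 bpt_def)
  qed
  moreover have "(q2 x, t) \<in> bpt x t" "(q2 y, t) \<in> bpt y t"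
    using t by (simp_all add: bpt_def in_bundle_class_iff topspace_torus)
  ultimately have "{bundle_class (torus_minus X Y) s | X Y s. (X, s) \<in> bpt x t \<and> (Y, s) \<in> bpt y t}
    = {bpt (x - y) t}" by blast
  then show ?thesis unfolding fiber_minus_def by (simp only: cSup_singleton)
qed

abbreviation strip :: "((real ^ 2) \<times> real) topology" where
  "strip \<equiv> prod_topology euclidean (top_of_set {0..1})"

text \<open>The product of \<open>q2\<close> with the identity of I is still a quotient map because
  I is locally compact Hausdorff.\<close>

lemma quotient_map_bpt: "quotient_map strip torus_bundle (\<lambda>(x, t). bpt x t)"
proof -
  have "quotient_map strip (prod_topology torus (top_of_set {0..1})) (\<lambda>(x, t). (q2 x, t))"
    by (intro quotient_map_prod_left quotient_map_q2 disjI1)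
      (auto simp: compact_space_subtopology Hausdorff_space_subtopology
        intro: compact_imp_locally_compact_space)
  moreover have "quotient_map (prod_topology torus (top_of_set {0..1})) torus_bundle (\<lambda>c. bundle_rel `` {c})"
    unfolding torus_bundle_def by (rule quotient_map_quotient_topology[OF equiv_bundle_rel])
  ultimately have "quotient_map strip torus_bundle ((\<lambda>c. bundle_rel `` {c}) \<circ> (\<lambda>(x, t). (q2 x, t)))"
    by (rule quotient_map_compose)
  then show ?thesis by (simp add: comp_def case_prod_unfold bpt_def[abs_def] bundle_class_def)
qed

lemma topspace_torus_bundle: "topspace torus_bundle = {bpt x t | x t. t \<in> {0..1}}"
proof -
  have "topspace torus_bundle = (\<lambda>(x, t). bpt x t) ` topspace strip"
    using quotient_map_bpt unfolding quotient_map_def by blast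
  then show ?thesis by (fastforce simp: image_iff)
qed

text \<open>Local compactness of the parameter space \<open>Z\<close> keeps the product with the
  quotient map a quotient map. With Z = I this lemma builds homotopies on the bundle.\<close>

lemma bundle_descent:
  assumes Z: "locally_compact_space Z" "Hausdorff_space Z"
    and \<phi>: "continuous_map (prod_topology Z strip) Y \<phi>"
    and per: "\<And>z x t u. z \<in> topspace Z \<Longrightarrow> t \<in> {0..1} \<Longrightarrow> \<phi> (z, x + real_vec u, t) = \<phi> (z, x, t)"
    and glue: "\<And>z x. z \<in> topspace Z \<Longrightarrow> \<phi> (z, x, 1) = \<phi> (z, A_bar *v x, 0)"
  obtains g where "continuous_map (prod_topology Z torus_bundle) Y g"
    "\<And>z x t. z \<in> topspace Z \<Longrightarrow> t \<in> {0..1} \<Longrightarrow> g (z, bpt x t) = \<phi> (z, x, t)"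
proof -
  have per': "\<phi> (z, x, t) = \<phi> (z, y, t)" if "z \<in> topspace Z" "t \<in> {0..1}" "q2 x = q2 y" for z x y t
  proof -
    from that(3) obtain u where "x = y + real_vec u" unfolding q2_eq_iff
      by (metis add.commute diff_add_cancel imageE)
    then show ?thesis using per that by simp
  qed
  have q: "quotient_map (prod_topology Z strip) (prod_topology Z torus_bundle)
      (\<lambda>(z, p). (z, case p of (x, t) \<Rightarrow> bpt x t))"
    using Z quotient_map_bpt by (intro quotient_map_prod_right) auto
  have eq: "\<phi> a = \<phi> b"
    if ab: "a \<in> topspace (prod_topology Z strip)" "b \<in> topspace (prod_topology Z strip)"
    "(\<lambda>(z, p). (z, case p of (x, t) \<Rightarrow> bpt x t)) a = (\<lambda>(z, p). (z, case p of (x, t) \<Rightarrow> bpt x t)) b" for a b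
  proof -
    obtain z x t where a: "a = (z, x, t)" by (cases a)
    obtain z' y s where b: "b = (z', y, s)" by (cases b)
    have *: "z \<in> topspace Z" "t \<in> {0..1}" "s \<in> {0..1}" "z' = z" "bpt x t = bpt y s"
      using ab by (auto simp: a b)
    consider "t = s" "q2 x = q2 y" | "t = 1" "s = 0" "q2 y = q2 (A_bar *v x)"
      | "t = 0" "s = 1" "q2 x = q2 (A_bar *v y)"
      using *(5) unfolding bpt_eq_iff[OF *(2,3)] by blast
    then show ?thesis
      unfolding a b \<open>z' = z\<close> using * by cases (auto intro: per' simp: glue)
  qed
  show thesis
  proof (rule quotient_map_lift_exists[OF q \<phi> eq])
    fix g assume g: "continuous_map (prod_topology Z torus_bundle) Y g"
      "\<And>a. a \<in> topspace (prod_topology Z strip) \<Longrightarrow>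
        g ((\<lambda>(z, p). (z, case p of (x, t) \<Rightarrow> bpt x t)) a) = \<phi> a"
    have "g (z, bpt x t) = \<phi> (z, x, t)" if "z \<in> topspace Z" "t \<in> {0..1}" for z x t
    proof -
      have "(z, x, t) \<in> topspace (prod_topology Z strip)" using that by simp
      from g(2)[OF this] show ?thesis by (simp only: prod.case)
    qed
    with g(1) show thesis by (rule that)
  qed
qed

section \<open>Lifting to the universal cover\<close>

lemma strip_eq: "strip = top_of_set (UNIV \<times> {0..1})"
  by (metis prod_topology_subtopology_eu subtopology_UNIV)

text \<open>A character of the torus. The two of them separate points, and as unit complex numbers
  they reduce lifting to taking logarithms.\<close>

definition torus_char :: "2 \<Rightarrow> real ^ 2 \<Rightarrow> complex" where
  "torus_char j x = cis (2 * pi * x $ j)"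

lemma torus_char_simps [simp]:
  "torus_char j (x + real_vec u) = torus_char j x"
  "torus_char 1 (A_bar *v x) = cnj (torus_char 2 x)"
  "torus_char 2 (A_bar *v x) = torus_char 1 x"
  "torus_char j x \<noteq> 0" "norm (torus_char j x) = 1"
  by (simp_all add: torus_char_def cis_mult[symmetric] distrib_left cis_multiple_2pi cis_cnj)

lemma continuous_on_torus_char [continuous_intros]:
  "continuous_on S f \<Longrightarrow> continuous_on S (\<lambda>x. torus_char j (f x))"
  unfolding torus_char_def by (intro continuous_intros)

lemma q2_eq_iff_char: "q2 x = q2 y \<longleftrightarrow> (\<forall>j. torus_char j x = torus_char j y)"
proof
  assume "q2 x = q2 y"
  then obtain u where "x = y + real_vec u"
    unfolding q2_eq_iff by (metis (no_types, lifting) add.commute diff_add_cancel image_iff)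
  then show "\<forall>j. torus_char j x = torus_char j y" by simp
next
  assume "\<forall>j. torus_char j x = torus_char j y"
  then have "\<exists>n::int. x $ j - y $ j = of_int n" for j
  proof -
    from \<open>\<forall>j. _\<close> have "exp (\<i> * of_real (2 * pi * x $ j)) = exp (\<i> * of_real (2 * pi * y $ j))"
      by (simp only: torus_char_def cis_conv_exp)
    then obtain n :: int where
      "\<i> * of_real (2 * pi * x $ j) = \<i> * of_real (2 * pi * y $ j) + of_int (2 * n) * pi * \<i>"
      unfolding exp_eq by blast
    then have "2 * pi * x $ j = 2 * pi * y $ j + 2 * n * pi" by (simp add: complex_eq_iff)
    then have "pi * (2 * (x $ j - y $ j - n)) = 0" by (simp add: algebra_simps)
    then have "x $ j - y $ j = n" by (simp only: mult_eq_0_iff) simp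
    then show ?thesis ..
  qed
  then obtain n m :: int where "x $ 1 - y $ 1 = n" "x $ 2 - y $ 2 = m" by metis
  then have "x - y = real_vec (vector [n, m])" by (simp add: vec2_eq_iff)
  then show "q2 x = q2 y" unfolding q2_eq_iff by blast
qed

lemma bundle_descent0:
  assumes \<phi>: "continuous_on (UNIV \<times> {0..1}) (\<lambda>(x, t). \<phi> x t :: complex)"
    and per: "\<And>x t u. t \<in> {0..1} \<Longrightarrow> \<phi> (x + real_vec u) t = \<phi> x t"
    and glue: "\<And>x. \<phi> x 1 = \<phi> (A_bar *v x) 0"
  obtains g where "continuous_map torus_bundle euclidean g"
    "\<And>x t. t \<in> {0..1} \<Longrightarrow> g (bpt x t) = \<phi> x t"
proof -
  \<comment> \<open>A dummy parameter, set to 0 at the end, that makes \<open>bundle_descent\<close>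
    applicable to a single map.\<close>
  let ?Z = "top_of_set {0..1::real}"
  have "continuous_map (prod_topology ?Z strip) euclidean ((\<lambda>(x, t). \<phi> x t) \<circ> snd)"
    using \<phi> by (intro continuous_map_compose[OF continuous_map_snd]) (simp add: strip_eq)
  then obtain g where g: "continuous_map (prod_topology ?Z torus_bundle) euclidean g"
    "\<And>z x t. z \<in> {0..1} \<Longrightarrow> t \<in> {0..1} \<Longrightarrow> g (z, bpt x t) = \<phi> x t"
    by (rule bundle_descent[rotated 2])
      (use per glue in \<open>auto simp: compact_space_subtopology Hausdorff_space_subtopology
        intro: compact_imp_locally_compact_space\<close>)
  show thesis
  proof (rule that)
    show "continuous_map torus_bundle euclidean (g \<circ> (\<lambda>c. (0, c)))"
      by (rule continuous_map_compose[OF _ g(1)]) (simp add: continuous_map_pairwise comp_def)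
  qed (simp add: g)
qed

text \<open>A character of the fiber torus does not extend to the bundle. Weighted by bump functions
  in \<open>t\<close> it does, and \<open>x \<mapsto> torus_char j x\<close> is recovered from the weighted ones,
  even at the gluing fiber.\<close>

lemma continuous_on_char_coord:
  fixes S :: "'a::topological_space set"
  assumes h: "continuous_map (top_of_set S) torus_bundle h" and \<tau>: "continuous_on S \<tau>"
    and Y: "\<And>w. w \<in> S \<Longrightarrow> \<tau> w \<in> {0..1} \<and> h w = bpt (Y w) (\<tau> w)"
  shows "continuous_on S (\<lambda>w. torus_char j (Y w))"
proof -
  \<comment> \<open>\<open>m\<close> lives on the first half of I, \<open>p\<close> on the second,
    and \<open>b\<close> vanishes only at the two ends. Thus p m = 0, while the three weights have
    no common zero on I: at t = 1/2, where \<open>p\<close> and \<open>m\<close> vanish,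
    \<open>b\<close> does not.\<close>
  define p m :: "real \<Rightarrow> real" where "p t = max 0 (t - 1/2)" and "m t = max 0 (1/2 - t)" for t
  define b :: "real \<Rightarrow> real" where "b t = t * (1 - t)" for t
  have pm: "p t * m t = 0" for t by (simp add: p_def m_def max_def)
  have "\<exists>g. continuous_map torus_bundle euclidean g \<and> (\<forall>x. \<forall>t\<in>{0..1}. g (bpt x t) = b t *\<^sub>R torus_char j x)" for j
  proof -
    obtain g where "continuous_map torus_bundle euclidean g"
      "\<And>x t. t \<in> {0..1} \<Longrightarrow> g (bpt x t) = b t *\<^sub>R torus_char j x"
      by (rule bundle_descent0[of "\<lambda>x t. b t *\<^sub>R torus_char j x"])
        (auto simp: b_def case_prod_unfold intro!: continuous_intros)
    then show ?thesis by blast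
  qed
  then obtain B where B: "\<And>j. continuous_map torus_bundle euclidean (B j)"
    "\<And>j x t. t \<in> {0..1} \<Longrightarrow> B j (bpt x t) = b t *\<^sub>R torus_char j x" by metis
  \<comment> \<open>At t = 1 only the term with \<open>A_bar\<close> survives and at t = 0 only the
    other one, both with weight 1/2; this is the compatibility needed at the gluing.\<close>
  have "\<exists>g. continuous_map torus_bundle euclidean g \<and>
    (\<forall>x. \<forall>t\<in>{0..1}. g (bpt x t) = m t *\<^sub>R torus_char j x + p t *\<^sub>R torus_char j (A_bar *v x))" for j
  proof (rule bundle_descent0[of "\<lambda>x t. m t *\<^sub>R torus_char j x + p t *\<^sub>R torus_char j (A_bar *v x)"])
      have "continuous_on UNIV (\<lambda>x. A_bar *v (x :: real ^ 2))"
        by (rule matrix_vector_mult_linear_continuous_on)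
      then have "continuous_on (UNIV \<times> {0..1::real}) (\<lambda>y. A_bar *v (fst y :: real ^ 2))"
        by (rule continuous_on_compose2) (auto intro: continuous_intros)
      then show "continuous_on (UNIV \<times> {0..1}) (\<lambda>(x, t). m t *\<^sub>R torus_char j x + p t *\<^sub>R torus_char j (A_bar *v x))"
        unfolding case_prod_unfold m_def p_def by (intro continuous_intros)
      show "m t *\<^sub>R torus_char j (x + real_vec u) + p t *\<^sub>R torus_char j (A_bar *v (x + real_vec u))
        = m t *\<^sub>R torus_char j x + p t *\<^sub>R torus_char j (A_bar *v x)" for x t u
        by (simp flip: real_vec_simps(5))
      show "m 1 *\<^sub>R torus_char j x + p 1 *\<^sub>R torus_char j (A_bar *v x)
        = m 0 *\<^sub>R torus_char j (A_bar *v x) + p 0 *\<^sub>R torus_char j (A_bar *v (A_bar *v x))" for x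
        by (simp add: m_def p_def)
    fix g assume "continuous_map torus_bundle euclidean g"
      "\<And>x t. t \<in> {0..1} \<Longrightarrow> g (bpt x t) = m t *\<^sub>R torus_char j x + p t *\<^sub>R torus_char j (A_bar *v x)"
    then show ?thesis by blast
  qed
  then obtain E where E: "\<And>j. continuous_map torus_bundle euclidean (E j)"
    "\<And>j x t. t \<in> {0..1} \<Longrightarrow> E j (bpt x t) = m t *\<^sub>R torus_char j x + p t *\<^sub>R torus_char j (A_bar *v x)" by metis
  define d where "d t = b t ^ 2 + m t ^ 2 + p t ^ 2" for t
  have d0: "d t \<noteq> 0" if "t \<in> {0..1}" for t
  proof
    assume "d t = 0"
    then have "b t = 0" "m t = 0" "p t = 0"
      unfolding d_def by (simp_all add: add_nonneg_eq_0_iff)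
    then show False by (auto simp: b_def m_def p_def max_def split: if_splits)
  qed
  have cB: "continuous_on S (\<lambda>w. B j (h w))" and cE: "continuous_on S (\<lambda>w. E j (h w))" for j
    using continuous_map_compose[OF h B(1)[of j]] continuous_map_compose[OF h E(1)[of j]]
    by (simp_all add: comp_def)
  have c: "continuous_on S (\<lambda>w. b (\<tau> w))" "continuous_on S (\<lambda>w. m (\<tau> w))" "continuous_on S (\<lambda>w. p (\<tau> w))"
    unfolding b_def m_def p_def by (intro continuous_intros \<tau>)+
  have cd: "continuous_on S (\<lambda>w. inverse (d (\<tau> w)))"
    unfolding d_def using c d0 Y by (intro continuous_intros) (auto simp: d_def)
  \<comment> \<open>The second character at A x is the first at x, so the product of
    \<open>p\<close> and \<open>E 2\<close> contributes p^2 times the first character. Cross terms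
    carry the factor p m = 0.\<close>
  have eq1: "torus_char 1 (Y w) = inverse (d (\<tau> w)) *\<^sub>R (b (\<tau> w) *\<^sub>R B 1 (h w) + m (\<tau> w) *\<^sub>R E 1 (h w) + p (\<tau> w) *\<^sub>R E 2 (h w))"
    if "w \<in> S" for w
  proof -
    have "b (\<tau> w) *\<^sub>R B 1 (h w) + m (\<tau> w) *\<^sub>R E 1 (h w) + p (\<tau> w) *\<^sub>R E 2 (h w)
      = d (\<tau> w) *\<^sub>R torus_char 1 (Y w) + (p (\<tau> w) * m (\<tau> w)) *\<^sub>R (torus_char 1 (A_bar *v Y w) + torus_char 2 (Y w))"
      using Y[OF that] by (simp add: B E d_def algebra_simps power2_eq_square)
    then show ?thesis using d0 Y[OF that] by (simp add: pm)
  qed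
  \<comment> \<open>Here a conjugation is needed: the first character at A x is the conjugate of the
    second at x.\<close>
  have eq2: "torus_char 2 (Y w) = inverse (d (\<tau> w)) *\<^sub>R (b (\<tau> w) *\<^sub>R B 2 (h w) + m (\<tau> w) *\<^sub>R E 2 (h w) + p (\<tau> w) *\<^sub>R cnj (E 1 (h w)))"
    if "w \<in> S" for w
  proof -
    have "b (\<tau> w) *\<^sub>R B 2 (h w) + m (\<tau> w) *\<^sub>R E 2 (h w) + p (\<tau> w) *\<^sub>R cnj (E 1 (h w))
      = d (\<tau> w) *\<^sub>R torus_char 2 (Y w) + (p (\<tau> w) * m (\<tau> w)) *\<^sub>R (torus_char 2 (A_bar *v Y w) + cnj (torus_char 1 (Y w)))"
      using Y[OF that] by (simp add: B E d_def algebra_simps power2_eq_square)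
    then show ?thesis using d0 Y[OF that] by (simp add: pm)
  qed
  have "continuous_on S (\<lambda>w. torus_char 1 (Y w))"
    by (subst continuous_on_cong[OF refl eq1]) (auto intro!: continuous_intros c cB cE cd)
  moreover have "continuous_on S (\<lambda>w. torus_char 2 (Y w))"
    by (subst continuous_on_cong[OF refl eq2]) (auto intro!: continuous_intros c cB cE cd)
  ultimately show ?thesis by (metis exhaust_2)
qed

lemma bundle_point_over:
  assumes "c \<in> topspace torus_bundle" "t \<in> {0..1}" "bundle_proj c = circle_class t"
  shows "\<exists>x. c = bpt x t"
proof -
  obtain y s where y: "c = bpt y s" "s \<in> {0..1}" using assms(1) unfolding topspace_torus_bundle by blast
  with assms(2,3) have "s = t \<or> s = 0 \<and> t = 1 \<or> s = 1 \<and> t = 0"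
    by (simp add: bundle_proj_bpt circle_class_eq_iff)
  then show ?thesis using y bpt_0 bpt_1 by metis
qed

text \<open>On a contractible set each character of the fiber coordinate has a continuous logarithm,
  and its imaginary part divided by 2 pi is a coordinate of the lift. The height \<tau> is
  prescribed because the point of the bundle determines it only up to exchanging 0 and 1.\<close>

lemma bundle_lift:
  fixes S :: "'a::real_normed_vector set"
  assumes S: "contractible S" and h: "continuous_map (top_of_set S) torus_bundle h"
    and \<tau>: "continuous_on S \<tau>" "\<And>w. w \<in> S \<Longrightarrow> \<tau> w \<in> {0..1}"
    and over: "\<And>w. w \<in> S \<Longrightarrow> bundle_proj (h w) = circle_class (\<tau> w)"
  obtains F where "continuous_on S F" "\<And>w. w \<in> S \<Longrightarrow> h w = bpt (F w) (\<tau> w)"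
proof -
  have "h w \<in> topspace torus_bundle" if "w \<in> S" for w
    using h that by (auto simp: continuous_map_def)
  then have "\<exists>x. h w = bpt x (\<tau> w)" if "w \<in> S" for w
    using bundle_point_over \<tau>(2) over that by blast
  then obtain Y where Y: "\<And>w. w \<in> S \<Longrightarrow> h w = bpt (Y w) (\<tau> w)" by metis
  have "\<exists>g. continuous_on S g \<and> (\<forall>w\<in>S. torus_char j (Y w) = exp (g w))" for j
  proof -
    have "continuous_on S (\<lambda>w. torus_char j (Y w))"
      by (rule continuous_on_char_coord[OF h \<tau>(1)]) (use \<tau>(2) Y in blast)
    then obtain g where "continuous_on S g" "\<And>w. w \<in> S \<Longrightarrow> torus_char j (Y w) = exp (g w)"
      by (rule continuous_logarithm_on_contractible[OF _ S]) simp_all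
    then show ?thesis by blast
  qed
  then obtain g where g: "\<And>j. continuous_on S (g j)"
    "\<And>j w. w \<in> S \<Longrightarrow> torus_char j (Y w) = exp (g j w)" by metis
  define F :: "'a \<Rightarrow> real ^ 2" where "F w = (\<chi> j. Im (g j w) / (2 * pi))" for w
  show thesis
  proof (rule that)
    show "continuous_on S F"
      unfolding F_def using g(1) by (intro continuous_on_vec_lambda continuous_intros) auto
    show "h w = bpt (F w) (\<tau> w)" if w: "w \<in> S" for w
    proof -
      have "torus_char j (F w) = torus_char j (Y w)" for j
      proof -
        \<comment> \<open>The character has modulus 1, so its logarithm is purely imaginary.\<close>
        have "exp (Re (g j w)) = 1" using g(2)[OF w, of j] torus_char_simps(5)[of j "Y w"] by simp
        then have "g j w = \<i> * Im (g j w)" by (simp add: complex_eq_iff)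
        then have "exp (g j w) = cis (Im (g j w))" by (metis cis_conv_exp)
        then show ?thesis using g(2)[OF w, of j] by (simp add: torus_char_def F_def)
      qed
      then show ?thesis using Y[OF w] \<tau>(2)[OF w] by (simp add: q2_eq_iff_char)
    qed
  qed
qed

text \<open>Distinct integers are at distance at least 1, so no coordinate can vary continuously on
  a connected set.\<close>

lemma lattice_valued_constant:
  fixes g :: "'a::topological_space \<Rightarrow> real ^ 2"
  assumes S: "connected S" and g: "continuous_on S g"
    and lat: "\<And>x. x \<in> S \<Longrightarrow> g x \<in> range real_vec" and xy: "x \<in> S" "y \<in> S"
  shows "g x = g y"
proof -
  have "(\<lambda>x. g x $ j) constant_on S" for j
  proof (rule continuous_discrete_range_constant[OF S])
    show "continuous_on S (\<lambda>x. g x $ j)" using g by (rule continuous_on_component)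
    fix x assume x: "x \<in> S"
    have "1 \<le> norm (g y $ j - g x $ j)" if y: "y \<in> S" "g y $ j \<noteq> g x $ j" for y
    proof -
      obtain u w where "g x = real_vec u" "g y = real_vec w" using lat x y(1) by blast
      then have "norm (g y $ j - g x $ j) = real_of_int \<bar>w $ j - u $ j\<bar>" "w $ j \<noteq> u $ j"
        using y(2) by simp_all
      then show ?thesis by (simp only: of_int_1_le_iff)
    qed
    then show "\<exists>e>0. \<forall>y. y \<in> S \<and> g y $ j \<noteq> g x $ j \<longrightarrow> e \<le> norm (g y $ j - g x $ j)"
      by (intro exI[of _ 1]) auto
  qed
  then have "g x $ j = g y $ j" for j using xy unfolding constant_on_def by metis
  then show ?thesis by (simp add: vec_eq_iff)
qed

text \<open>Uniqueness of lifts up to a deck transformation: the difference of two lifts is lattice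
  valued.\<close>

lemma q2_eq_shift_constant:
  fixes f g :: "'a::topological_space \<Rightarrow> real ^ 2"
  assumes S: "connected S" "S \<noteq> {}" and fg: "continuous_on S f" "continuous_on S g"
    and q: "\<And>x. x \<in> S \<Longrightarrow> q2 (f x) = q2 (g x)"
  obtains u where "\<And>x. x \<in> S \<Longrightarrow> f x = g x + real_vec u"
proof -
  obtain a where a: "a \<in> S" using S by blast
  obtain u where u: "f a - g a = real_vec u" using q[OF a] unfolding q2_eq_iff by blast
  have "f x - g x = f a - g a" if "x \<in> S" for x
    by (rule lattice_valued_constant[OF S(1), where g = "\<lambda>x. f x - g x"])
      (use that a q fg in \<open>auto simp: q2_eq_iff intro: continuous_intros\<close>)
  then show thesis using that[of u] u by (metis add.commute diff_add_cancel)
qed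

text \<open>The torus is placed in the bundle as the fiber over 1/2, so that lifting to the plane
  becomes a case of \<open>bundle_lift\<close>.\<close>

lemma continuous_map_bundle_point: "continuous_map torus torus_bundle (\<lambda>X. bundle_class X (1/2))"
proof (rule continuous_compose_quotient_map[OF quotient_map_q2])
  have "continuous_map euclidean strip (\<lambda>x. (x, 1/2))"
    by (simp add: continuous_map_pairwise comp_def)
  from continuous_map_compose[OF this quotient_imp_continuous_map[OF quotient_map_bpt]]
  show "continuous_map euclidean torus_bundle ((\<lambda>X. bundle_class X (1/2)) \<circ> q2)"
    by (simp add: comp_def bpt_def)
qed

lemma torus_lift:
  fixes S :: "'a::real_normed_vector set"
  assumes "contractible S" "continuous_map (top_of_set S) torus h"
  obtains F where "continuous_on S F" "\<And>w. w \<in> S \<Longrightarrow> h w = q2 (F w)"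
proof -
  have "h w \<in> topspace torus" if "w \<in> S" for w
    using assms(2) that by (auto simp: continuous_map_def)
  then have "\<exists>x. h w = q2 x" if "w \<in> S" for w using that by (auto simp: topspace_torus)
  then obtain Y where Y: "\<And>w. w \<in> S \<Longrightarrow> h w = q2 (Y w)" by metis
  have *: "continuous_map (top_of_set S) torus_bundle (\<lambda>w. bundle_class (h w) (1/2))"
    using continuous_map_compose[OF assms(2) continuous_map_bundle_point] by (simp add: comp_def)
  obtain F where F: "continuous_on S F" "\<And>w. w \<in> S \<Longrightarrow> bundle_class (h w) (1/2) = bpt (F w) (1/2)"
    by (rule bundle_lift[OF assms(1) *, of "\<lambda>w. 1/2"])
      (use Y in \<open>simp_all add: bundle_proj_bpt flip: bpt_def\<close>)
  have "h w = q2 (F w)" if "w \<in> S" for w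
    using F(2)[OF that] Y[OF that] by (simp flip: bpt_def)
  with F(1) show thesis by (rule that)
qed

section \<open>Lifts of fiberwise homotopies and their equivariance\<close>

abbreviation cylinder :: "(real \<times> (real ^ 2) \<times> real) set" where
  "cylinder \<equiv> {0..1} \<times> UNIV \<times> {0..1}"

lemma cylinder_eq: "prod_topology (top_of_set {0..1}) strip = top_of_set cylinder"
  unfolding strip_eq by (rule prod_topology_subtopology_eu)

lemma convex_cylinder: "convex cylinder"
  by (intro convex_Times) auto

lemma fiberwise_cong:
  "(\<And>x. x \<in> topspace torus_bundle \<Longrightarrow> h x = k x) \<Longrightarrow> fiberwise h \<longleftrightarrow> fiberwise k"
  unfolding fiberwise_def by (metis (no_types, lifting) continuous_map_eq)

text \<open>The cylinder is convex and its last coordinate is a continuous height, so the whole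
  homotopy lifts at once.\<close>

lemma family_lift:
  assumes h: "continuous_map (prod_topology (top_of_set {0..1}) torus_bundle) torus_bundle h"
    and fib: "\<And>s. s \<in> {0..1} \<Longrightarrow> fiberwise (\<lambda>c. h (s, c))"
  obtains F where "continuous_on cylinder F"
    "\<And>s x t. s \<in> {0..1} \<Longrightarrow> t \<in> {0..1} \<Longrightarrow> h (s, bpt x t) = bpt (F (s, x, t)) t"
proof -
  have "continuous_map (prod_topology (top_of_set {0..1}) strip)
      (prod_topology (top_of_set {0..1}) torus_bundle) (\<lambda>(s, p). (s, case p of (x, t) \<Rightarrow> bpt x t))"
    using quotient_imp_continuous_map[OF quotient_map_bpt]
    by (simp add: continuous_map_prod_top)
  from continuous_map_compose[OF this h]
  have c: "continuous_map (top_of_set cylinder) torus_bundle (\<lambda>(s, x, t). h (s, bpt x t))"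
    by (simp add: cylinder_eq comp_def case_prod_unfold)
  have over: "bundle_proj ((\<lambda>(s, x, t). h (s, bpt x t)) w) = circle_class (snd (snd w))" if w: "w \<in> cylinder" for w
  proof -
    obtain s x t where [simp]: "w = (s, x, t)" by (cases w)
    have "bpt x t \<in> topspace torus_bundle" using w by (auto simp: topspace_torus_bundle)
    then have "bundle_proj (h (s, bpt x t)) = bundle_proj (bpt x t)"
      using fib[of s] w by (simp add: fiberwise_def)
    then show ?thesis using w by (simp add: bundle_proj_bpt)
  qed
  have "continuous_on cylinder (\<lambda>w. snd (snd w))" by (intro continuous_intros)
  then obtain F where F: "continuous_on cylinder F" "\<And>w. w \<in> cylinder \<Longrightarrow>
      (\<lambda>(s, x, t). h (s, bpt x t)) w = bpt (F w) (snd (snd w))"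
    by (rule bundle_lift[OF convex_imp_contractible[OF convex_cylinder] c _ _ over]) auto
  have "h (s, bpt x t) = bpt (F (s, x, t)) t" if "s \<in> {0..1}" "t \<in> {0..1}" for s x t
    using F(2)[of "(s, x, t)"] that by simp
  with F(1) show thesis by (rule that)
qed

text \<open>The translation is written \<open>A_bar *v v\<close> so that the affine map L x + t v
  satisfies the gluing condition, and so that labels change by u to A (u - v), exactly as under
  \<open>beta\<close>.\<close>

definition equivariant :: "(int ^ 2 \<Rightarrow> int ^ 2) \<Rightarrow> int ^ 2 \<Rightarrow> ((real ^ 2) \<times> real \<Rightarrow> real ^ 2) \<Rightarrow> bool" where
  "equivariant L v G \<longleftrightarrow> continuous_on (UNIV \<times> {0..1}) G \<and>
     (\<forall>x u. \<forall>t\<in>{0..1}. G (x + real_vec u, t) = G (x, t) + real_vec (L u)) \<and>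
     (\<forall>x. A_bar *v G (x, 1) = G (A_bar *v x, 0) + real_vec (A_bar *v v))"

lemma continuous_on_A_bar [continuous_intros]:
  "continuous_on S f \<Longrightarrow> continuous_on S (\<lambda>x. A_bar *v (f x :: real ^ 2))"
  by (rule continuous_on_compose2[OF matrix_vector_mult_linear_continuous_on[of UNIV]]) auto

text \<open>The defects of periodicity and of gluing are lattice valued on a connected cylinder,
  hence independent of the homotopy parameter. One pair (L, v) therefore serves all stages.\<close>

lemma family_equivariant:
  assumes F: "continuous_on cylinder F1" "continuous_on cylinder F2"
    and F1: "\<And>s x t. s \<in> {0..1} \<Longrightarrow> t \<in> {0..1} \<Longrightarrow> h1 (s, bpt x t) = bpt (F1 (s, x, t)) t"
    and F2: "\<And>s x t. s \<in> {0..1} \<Longrightarrow> t \<in> {0..1} \<Longrightarrow> h2 (s, bpt x t) = bpt (F2 (s, x, t)) t"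
  obtains L v where "\<And>s. s \<in> {0..1} \<Longrightarrow> equivariant L v (\<lambda>(x, t). F1 (s, x, t) - F2 (s, x, t))"
proof -
  define D where "D w = F1 w - F2 w" for w
  have D: "continuous_on cylinder D" unfolding D_def using F by (intro continuous_intros)
  have conn: "connected cylinder" "cylinder \<noteq> {}" using convex_cylinder convex_connected by auto
  have per: "q2 (D (s, x + real_vec u, t)) = q2 (D (s, x, t))" if "s \<in> {0..1}" "t \<in> {0..1}" for s x t u
  proof -
    have "q2 (F1 (s, x + real_vec u, t)) = q2 (F1 (s, x, t))" "q2 (F2 (s, x + real_vec u, t)) = q2 (F2 (s, x, t))"
      using F1[OF that, of x] F1[OF that, of "x + real_vec u"]
        F2[OF that, of x] F2[OF that, of "x + real_vec u"] that by simp_all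
    then show ?thesis unfolding D_def by (simp flip: torus_minus_q2)
  qed
  have glue: "q2 (A_bar *v D (s, x, 1)) = q2 (D (s, A_bar *v x, 0))" if "s \<in> {0..1}" for s x
  proof -
    have "q2 (A_bar *v F1 (s, x, 1)) = q2 (F1 (s, A_bar *v x, 0))" "q2 (A_bar *v F2 (s, x, 1)) = q2 (F2 (s, A_bar *v x, 0))"
      using F1[OF that, of 1 x] F1[OF that, of 0 "A_bar *v x"]
        F2[OF that, of 1 x] F2[OF that, of 0 "A_bar *v x"] by (simp_all add: bpt_1)
    then show ?thesis unfolding D_def by (simp flip: torus_minus_q2)
  qed
  have "\<exists>w. \<forall>p\<in>cylinder. D (fst p, fst (snd p) + real_vec u, snd (snd p)) = D p + real_vec w" for u
  proof -
    have "continuous_on cylinder (\<lambda>p. D (fst p, fst (snd p) + real_vec u, snd (snd p)))"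
      by (rule continuous_on_compose2[OF D]) (auto intro!: continuous_intros)
    then obtain w where "\<And>p. p \<in> cylinder \<Longrightarrow> D (fst p, fst (snd p) + real_vec u, snd (snd p)) = D p + real_vec w"
      by (rule q2_eq_shift_constant[OF conn _ D]) (use per in auto)
    then show ?thesis by blast
  qed
  then obtain L where L: "\<And>u p. p \<in> cylinder \<Longrightarrow> D (fst p, fst (snd p) + real_vec u, snd (snd p)) = D p + real_vec (L u)"
    by metis
  have "continuous_on cylinder (\<lambda>p. A_bar *v D (fst p, fst (snd p), 1))"
    by (intro continuous_intros continuous_on_compose2[OF D]) (auto intro!: continuous_intros)
  moreover have "continuous_on cylinder (\<lambda>p. D (fst p, A_bar *v fst (snd p), 0))"
    by (rule continuous_on_compose2[OF D]) (auto intro!: continuous_intros)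
  ultimately obtain c where c: "\<And>p. p \<in> cylinder \<Longrightarrow>
      A_bar *v D (fst p, fst (snd p), 1) = D (fst p, A_bar *v fst (snd p), 0) + real_vec c"
    by (rule q2_eq_shift_constant[OF conn]) (use glue in auto)
  \<comment> \<open>Since the square of \<open>A_bar\<close> is minus the identity, its inverse is
    minus itself.\<close>
  define v where "v = - (A_bar *v c)"
  have v: "A_bar *v v = c" by (simp add: v_def vec2_eq_iff)
  have "equivariant L v (\<lambda>(x, t). D (s, x, t))" if s: "s \<in> {0..1}" for s
    unfolding equivariant_def v
  proof (intro conjI allI ballI)
    show "continuous_on (UNIV \<times> {0..1}) (\<lambda>(x, t). D (s, x, t))"
      unfolding case_prod_unfold
      by (rule continuous_on_compose2[OF D]) (use s in \<open>auto intro!: continuous_intros\<close>)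
  qed (use L[of "(s, _, _)"] c[of "(s, _, 0)"] s in auto)
  then show thesis using that[of L v] by (simp add: D_def)
qed

text \<open>The increment of \<open>G\<close> under a lattice translation is the same at every base
  point and height. Two successive translations give additivity, and passing from height 1 to height
  0 gives compatibility with \<open>A_bar\<close>.\<close>

lemma equivariant_hom:
  fixes u w :: "int ^ 2"
  assumes "equivariant L v G"
  shows "L (u + w) = L u + L w" and "L (A_bar *v u) = A_bar *v L u"
proof -
  have *: "real_vec (L u) = G (x + real_vec u, t) - G (x, t)" if "t \<in> {0..1}" for x t and u :: "int ^ 2"
    using assms that by (simp add: equivariant_def)
  have "real_vec (L (u + w)) = real_vec (L u) + real_vec (L w)"
    using *[of 0 "u + w" 0] *[of 0 u 0] *[of 0 w "real_vec u"] by simp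
  then show "L (u + w) = L u + L w" by (simp flip: real_vec_simps(2))
  have g: "G (A_bar *v x, 0) = A_bar *v G (x, 1) - real_vec (A_bar *v v)" for x
    using assms by (simp add: equivariant_def)
  have "real_vec (L (A_bar *v u)) = G (A_bar *v real_vec u, 0) - G (A_bar *v 0, 0)"
    using *[of 0 "A_bar *v u" 0] by simp
  also have "\<dots> = A_bar *v (G (real_vec u, 1) - G (0, 1))" unfolding g by simp
  also have "\<dots> = real_vec (A_bar *v L u)" using *[of 1 u 0] by simp
  finally show "L (A_bar *v u) = A_bar *v L u" by (simp only: real_vec_inject)
qed

lemma additive_int_mult:
  fixes f :: "int \<Rightarrow> int"
  assumes "\<And>m n. f (m + n) = f m + f n"
  shows "f n = n * f 1"
proof -
  have 0: "f 0 = 0" using assms[of 0 0] by simp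
  have nat: "f (int n) = int n * f 1" for n
    by (induction n) (simp_all add: 0 assms algebra_simps)
  have "f (- int n) = - int n * f 1" for n
    using assms[of "- int n" "int n"] nat[of n] 0 by simp
  then show ?thesis using nat by (cases n rule: int_cases2) simp_all
qed

text \<open>Additively the Gaussian integers are generated by 1 and i = A 1, so the value at 1
  determines \<open>L\<close>.\<close>

lemma complex_linear_eq_gmul:
  assumes add: "\<And>u w. L (u + w) = L u + L w" and A: "\<And>u. L (A_bar *v u) = A_bar *v L u"
  shows "L = gmul (L (vector [1, 0]))"
proof
  fix u :: "int ^ 2"
  have 1: "L (vector [n, 0]) $ j = n * L (vector [1, 0]) $ j" for n and j :: 2
  proof (rule additive_int_mult)
    fix m n :: int
    have "vector [m + n, 0] = vector [m, 0] + (vector [n, 0] :: int ^ 2)" by (simp add: vec2_eq_iff)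
    then show "L (vector [m + n, 0]) $ j = L (vector [m, 0]) $ j + L (vector [n, 0]) $ j"
      by (simp add: add)
  qed
  have "u = vector [u $ 1, 0] + A_bar *v vector [u $ 2, 0]" by (simp add: vec2_eq_iff)
  then have "L u = L (vector [u $ 1, 0]) + A_bar *v L (vector [u $ 2, 0])" by (metis add A)
  then show "L u = gmul (L (vector [1, 0])) u"
    using 1[of "u $ 1"] 1[of "u $ 2"] by (simp add: vec2_eq_iff gmul_def)
qed

section \<open>Reading the classifying pair off a lift\<close>

lemma bundle_section_circle_class:
  assumes t: "t \<in> {0..1}"
  shows "bundle_section v (circle_class t) = bpt (t *\<^sub>R real_vec v) t"
proof -
  have "bpt (real_vec v) 1 = bpt 0 0"
    using q2_add_lattice[of 0 "A_bar *v v"] by (simp add: bpt_1)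
  then have "bpt (s *\<^sub>R real_vec v) s = bpt (t *\<^sub>R real_vec v) t" if "s \<in> circle_class t" for s
    using that t by (auto simp: in_circle_class_iff circle_class_eq_iff)
  moreover have "t \<in> circle_class t" using t by (simp add: in_circle_class_iff)
  ultimately show ?thesis unfolding bundle_section_def bpt_def[symmetric] by blast
qed

lemma square_convex: "convex ({0..1::real} \<times> {0..1::real})"
  by (intro convex_Times) auto

lemma square_eq: "prod_topology (top_of_set {0..1::real}) (top_of_set {0..1::real}) = top_of_set ({0..1} \<times> {0..1})"
  by (rule prod_topology_subtopology_eu)

context
  fixes f1 f2 :: "bundle_pt \<Rightarrow> bundle_pt" and F1 F2 :: "(real ^ 2) \<times> real \<Rightarrow> real ^ 2"
    and L L' :: "int ^ 2 \<Rightarrow> int ^ 2" and v v' :: "int ^ 2"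
  assumes F1: "\<And>x t. t \<in> {0..1} \<Longrightarrow> f1 (bpt x t) = bpt (F1 (x, t)) t"
    and F2: "\<And>x t. t \<in> {0..1} \<Longrightarrow> f2 (bpt x t) = bpt (F2 (x, t)) t"
    and eqv: "equivariant L v (\<lambda>p. F1 p - F2 p)"
    and cp: "classifying_pair (\<lambda>c. fiber_minus (f1 c) (f2 c)) L' v'"
begin

definition diff_lift where "diff_lift p = F1 p - F2 p"

lemma cont_diff_lift: "continuous_on (UNIV \<times> {0..1}) diff_lift"
  using eqv unfolding equivariant_def diff_lift_def by simp

lemma fiber_minus_lift: "t \<in> {0..1} \<Longrightarrow> fiber_minus (f1 (bpt x t)) (f2 (bpt x t)) = bpt (diff_lift (x, t)) t"
  by (simp add: F1 F2 fiber_minus_bpt diff_lift_def)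

lemma fiber_restriction_lift:
  "fiber_restriction (\<lambda>c. fiber_minus (f1 c) (f2 c)) (q2 x) = q2 (diff_lift (x, 1))"
  unfolding fiber_restriction_def
proof (rule the_equality)
  show "q2 (diff_lift (x, 1)) \<in> topspace torus \<and>
    fiber_minus (f1 (bundle_class (q2 x) 1)) (f2 (bundle_class (q2 x) 1)) = bundle_class (q2 (diff_lift (x, 1))) 1"
    using fiber_minus_lift[of 1 x] by (simp add: topspace_torus bpt_def)
  fix Y assume "Y \<in> topspace torus \<and>
    fiber_minus (f1 (bundle_class (q2 x) 1)) (f2 (bundle_class (q2 x) 1)) = bundle_class Y 1"
  then show "Y = q2 (diff_lift (x, 1))"
    using fiber_minus_lift[of 1 x] by (auto simp: topspace_torus simp flip: bpt_def)
qed

text \<open>The homotopy of loops lifts to a square. Two opposite sides lie over a fixed point and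
  have constant lifts, so the other two sides have the same total displacement; it is
  \<open>L u\<close> on one and \<open>L' u\<close> on the other.\<close>

lemma classifying_hom: "L' = L"
proof
  fix u
  let ?I = "{0..1::real}"
  have loop: "fiber_restriction (\<lambda>c. fiber_minus (f1 c) (f2 c)) (torus_loop (q2 0) u t) = q2 (diff_lift (t *\<^sub>R real_vec u, 1))" for t
    by (simp add: torus_loop_q2 fiber_restriction_lift)
  from cp have "\<exists>h. continuous_map (top_of_set (?I \<times> ?I)) torus h \<and>
      (\<forall>t. h (0, t) = q2 (diff_lift (t *\<^sub>R real_vec u, 1))) \<and>
      (\<forall>t. h (1, t) = q2 (diff_lift (0, 1) + t *\<^sub>R real_vec (L' u))) \<and>
      (\<forall>s\<in>?I. h (s, 0) = q2 (diff_lift (0, 1)) \<and> h (s, 1) = q2 (diff_lift (0, 1)))"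
    unfolding classifying_pair_def induces_on_pi1_def homotopic_with_def
    by (simp only: loop fiber_restriction_lift torus_loop_q2 comp_def square_eq add_0)
  then obtain h where h: "continuous_map (top_of_set (?I \<times> ?I)) torus h"
    and h0: "\<And>t. h (0, t) = q2 (diff_lift (t *\<^sub>R real_vec u, 1))"
    and h1: "\<And>t. h (1, t) = q2 (diff_lift (0, 1) + t *\<^sub>R real_vec (L' u))"
    and hs: "\<And>s. s \<in> ?I \<Longrightarrow> h (s, 0) = q2 (diff_lift (0, 1)) \<and> h (s, 1) = q2 (diff_lift (0, 1))"
    by metis
  obtain H where H: "continuous_on (?I \<times> ?I) H" "\<And>p. p \<in> ?I \<times> ?I \<Longrightarrow> h p = q2 (H p)"
    using torus_lift[OF convex_imp_contractible[OF square_convex] h] by metis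
  have cH: "continuous_on ?I (\<lambda>s. H (s, t))" "continuous_on ?I (\<lambda>s. H (t, s))" if "t \<in> ?I" for t
    by (rule continuous_on_compose2[OF H(1)]; use that in \<open>auto intro!: continuous_intros\<close>)+
  have conn: "connected ?I" "?I \<noteq> {}" by auto
  \<comment> \<open>Each of the four sides is compared with an explicit lift, up to a lattice
    constant. The four corners then relate the constants.\<close>
  obtain w0 where w0: "\<And>s. s \<in> ?I \<Longrightarrow> H (s, 0) = diff_lift (0, 1) + real_vec w0"
    by (rule q2_eq_shift_constant[OF conn cH(1)[of 0]]) (use H(2) hs in \<open>auto simp flip: H(2)\<close>)
  obtain w1 where w1: "\<And>s. s \<in> ?I \<Longrightarrow> H (s, 1) = diff_lift (0, 1) + real_vec w1"
    by (rule q2_eq_shift_constant[OF conn cH(1)[of 1]]) (use H(2) hs in \<open>auto simp flip: H(2)\<close>)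
  have ct: "continuous_on ?I (\<lambda>t. diff_lift (t *\<^sub>R real_vec u, 1))"
    by (rule continuous_on_compose2[OF cont_diff_lift]) (auto intro!: continuous_intros)
  obtain w2 where w2: "\<And>t. t \<in> ?I \<Longrightarrow> H (0, t) = diff_lift (t *\<^sub>R real_vec u, 1) + real_vec w2"
    by (rule q2_eq_shift_constant[OF conn cH(2)[of 0] ct]) (use h0 in \<open>auto simp flip: H(2)\<close>)
  have ct: "continuous_on ?I (\<lambda>t. diff_lift (0, 1) + t *\<^sub>R real_vec (L' u))"
    by (intro continuous_intros)
  obtain w3 where w3: "\<And>t. t \<in> ?I \<Longrightarrow> H (1, t) = diff_lift (0, 1) + t *\<^sub>R real_vec (L' u) + real_vec w3"
    by (rule q2_eq_shift_constant[OF conn cH(2)[of 1] ct]) (use h1 in \<open>auto simp flip: H(2)\<close>)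
  have "diff_lift (real_vec u, 1) = diff_lift (0, 1) + real_vec (L u)"
    using eqv unfolding equivariant_def diff_lift_def[symmetric] by (metis add_0 atLeastAtMost_iff order_refl zero_le_one)
  then have "real_vec w0 + real_vec (L' u) = real_vec w0 + real_vec (L u)"
    using w0[of 0] w0[of 1] w1[of 0] w1[of 1] w2[of 0] w2[of 1] w3[of 0] w3[of 1]
    by (simp add: algebra_simps)
  then show "L' u = L u" by simp
qed

text \<open>The lifted homotopy of sections has a gluing defect \<open>c\<close> that does not vary
  along it. Computing \<open>c\<close> at both ends gives A v and A v' up to terms A w - w, which
  come from the choice of lifts.\<close>

lemma classifying_parity: "even (v' $ 1 + v' $ 2) \<longleftrightarrow> even (v $ 1 + v $ 2)"
proof -
  let ?I = "{0..1::real}"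
  obtain h where h: "continuous_map (prod_topology (top_of_set ?I) circle) torus_bundle h"
    and h0: "\<And>b. h (0, b) = fiber_minus (f1 (bundle_section 0 b)) (f2 (bundle_section 0 b))"
    and h1: "\<And>b. h (1, b) = bundle_section v' b"
    and hs: "\<And>s b. s \<in> ?I \<Longrightarrow> b \<in> topspace circle \<Longrightarrow> bundle_proj (h (s, b)) = b"
    using cp unfolding classifying_pair_def section_homotopic_def homotopic_with_def
    by (auto simp: comp_def)
  have "continuous_map (prod_topology (top_of_set ?I) (top_of_set ?I)) (prod_topology (top_of_set ?I) circle) (\<lambda>(s, t). (s, circle_class t))"
    using quotient_imp_continuous_map[OF quotient_map_circle_class]
    by (subst continuous_map_prod_top) simp
  from continuous_map_compose[OF this h]
  have hc: "continuous_map (top_of_set (?I \<times> ?I)) torus_bundle (\<lambda>(s, t). h (s, circle_class t))"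
    by (simp add: square_eq comp_def case_prod_unfold)
  obtain H where H: "continuous_on (?I \<times> ?I) H"
    "\<And>p. p \<in> ?I \<times> ?I \<Longrightarrow> (\<lambda>(s, t). h (s, circle_class t)) p = bpt (H p) (snd p)"
    by (rule bundle_lift[OF convex_imp_contractible[OF square_convex] hc, of snd])
      (use hs in \<open>auto simp: topspace_circle intro: continuous_intros\<close>)
  have Hst: "h (s, circle_class t) = bpt (H (s, t)) t" if "s \<in> ?I" "t \<in> ?I" for s t
    using H(2)[of "(s, t)"] that by simp
  have cH: "continuous_on ?I (\<lambda>s. H (s, t))" "continuous_on ?I (\<lambda>s. H (t, s))" if "t \<in> ?I" for t
    by (rule continuous_on_compose2[OF H(1)]; use that in \<open>auto intro!: continuous_intros\<close>)+
  have conn: "connected ?I" "?I \<noteq> {}" by auto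
  have ccl01: "circle_class 1 = circle_class 0" by (simp add: circle_class_eq_iff)
  have q: "q2 (A_bar *v H (s, 1)) = q2 (H (s, 0))" if "s \<in> ?I" for s
    using Hst[OF that, of 1] Hst[OF that, of 0] ccl01 by (simp add: bpt_1)
  have "continuous_on ?I (\<lambda>s. A_bar *v H (s, 1))" "continuous_on ?I (\<lambda>s. H (s, 0))"
    by (intro continuous_intros cH; simp)+
  then obtain c where c: "\<And>s. s \<in> ?I \<Longrightarrow> A_bar *v H (s, 1) = H (s, 0) + real_vec c"
    by (rule q2_eq_shift_constant[OF conn _ _ q]) auto
  have q: "q2 (H (0, t)) = q2 (diff_lift (0, t))" if t: "t \<in> ?I" for t
    using Hst[of 0 t] h0[of "circle_class t"] t fiber_minus_lift[of t 0] by (simp add: bundle_section_circle_class)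
  have ct: "continuous_on ?I (\<lambda>t. diff_lift (0, t))"
    by (rule continuous_on_compose2[OF cont_diff_lift]) (auto intro!: continuous_intros)
  obtain w where w: "\<And>t. t \<in> ?I \<Longrightarrow> H (0, t) = diff_lift (0, t) + real_vec w"
    by (rule q2_eq_shift_constant[OF conn cH(2)[of 0] ct q]) auto
  have q: "q2 (H (1, t)) = q2 (t *\<^sub>R real_vec v')" if t: "t \<in> ?I" for t
    using Hst[of 1 t] h1[of "circle_class t"] t by (simp add: bundle_section_circle_class)
  have ct: "continuous_on ?I (\<lambda>t. t *\<^sub>R real_vec v')" by (intro continuous_intros)
  obtain w' where w': "\<And>t. t \<in> ?I \<Longrightarrow> H (1, t) = t *\<^sub>R real_vec v' + real_vec w'"
    by (rule q2_eq_shift_constant[OF conn cH(2)[of 1] ct q]) auto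
  have "A_bar *v diff_lift (0, 1) = diff_lift (0, 0) + real_vec (A_bar *v v)"
    using eqv unfolding equivariant_def diff_lift_def[symmetric] by (metis A_bar_distribs(4))
  then have "real_vec (A_bar *v v + A_bar *v w - w) = real_vec (A_bar *v v' + A_bar *v w' - w')"
    using c[of 0] c[of 1] w[of 0] w[of 1] w'[of 0] w'[of 1]
    by (simp add: algebra_simps)
  then have "A_bar *v v + A_bar *v w - w = A_bar *v v' + A_bar *v w' - w'"
    by (simp only: real_vec_inject)
  \<comment> \<open>\<open>A_bar\<close> preserves the parity of the coordinate sum, so A w - w and
    A w' - w' vanish modulo 2.\<close>
  then show ?thesis by (simp add: vec2_eq_iff) presburger
qed

end

section \<open>The coincidence number\<close>

lemma continuous_map_bpt:
  assumes "continuous_on S f" "continuous_on S \<tau>" "\<And>w. w \<in> S \<Longrightarrow> \<tau> w \<in> {0..1}"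
  shows "continuous_map (top_of_set S) torus_bundle (\<lambda>w. bpt (f w) (\<tau> w))"
proof -
  have "continuous_map (top_of_set S) strip (\<lambda>w. (f w, \<tau> w))"
    using assms by (auto simp: continuous_map_pairwise comp_def continuous_map_in_subtopology)
  from continuous_map_compose[OF this quotient_imp_continuous_map[OF quotient_map_bpt]]
  show ?thesis by (simp add: comp_def)
qed

section \<open>Complex multiplication on the plane and surjectivity on fibers\<close>

definition rmul :: "int ^ 2 \<Rightarrow> real ^ 2 \<Rightarrow> real ^ 2" where
  "rmul a x = vector [a $ 1 * x $ 1 - a $ 2 * x $ 2, a $ 1 * x $ 2 + a $ 2 * x $ 1]"

text \<open>Complex division by \<open>a\<close>: the conjugate of \<open>a\<close> times y, divided
  by the norm.\<close>

definition rdiv :: "int ^ 2 \<Rightarrow> real ^ 2 \<Rightarrow> real ^ 2" where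
  "rdiv a y = (1 / gnorm a) *\<^sub>R rmul (vector [a $ 1, - a $ 2]) y"

lemma rmul_simps [simp]:
  "rmul a (real_vec u) = real_vec (gmul a u)" "rmul a (x + y) = rmul a x + rmul a y"
  "rmul a (x - y) = rmul a x - rmul a y" "rmul a (A_bar *v x) = A_bar *v rmul a x"
  by (simp_all add: rmul_def gmul_def vec2_eq_iff algebra_simps)

lemma
  assumes "a \<noteq> 0"
  shows rmul_rdiv [simp]: "rmul a (rdiv a y) = y" and rdiv_rmul [simp]: "rdiv a (rmul a x) = x"
proof -
  let ?b = "vector [a $ 1, - a $ 2] :: int ^ 2"
  have conj: "rmul a (rmul ?b x) = gnorm a *\<^sub>R x" "rmul ?b (rmul a x) = gnorm a *\<^sub>R x" for x
    by (simp_all add: rmul_def gnorm_def vec2_eq_iff power2_eq_square algebra_simps)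
  have "rmul a (c *\<^sub>R x) = c *\<^sub>R rmul a x" for c x
    by (simp add: rmul_def vec2_eq_iff algebra_simps)
  moreover have "real_of_int (gnorm a) \<noteq> 0" using assms by simp
  ultimately show "rmul a (rdiv a y) = y" "rdiv a (rmul a x) = x"
    unfolding rdiv_def by (simp_all add: conj del: gnorm_eq_0_iff)
qed

lemma rdiv_simps [simp]:
  "rdiv a (x - y) = rdiv a x - rdiv a y" "rdiv a (x + y) = rdiv a x + rdiv a y"
  "rdiv a (A_bar *v x) = A_bar *v rdiv a x"
  by (simp_all add: rdiv_def algebra_simps)

lemma continuous_on_rmul [continuous_intros]:
  "continuous_on S f \<Longrightarrow> continuous_on S (\<lambda>x. rmul a (f x))"
  unfolding rmul_def by (intro continuous_on_vec2 continuous_intros)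

lemma continuous_on_rdiv [continuous_intros]:
  "continuous_on S f \<Longrightarrow> continuous_on S (\<lambda>x. rdiv a (f x))"
  unfolding rdiv_def by (intro continuous_intros)

text \<open>All values are taken on the compact unit square, a fundamental domain of the
  lattice.\<close>

lemma bounded_range_periodic:
  fixes T :: "real ^ 2 \<Rightarrow> 'a::metric_space"
  assumes "continuous_on UNIV T" and per: "\<And>x u. T (x + real_vec u) = T x"
  shows "bounded (range T)"
proof -
  have "T x \<in> T ` cbox 0 1" for x
  proof -
    define u :: "int ^ 2" where "u = (\<chi> i. \<lfloor>x $ i\<rfloor>)"
    have "x - real_vec u \<in> cbox 0 1"
      using floor_correct[of "x $ i" for i] by (auto simp: mem_box_cart u_def) linarith
    moreover have "T (x - real_vec u) = T x" using per[of "x - real_vec u" u] by simp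
    ultimately show ?thesis by (metis image_eqI)
  qed
  then have "range T \<subseteq> T ` cbox 0 1" by blast
  moreover have "bounded (T ` cbox 0 1)"
    by (intro compact_imp_bounded compact_continuous_image continuous_on_subset[OF assms(1)]) auto
  ultimately show ?thesis by (metis bounded_subset)
qed

text \<open>A solution of \<open>G x = y\<close> is a fixed point of \<open>x \<mapsto> x + (y - G x) / a\<close>, which is periodic
  and therefore maps some ball into itself.\<close>

lemma equivariant_surj:
  assumes a: "a \<noteq> 0" and G: "continuous_on UNIV G"
    and per: "\<And>x u. G (x + real_vec u) = G x + real_vec (gmul a u)"
  obtains x where "G x = y"
proof -
  define T where "T x = x + rdiv a (y - G x)" for x
  have cT: "continuous_on UNIV T" unfolding T_def by (intro continuous_intros G)
  have "T (x + real_vec u) = T x" for x u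
  proof -
    have "rdiv a (real_vec (gmul a u)) = real_vec u" using rdiv_rmul[OF a, of "real_vec u"] by simp
    then show ?thesis by (simp add: T_def per algebra_simps)
  qed
  then have "bounded (range T)" by (rule bounded_range_periodic[OF cT])
  then obtain B where B: "\<And>x. norm (T x) \<le> B" by (auto simp: bounded_iff)
  \<comment> \<open>A positive radius such that the ball contains every value of
    \<open>T\<close>.\<close>
  define e where "e = \<bar>B\<bar> + 1"
  obtain x where "T x = x"
  proof (rule brouwer_ball[of e 0 T])
    show "continuous_on (cball 0 e) T" using cT continuous_on_subset by blast
    show "T \<in> cball 0 e \<rightarrow> cball 0 e"
    proof
      fix x show "T x \<in> cball 0 e" using B[of x] by (simp add: e_def)
    qed
  qed (auto simp: e_def)
  then have "rdiv a (y - G x) = 0" by (simp add: T_def)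
  moreover have "rmul a (rdiv a (y - G x)) = y - G x" by (rule rmul_rdiv[OF a])
  moreover have "rmul a 0 = 0" by (simp add: rmul_def vec2_eq_iff)
  ultimately have "G x = y" by simp
  then show thesis by (rule that)
qed

text \<open>\<open>A_bar\<close> is a rotation by a right angle; this makes the neighbourhoods used
  for labels compatible with the gluing.\<close>

lemma norm_A_bar [simp]: "norm (A_bar *v x) = norm x" for x :: "real ^ 2"
  by (simp add: norm_eq_sqrt_inner inner_vec_def sum_2 add.commute)

section \<open>The lower bound: labels of coincidences by orbits\<close>

lemma beta_orbit_eq: "U \<in> coker (gmul a) \<Longrightarrow> a \<noteq> 0 \<Longrightarrow> beta_orbit (gmul a) v U = orbit4 (beta (gmul a) v) U"
  unfolding beta_orbit_def
  by (rule orbit4_eq[OF finite_coker_gmul beta_in_coker beta_period4])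

text \<open>The backward direction applies \<open>beta\<close> three more times.\<close>

lemma beta_in_orbit_iff:
  assumes a: "a \<noteq> 0" and Q: "Q \<in> beta_orbits (gmul a) v" and U: "U \<in> coker (gmul a)"
  shows "beta (gmul a) v U \<in> Q \<longleftrightarrow> U \<in> Q"
proof -
  obtain W where W: "W \<in> coker (gmul a)" "Q = orbit4 (beta (gmul a) v) W"
    using Q a by (auto simp: beta_orbits_def beta_orbit_eq)
  note 4 = beta_period4[OF W(1), of v] beta_period4[OF U, of v]
  show ?thesis
  proof
    assume "U \<in> Q"
    then show "beta (gmul a) v U \<in> Q" using 4 unfolding W(2) orbit4_def by auto
  next
    assume "beta (gmul a) v U \<in> Q"
    then have "beta (gmul a) v (beta (gmul a) v (beta (gmul a) v (beta (gmul a) v U))) \<in> Q"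
      using 4(1) unfolding W(2) orbit4_def by auto
    then show "U \<in> Q" unfolding 4(2) .
  qed
qed

lemma beta_orbits_disjoint:
  assumes a: "a \<noteq> 0" and "Q \<in> beta_orbits (gmul a) v" "Q' \<in> beta_orbits (gmul a) v" "U \<in> Q" "U \<in> Q'"
  shows "Q = Q'"
proof -
  have "R = orbit4 (beta (gmul a) v) U" if R: "R \<in> beta_orbits (gmul a) v" "U \<in> R" for R
  proof -
    obtain W where W: "W \<in> coker (gmul a)" "R = orbit4 (beta (gmul a) v) W"
      using R(1) a by (auto simp: beta_orbits_def beta_orbit_eq)
    then show ?thesis
      using orbit4_cong[OF finite_coker_gmul[OF a] beta_in_coker[where v = v] beta_period4[where v = v] W(1)] R(2) by metis
  qed
  then show ?thesis using assms by metis
qed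

lemma beta_orbit_self: "U \<in> coker (gmul a) \<Longrightarrow> U \<in> beta_orbit (gmul a) v U"
  unfolding beta_orbit_def by (auto intro: exI[of _ 0])

lemma coker_class_add_gmul: "coker_class a (u + gmul a w) = coker_class a u"
  by (auto simp: coker_class_eq_iff)

text \<open>Only the values of \<open>G\<close> in the lattice describe the coincidences. The
  setting is instantiated with an arbitrary deformed pair for the lower bound and with the affine
  model for the upper bound.\<close>

locale coincidence_lift =
  fixes g1 g2 :: "bundle_pt \<Rightarrow> bundle_pt" and a v :: "int ^ 2" and G
  assumes a: "a \<noteq> 0" and eqv: "equivariant (gmul a) v G"
    and coin: "\<And>x t. t \<in> {0..1} \<Longrightarrow> g1 (bpt x t) = g2 (bpt x t) \<longleftrightarrow> G (x, t) \<in> range real_vec"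
begin

abbreviation X where "X \<equiv> coincidence_space g1 g2"

lemma topspace_X: "topspace X = {bpt x t | x t. t \<in> {0..1} \<and> G (x, t) \<in> range real_vec}"
  unfolding coincidence_space_def topspace_subtopology topspace_torus_bundle using coin by blast

lemma G_per: "t \<in> {0..1} \<Longrightarrow> G (x + real_vec u, t) = G (x, t) + real_vec (gmul a u)"
  using eqv by (simp add: equivariant_def)

lemma G_glue: "A_bar *v G (x, 1) = G (A_bar *v x, 0) + real_vec (A_bar *v v)"
  using eqv by (simp add: equivariant_def)

text \<open>An open thickening of the points with label in \<open>Q\<close>. With radius 1/2, a ball
  around one lattice point contains no other lattice point, so it adds no wrongly labelled
  coincidence.\<close>

definition near :: "(int ^ 2) set set \<Rightarrow> ((real ^ 2) \<times> real) set" where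
  "near Q = {(x, t). t \<in> {0..1} \<and> (\<exists>u. coker_class a u \<in> Q \<and> norm (G (x, t) - real_vec u) < 1/2)}"

definition near_bundle :: "(int ^ 2) set set \<Rightarrow> bundle_pt set" where
  "near_bundle Q = (\<lambda>(x, t). bpt x t) ` near Q"

text \<open>A deck translation by w moves the label by \<open>gmul a w\<close>, which leaves its
  class unchanged.\<close>

lemma near_q2:
  assumes "q2 x = q2 y" "(y, t) \<in> near Q"
  shows "(x, t) \<in> near Q"
proof -
  obtain w where "x - y = real_vec w" using assms(1) by (auto simp: q2_eq_iff)
  then have w: "x = y + real_vec w" by (simp add: algebra_simps)
  obtain u where u: "t \<in> {0..1}" "coker_class a u \<in> Q" "norm (G (y, t) - real_vec u) < 1/2"
    using assms(2) by (auto simp: near_def)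
  have "G (x, t) - real_vec (u + gmul a w) = G (y, t) - real_vec u"
    using u(1) by (simp add: w G_per)
  then have "coker_class a (u + gmul a w) \<in> Q \<and> norm (G (x, t) - real_vec (u + gmul a w)) < 1/2"
    using u by (simp only: coker_class_add_gmul simp_thms)
  then show ?thesis using u(1) unfolding near_def by blast
qed

text \<open>Crossing the gluing fiber replaces the label u by A (u - v), so its class moves by
  \<open>beta\<close> and stays in the orbit.\<close>

lemma near_glue:
  assumes Q: "Q \<in> beta_orbits (gmul a) v"
  shows "(A_bar *v x, 0) \<in> near Q \<longleftrightarrow> (x, 1) \<in> near Q"
proof -
  have cc: "coker_class a (A_bar *v (u - v)) \<in> Q \<longleftrightarrow> coker_class a u \<in> Q" for u
    using beta_in_orbit_iff[OF a Q, of "coker_class a u"] by (simp only: beta_coker_class coker_eq rangeI simp_thms)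
  have "norm (G (A_bar *v x, 0) - real_vec (A_bar *v (u - v))) = norm (G (x, 1) - real_vec u)" for u
  proof -
    have "G (A_bar *v x, 0) - real_vec (A_bar *v (u - v)) = A_bar *v (G (x, 1) - real_vec u)"
      using G_glue[of x] by (simp add: algebra_simps)
    then show ?thesis by (simp only: norm_A_bar)
  qed
  then have "(\<exists>u. coker_class a u \<in> Q \<and> norm (G (x, 1) - real_vec u) < 1/2) \<longleftrightarrow>
    (\<exists>u. coker_class a (A_bar *v (u - v)) \<in> Q \<and> norm (G (A_bar *v x, 0) - real_vec (A_bar *v (u - v))) < 1/2)"
    by (simp only: cc)
  also have "\<dots> \<longleftrightarrow> (\<exists>u. coker_class a u \<in> Q \<and> norm (G (A_bar *v x, 0) - real_vec u) < 1/2)"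
  proof -
    \<comment> \<open>The inverse of u to A (u - v) is u to v - A u, because A^2 = - 1. Hence the
      quantifier may run over all u.\<close>
    have "A_bar *v (v - A_bar *v u - v) = u" for u :: "int ^ 2" by (simp add: vec2_eq_iff)
    then show ?thesis by metis
  qed
  finally show ?thesis by (simp add: near_def)
qed

text \<open>Openness in the quotient is tested on preimages; saturation shows that the preimage is
  \<open>near Q\<close> itself.\<close>

lemma near_saturated:
  assumes Q: "Q \<in> beta_orbits (gmul a) v" and t: "t \<in> {0..1}"
  shows "bpt x t \<in> near_bundle Q \<longleftrightarrow> (x, t) \<in> near Q"
proof
  assume "bpt x t \<in> near_bundle Q"
  then obtain y s where ys: "(y, s) \<in> near Q" "bpt x t = bpt y s" by (auto simp: near_bundle_def)
  then have "s \<in> {0..1}" by (auto simp: near_def)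
  then consider "t = s" "q2 x = q2 y" | "t = 1" "s = 0" "q2 y = q2 (A_bar *v x)"
    | "t = 0" "s = 1" "q2 x = q2 (A_bar *v y)"
    using ys(2) unfolding bpt_eq_iff[OF t \<open>s \<in> {0..1}\<close>] by blast
  then show "(x, t) \<in> near Q"
  proof cases
    case 1
    then show ?thesis using near_q2 ys(1) by blast
  next
    case 2
    then show ?thesis using near_q2[OF 2(3)[symmetric], of 0 Q] ys(1) near_glue[OF Q, of x] by simp
  next
    case 3
    then show ?thesis using near_q2[of x "A_bar *v y"] ys(1) near_glue[OF Q] by simp
  qed
qed (auto simp: near_bundle_def)

lemma openin_near_bundle:
  assumes Q: "Q \<in> beta_orbits (gmul a) v"
  shows "openin torus_bundle (near_bundle Q)"
proof -
  have cG: "continuous_on (UNIV \<times> {0..1}) G" using eqv by (simp add: equivariant_def)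
  have "near Q = (UNIV \<times> {0..1}) \<inter> G -` (\<Union>u\<in>{u. coker_class a u \<in> Q}. ball (real_vec u) (1/2))"
    by (auto simp: near_def dist_norm norm_minus_commute)
  then have o: "openin strip (near Q)"
    unfolding strip_eq by (simp add: continuous_openin_preimage_gen[OF cG] open_UN)
  have pre: "{p \<in> topspace strip. (case p of (x, t) \<Rightarrow> bpt x t) \<in> near_bundle Q} = near Q"
    using near_saturated[OF Q] by (auto simp: near_def)
  have sub: "near_bundle Q \<subseteq> topspace torus_bundle"
    by (auto simp: near_bundle_def near_def topspace_torus_bundle)
  show ?thesis
    using quotient_map_bpt[unfolded quotient_map_def, THEN conjunct2, rule_format, OF sub] o
    unfolding pre by (rule iffD1)
qed

text \<open>At a coincidence \<open>G\<close> equals a lattice point u, and the only lattice point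
  within 1/2 of it is u. So the class of u lies in both orbits.\<close>

lemma near_bundle_disjoint:
  assumes "Q \<in> beta_orbits (gmul a) v" "Q' \<in> beta_orbits (gmul a) v"
    and c: "c \<in> topspace X" "c \<in> near_bundle Q" "c \<in> near_bundle Q'"
  shows "Q = Q'"
proof -
  obtain x t u where t: "t \<in> {0..1}" "c = bpt x t" and u: "G (x, t) = real_vec u"
    using c(1) by (auto simp: topspace_X)
  have "coker_class a u \<in> R" if R: "R \<in> beta_orbits (gmul a) v" "c \<in> near_bundle R" for R
  proof -
    have "(x, t) \<in> near R" using near_saturated[OF R(1) t(1)] R(2) t(2) by simp
    then obtain w where w: "coker_class a w \<in> R" "norm (real_vec (u - w)) < 1/2"
      by (auto simp: near_def u)
    have "\<bar>real_vec (u - w) $ j\<bar> < 1" for j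
      using w(2) component_le_norm_cart[of "real_vec (u - w)" j] by linarith
    then have "real_of_int \<bar>(u - w) $ j\<bar> < 1" for j by (simp only: real_vec_nth of_int_abs)
    then have "\<bar>(u - w) $ j\<bar> < 1" for j by (simp only: of_int_less_1_iff)
    then have "(u - w) $ j = 0" for j by (simp only: zabs_less_one_iff)
    then have "u = w" by (simp add: vec_eq_iff)
    then show ?thesis using w(1) by simp
  qed
  then show ?thesis using beta_orbits_disjoint[OF a assms(1,2)] assms by blast
qed

lemma topspace_X_near: "c \<in> topspace X \<Longrightarrow> \<exists>Q\<in>beta_orbits (gmul a) v. c \<in> near_bundle Q"
proof -
  assume "c \<in> topspace X"
  then obtain x t u where t: "t \<in> {0..1}" "c = bpt x t" and u: "G (x, t) = real_vec u"
    by (auto simp: topspace_X)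
  let ?Q = "beta_orbit (gmul a) v (coker_class a u)"
  have "(x, t) \<in> near ?Q" using t(1) u beta_orbit_self[of "coker_class a u" a v] by (auto simp: near_def coker_eq)
  then have "c \<in> near_bundle ?Q" unfolding near_bundle_def t(2) by force
  then show ?thesis by (auto simp: beta_orbits_def coker_eq)
qed

text \<open>A path component is connected. The open set of one orbit and the union of those of all
  other orbits cover it and do not meet on it.\<close>

lemma path_component_near:
  assumes p: "path_component_of X c c'" and Q: "Q \<in> beta_orbits (gmul a) v" "Q' \<in> beta_orbits (gmul a) v"
    and c: "c \<in> near_bundle Q" "c' \<in> near_bundle Q'"
  shows "Q = Q'"
proof (rule ccontr)
  assume "Q \<noteq> Q'"
  define C where "C = path_component_of_set X c"
  have "path_component_of X c c" using p by (meson path_component_of_sym path_component_of_trans)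
  then have C: "connectedin X C" "c \<in> C" "c' \<in> C"
    using p path_connectedin_path_component_of[of X c]
    by (simp_all add: C_def path_connectedin_imp_connectedin)
  then have CX: "C \<subseteq> topspace X" by (simp add: connectedin_subset_topspace)
  have cC: "connectedin torus_bundle C"
    using C(1) by (simp add: coincidence_space_def connectedin_subtopology)
  define E where "E = (\<Union>R\<in>beta_orbits (gmul a) v - {Q}. near_bundle R)"
  have "openin torus_bundle E" unfolding E_def using openin_near_bundle by auto
  moreover have "C \<subseteq> near_bundle Q \<union> E" unfolding E_def using CX topspace_X_near by blast
  moreover have "near_bundle Q \<inter> E \<inter> C = {}"
    unfolding E_def using CX near_bundle_disjoint[OF Q(1)] by blast
  moreover have "near_bundle Q \<inter> C \<noteq> {}" "E \<inter> C \<noteq> {}"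
    using C c Q \<open>Q \<noteq> Q'\<close> unfolding E_def by auto
  ultimately show False using cC openin_near_bundle[OF Q(1)] unfolding connectedin by blast
qed

text \<open>On the fiber over t = 0 the lift is onto the plane, so it takes any prescribed lattice
  value.\<close>

lemma orbit_near_nonempty:
  assumes Q: "Q \<in> beta_orbits (gmul a) v"
  shows "\<exists>c. c \<in> topspace X \<and> c \<in> near_bundle Q"
proof -
  obtain u where u: "Q = beta_orbit (gmul a) v (coker_class a u)"
    using Q by (auto simp: beta_orbits_def coker_eq)
  have "continuous_on UNIV (\<lambda>x. G (x, 0))"
    by (rule continuous_on_compose2[of "UNIV \<times> {0..1}" G])
      (use eqv in \<open>auto simp: equivariant_def intro!: continuous_intros\<close>)
  then obtain x where x: "G (x, 0) = real_vec u"
    by (rule equivariant_surj[OF a]) (simp add: G_per, blast)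
  have "(x, 0) \<in> near Q"
    unfolding u using x beta_orbit_self[of "coker_class a u" a v] by (auto simp: near_def coker_eq)
  then have "bpt x 0 \<in> near_bundle Q" unfolding near_bundle_def by force
  moreover have "bpt x 0 \<in> topspace X" using x by (force simp: topspace_X)
  ultimately show ?thesis by blast
qed

lemma beta_orbits_le_path_components:
  "enat (card (beta_orbits (gmul a) v)) \<le> ecard (path_components_of X)"
proof -
  obtain z where z: "\<And>Q. Q \<in> beta_orbits (gmul a) v \<Longrightarrow> z Q \<in> topspace X \<and> z Q \<in> near_bundle Q"
    using orbit_near_nonempty by metis
  let ?K = "\<lambda>Q. path_component_of_set X (z Q)"
  have "inj_on ?K (beta_orbits (gmul a) v)"
  proof (rule inj_onI)
    fix Q Q' assume Q: "Q \<in> beta_orbits (gmul a) v" "Q' \<in> beta_orbits (gmul a) v" "?K Q = ?K Q'"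
    then have "path_component_of X (z Q) (z Q')"
      using z[OF Q(2)] by (metis mem_Collect_eq path_component_of_refl)
    then show "Q = Q'" by (rule path_component_near) (use Q z in auto)
  qed
  moreover have "?K ` beta_orbits (gmul a) v \<subseteq> path_components_of X"
    using z by (auto simp: path_components_of_def)
  ultimately have "card (beta_orbits (gmul a) v) \<le> card (path_components_of X)"
    if "finite (path_components_of X)"
    using that by (metis card_image card_mono)
  then show ?thesis by (simp add: ecard_def)
qed

end

section \<open>The upper bound: the affine model\<close>

context coincidence_lift
begin

text \<open>Coincidences with value u form one arc. Its class under path components depends only on
  u modulo \<open>a\<close>, and the end of the arc of u is the start of the arc of A (u - v), so
  all arcs of one orbit lie in a single component.\<close>

lemma path_components_le_beta_orbits:
  assumes affine: "\<And>x t. t \<in> {0..1} \<Longrightarrow> G (x, t) = rmul a x + t *\<^sub>R real_vec v"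
  shows "ecard (path_components_of X) \<le> enat (card (beta_orbits (gmul a) v))"
proof -
  \<comment> \<open>The unique solution x of L x + t v = u, followed over all heights t.\<close>
  define \<gamma> where "\<gamma> u t = bpt (rdiv a (real_vec u - t *\<^sub>R real_vec v)) t" for u t
  have lattice_div: "rdiv a (real_vec (gmul a w)) = real_vec w" for w
    using rdiv_rmul[OF a, of "real_vec w"] by simp
  have \<gamma>X: "\<gamma> u t \<in> topspace X" if "t \<in> {0..1}" for u t
  proof -
    have "G (rdiv a (real_vec u - t *\<^sub>R real_vec v), t) = real_vec u"
      using affine[OF that] a by (simp del: rdiv_simps)
    then show ?thesis using that unfolding topspace_X \<gamma>_def by blast
  qed
  have path: "path_component_of X (\<gamma> u 0) (\<gamma> u t)" if t: "t \<in> {0..1}" for u t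
  proof -
    have st: "s * t \<in> {0..1}" if "s \<in> {0..1}" for s
      using t that by (auto intro: mult_le_one)
    have "continuous_map (top_of_set {0..1}) torus_bundle (\<lambda>s. \<gamma> u (s * t))"
      unfolding \<gamma>_def by (intro continuous_map_bpt continuous_intros st)
    then have "pathin X (\<lambda>s. \<gamma> u (s * t))"
      unfolding pathin_def coincidence_space_def continuous_map_in_subtopology
      using \<gamma>X[OF st] by (auto simp: coincidence_space_def)
    then show ?thesis unfolding path_component_of_def by (intro exI[of _ "\<lambda>s. \<gamma> u (s * t)"]) simp
  qed
  define K where "K u = path_component_of_set X (\<gamma> u 0)" for u
  have K_eq: "K u = path_component_of_set X (\<gamma> u t)" if "t \<in> {0..1}" for u t
    unfolding K_def using path[OF that, of u] path_component_of_equiv[of X "\<gamma> u 0" "\<gamma> u t"] by auto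
  have K_per: "K (u + gmul a w) = K u" for u w
    by (simp add: K_def \<gamma>_def lattice_div)
  have K_ccls: "K u = K w" if uw: "coker_class a u = coker_class a w" for u w
  proof -
    obtain z where "gauss u - gauss w = gauss a * gauss z" using uw unfolding coker_class_eq_iff by blast
    then have "gauss u = gauss (w + gmul a z)" by (simp add: algebra_simps)
    then have "u = w + gmul a z" by (simp only: gauss_inject)
    then show ?thesis using K_per by simp
  qed
  have K_A: "K (A_bar *v (u - v)) = K u" for u
  proof -
    have "\<gamma> u 1 = \<gamma> (A_bar *v (u - v)) 0" by (simp add: \<gamma>_def bpt_1)
    then show ?thesis using K_eq[of 1 u] by (simp add: K_def)
  qed
  have K_iter: "(beta (gmul a) v ^^ n) (coker_class a u) = coker_class a w \<Longrightarrow> K u = K w" for n u w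
  proof (induction n arbitrary: u)
    case 0
    then have "coker_class a u = coker_class a w" by simp
    then show ?case by (rule K_ccls)
  next
    case (Suc n)
    then have "(beta (gmul a) v ^^ n) (coker_class a (A_bar *v (u - v))) = coker_class a w"
      by (simp only: funpow_Suc_right comp_apply beta_coker_class)
    then have "K (A_bar *v (u - v)) = K w" by (rule Suc.IH)
    then show ?case by (simp only: K_A)
  qed
  \<comment> \<open>\<open>K\<close> is constant on each orbit, so any label chosen from the orbit
    yields its component.\<close>
  define R where "R Q = K (SOME u. coker_class a u \<in> Q)" for Q
  have K_R: "K u = R (beta_orbit (gmul a) v (coker_class a u))" for u
  proof -
    let ?Q = "beta_orbit (gmul a) v (coker_class a u)"
    have "coker_class a u \<in> ?Q" by (rule beta_orbit_self) (simp add: coker_eq)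
    then have "coker_class a (SOME u. coker_class a u \<in> ?Q) \<in> ?Q" by (rule someI)
    then show ?thesis unfolding R_def beta_orbit_def using K_iter by blast
  qed
  have sub: "path_components_of X \<subseteq> R ` beta_orbits (gmul a) v"
  proof
    fix C assume "C \<in> path_components_of X"
    then obtain x t u where x: "t \<in> {0..1}" "G (x, t) = real_vec u"
      "C = path_component_of_set X (bpt x t)"
      by (auto simp: path_components_of_def topspace_X)
    have "rmul a x = real_vec u - t *\<^sub>R real_vec v" using affine[OF x(1)] x(2) by (simp add: algebra_simps)
    then have "x = rdiv a (real_vec u - t *\<^sub>R real_vec v)" using rdiv_rmul[OF a, of x] by simp
    then have "C = K u" using K_eq[OF x(1), of u] x(3) by (simp add: \<gamma>_def)
    then show "C \<in> R ` beta_orbits (gmul a) v" using K_R by (auto simp: beta_orbits_def coker_eq)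
  qed
  have fin: "finite (R ` beta_orbits (gmul a) v)" using finite_beta_orbits[OF a] by simp
  have "card (path_components_of X) \<le> card (beta_orbits (gmul a) v)"
    using card_mono[OF fin sub] card_image_le[OF finite_beta_orbits[OF a], of R v] by linarith
  then show ?thesis using finite_subset[OF sub fin] by (simp add: ecard_def)
qed

end

section \<open>Straight line deformations and simultaneous lifts\<close>

lemma fiberwise_deformation:
  assumes f1: "fiberwise f1" and F1: "continuous_on (UNIV \<times> {0..1}) F1"
    "\<And>x t. t \<in> {0..1} \<Longrightarrow> f1 (bpt x t) = bpt (F1 (x, t)) t"
    and D: "equivariant L v (\<lambda>p. F1 p - F2 p)" and G: "equivariant L v G"
  obtains g1 where "fiberwise_homotopic f1 g1"
    "\<And>x t. t \<in> {0..1} \<Longrightarrow> g1 (bpt x t) = bpt (F2 (x, t) + G (x, t)) t"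
proof -
  let ?I = "{0..1::real}"
  \<comment> \<open>Both summands have the same L and v, whose contributions cancel in
    \<open>E\<close>. So \<open>E\<close> is periodic and compatible with the gluing without any
    shift, and s E can be added to \<open>F1\<close> for every real s in I.\<close>
  define E where "E p = G p - (F1 p - F2 p)" for p
  have cE: "continuous_on (UNIV \<times> ?I) E"
    unfolding E_def by (rule continuous_on_diff) (use D G in \<open>simp_all add: equivariant_def\<close>)
  have E_per: "E (x + real_vec u, t) = E (x, t)" if "t \<in> ?I" for x t u
    using D G that by (simp add: E_def equivariant_def)
  have "A_bar *v G (x, 1) - A_bar *v (F1 (x, 1) - F2 (x, 1)) = E (A_bar *v x, 0)" for x
    using D G unfolding E_def equivariant_def by (simp del: A_bar_distribs)
  then have E_glue: "A_bar *v E (x, 1) = E (A_bar *v x, 0)" for x by (simp add: E_def)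
  define \<phi> where "\<phi> = (\<lambda>(s, x, t). bpt (F1 (x, t) + s *\<^sub>R E (x, t)) t)"
  have "continuous_map (top_of_set cylinder) torus_bundle \<phi>"
    unfolding \<phi>_def case_prod_unfold
    by (intro continuous_map_bpt continuous_intros continuous_on_compose2[OF F1(1)] continuous_on_compose2[OF cE]) auto
  then have c\<phi>: "continuous_map (prod_topology (top_of_set ?I) strip) torus_bundle \<phi>"
    by (simp only: cylinder_eq)
  have q: "q2 (x + z) = q2 (y + z)" if "q2 x = q2 y" for x y z using that by (simp add: q2_eq_iff)
  have per: "\<phi> (s, x + real_vec u, t) = \<phi> (s, x, t)" if t: "t \<in> ?I" for s x t u
  proof -
    have "q2 (F1 (x + real_vec u, t)) = q2 (F1 (x, t))"
      using F1(2)[OF t, of "x + real_vec u"] F1(2)[OF t, of x] t by simp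
    from q[OF this, of "s *\<^sub>R E (x, t)"] show ?thesis using t by (simp add: \<phi>_def E_per)
  qed
  have glue: "\<phi> (s, x, 1) = \<phi> (s, A_bar *v x, 0)" for s x
  proof -
    have "q2 (A_bar *v F1 (x, 1)) = q2 (F1 (A_bar *v x, 0))"
      using F1(2)[of 1 x] F1(2)[of 0 "A_bar *v x"] by (simp add: bpt_1)
    from q[OF this, of "s *\<^sub>R E (A_bar *v x, 0)"] show ?thesis by (simp add: \<phi>_def bpt_1 E_glue)
  qed
  have I: "locally_compact_space (top_of_set ?I)" "Hausdorff_space (top_of_set ?I)"
    by (auto simp: compact_space_subtopology Hausdorff_space_subtopology
        intro: compact_imp_locally_compact_space)
  obtain h where h: "continuous_map (prod_topology (top_of_set ?I) torus_bundle) torus_bundle h"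
    and h\<phi>: "\<And>s x t. s \<in> ?I \<Longrightarrow> t \<in> ?I \<Longrightarrow> h (s, bpt x t) = \<phi> (s, x, t)"
    using bundle_descent[OF I c\<phi> per glue] by auto
  have fib: "fiberwise (\<lambda>c. h (s, c))" if s: "s \<in> ?I" for s
  proof -
    have "continuous_map torus_bundle (prod_topology (top_of_set ?I) torus_bundle) (\<lambda>c. (s, c))"
      using s by (simp add: continuous_map_pairwise comp_def)
    from continuous_map_compose[OF this h] have "continuous_map torus_bundle torus_bundle (\<lambda>c. h (s, c))"
      by (simp add: comp_def)
    moreover have "bundle_proj (h (s, c)) = bundle_proj c" if "c \<in> topspace torus_bundle" for c
      using that s unfolding topspace_torus_bundle by (auto simp: h\<phi> \<phi>_def bundle_proj_bpt)
    ultimately show ?thesis by (simp add: fiberwise_def)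
  qed
  have h0: "h (0, c) = f1 c" if "c \<in> topspace torus_bundle" for c
    using that unfolding topspace_torus_bundle by (auto simp: h\<phi> \<phi>_def F1(2))
  show thesis
  proof (rule that)
    show "fiberwise_homotopic f1 (\<lambda>c. h (1, c))"
      unfolding fiberwise_homotopic_def
      \<comment> \<open>Outside the bundle the descended map has arbitrary values, so the end
        conditions are reduced to points of the bundle.\<close>
      by (subst homotopic_with[OF fiberwise_cong]) (use h fib h0 in blast)+
    show "h (1, bpt x t) = bpt (F2 (x, t) + G (x, t)) t" if "t \<in> ?I" for x t
      using that by (simp add: h\<phi> \<phi>_def E_def add.commute)
  qed
qed

text \<open>Lifting both homotopies together gives one pair (L, v) for the original and for the
  deformed maps; this is homotopy invariance of the labels.\<close>

lemma fiberwise_lift_pair: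
  assumes "fiberwise_homotopic f1 g1" "fiberwise_homotopic f2 g2"
  obtains F1 F2 G1 G2 L v where
    "continuous_on (UNIV \<times> {0..1}) F1" "continuous_on (UNIV \<times> {0..1}) F2"
    "\<And>x t. t \<in> {0..1} \<Longrightarrow> f1 (bpt x t) = bpt (F1 (x, t)) t"
    "\<And>x t. t \<in> {0..1} \<Longrightarrow> f2 (bpt x t) = bpt (F2 (x, t)) t"
    "\<And>x t. t \<in> {0..1} \<Longrightarrow> g1 (bpt x t) = bpt (G1 (x, t)) t"
    "\<And>x t. t \<in> {0..1} \<Longrightarrow> g2 (bpt x t) = bpt (G2 (x, t)) t"
    "equivariant L v (\<lambda>p. F1 p - F2 p)" "equivariant L v (\<lambda>p. G1 p - G2 p)"
proof -
  obtain h1 where h1: "continuous_map (prod_topology (top_of_set {0..1::real}) torus_bundle) torus_bundle h1"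
    "\<And>c. h1 (0, c) = f1 c" "\<And>c. h1 (1, c) = g1 c" "\<And>s::real. s \<in> {0..1} \<Longrightarrow> fiberwise (\<lambda>c. h1 (s, c))"
    using assms(1) unfolding fiberwise_homotopic_def homotopic_with_def by metis
  obtain h2 where h2: "continuous_map (prod_topology (top_of_set {0..1::real}) torus_bundle) torus_bundle h2"
    "\<And>c. h2 (0, c) = f2 c" "\<And>c. h2 (1, c) = g2 c" "\<And>s::real. s \<in> {0..1} \<Longrightarrow> fiberwise (\<lambda>c. h2 (s, c))"
    using assms(2) unfolding fiberwise_homotopic_def homotopic_with_def by metis
  obtain H1 where H1: "continuous_on cylinder H1"
    "\<And>s x t. s \<in> {0..1} \<Longrightarrow> t \<in> {0..1} \<Longrightarrow> h1 (s, bpt x t) = bpt (H1 (s, x, t)) t"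
    using family_lift[OF h1(1,4)] by metis
  obtain H2 where H2: "continuous_on cylinder H2"
    "\<And>s x t. s \<in> {0..1} \<Longrightarrow> t \<in> {0..1} \<Longrightarrow> h2 (s, bpt x t) = bpt (H2 (s, x, t)) t"
    using family_lift[OF h2(1,4)] by metis
  obtain L v where eqv: "\<And>s. s \<in> {0..1} \<Longrightarrow> equivariant L v (\<lambda>(x, t). H1 (s, x, t) - H2 (s, x, t))"
    by (rule family_equivariant[OF H1(1) H2(1) H1(2) H2(2)]) (assumption | (rule that; simp))+
  have slice: "continuous_on (UNIV \<times> {0..1}) (\<lambda>p. H (s, p))"
    if "continuous_on cylinder H" "s \<in> {0..1}" for H :: "real \<times> (real ^ 2) \<times> real \<Rightarrow> real ^ 2" and s
    by (rule continuous_on_compose2[OF that(1)]) (use that(2) in \<open>auto intro!: continuous_intros\<close>)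
  show thesis
  proof (rule that)
    show "continuous_on (UNIV \<times> {0..1}) (\<lambda>p. H1 (0, p))" "continuous_on (UNIV \<times> {0..1}) (\<lambda>p. H2 (0, p))"
      using slice H1(1) H2(1) by auto
    show "f1 (bpt x t) = bpt (H1 (0, (x, t))) t" "f2 (bpt x t) = bpt (H2 (0, (x, t))) t"
      "g1 (bpt x t) = bpt (H1 (1, (x, t))) t" "g2 (bpt x t) = bpt (H2 (1, (x, t))) t"
      if "t \<in> {0..1}" for x t
      using H1(2)[of 0 t x] H1(2)[of 1 t x] H2(2)[of 0 t x] H2(2)[of 1 t x] h1 h2 that by simp_all
    show "equivariant L v (\<lambda>p. H1 (0, p) - H2 (0, p))" "equivariant L v (\<lambda>p. H1 (1, p) - H2 (1, p))"
      using eqv[of 0] eqv[of 1] by (simp_all add: case_prod_unfold)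
  qed
qed

lemma fiberwise_homotopic_refl: "fiberwise f \<Longrightarrow> fiberwise_homotopic f f"
  by (simp add: fiberwise_homotopic_def) (simp add: fiberwise_def)

text \<open>Constant homotopies supply the lifts. The homomorphism is then exactly \<open>L\<close>,
  whereas the lattice vector \<open>w\<close> belongs to the chosen lifts.\<close>

lemma classifying_pair_lift:
  assumes "fiberwise f1" "fiberwise f2" "classifying_pair (\<lambda>c. fiber_minus (f1 c) (f2 c)) L v"
  obtains F1 F2 w where
    "continuous_on (UNIV \<times> {0..1}) F1" "continuous_on (UNIV \<times> {0..1}) F2"
    "\<And>x t. t \<in> {0..1} \<Longrightarrow> f1 (bpt x t) = bpt (F1 (x, t)) t"
    "\<And>x t. t \<in> {0..1} \<Longrightarrow> f2 (bpt x t) = bpt (F2 (x, t)) t"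
    "equivariant L w (\<lambda>p. F1 p - F2 p)" "even (v $ 1 + v $ 2) \<longleftrightarrow> even (w $ 1 + w $ 2)"
proof (rule fiberwise_lift_pair[OF assms(1,2)[THEN fiberwise_homotopic_refl]])
  fix F1 F2 G1 G2 M w
  assume F: "continuous_on (UNIV \<times> {0..1}) F1" "continuous_on (UNIV \<times> {0..1}) F2"
    "\<And>x t. t \<in> {0..1} \<Longrightarrow> f1 (bpt x t) = bpt (F1 (x, t)) t"
    "\<And>x t. t \<in> {0..1} \<Longrightarrow> f2 (bpt x t) = bpt (F2 (x, t)) t"
    and eqv: "equivariant M w (\<lambda>p. F1 p - F2 p)"
  have "L = M" using classifying_hom[OF F(3,4) eqv assms(3)] .
  then show thesis
    using that[OF F] eqv classifying_parity[OF F(3,4) eqv assms(3)] by simp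
qed

lemma classifying_pair_gmul:
  assumes "fiberwise f1" "fiberwise f2" "classifying_pair (\<lambda>c. fiber_minus (f1 c) (f2 c)) L v"
  shows "L = gmul (L (vector [1, 0]))"
proof -
  obtain F1 F2 w where "equivariant L w (\<lambda>p. F1 p - F2 p)"
    by (rule classifying_pair_lift[OF assms])
  then show ?thesis by (intro complex_linear_eq_gmul equivariant_hom)
qed

text \<open>The labels bound every admissible pair from below. For attainment it suffices to deform
  \<open>f1\<close> and keep \<open>f2\<close>, since any equivariant map with the same data can be
  made the difference of the lifts.\<close>

lemma MCC_B_eq:
  assumes f: "fiberwise f1" "fiberwise f2"
    and cp: "classifying_pair (\<lambda>c. fiber_minus (f1 c) (f2 c)) (gmul a) v"
  shows "MCC_B f1 f2 = (if a = 0 then 0 else enat (nu_total (gmul a) v))"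
proof -
  define S where "S = {(g1, g2). fiberwise_homotopic f1 g1 \<and> fiberwise_homotopic f2 g2}"
  define N where "N = (\<lambda>(g1, g2). ecard (path_components_of (coincidence_space g1 g2)))"
  have MCC: "MCC_B f1 f2 = Inf (N ` S)" by (simp add: MCC_B_def S_def N_def)
  obtain F1 F2 w where F: "continuous_on (UNIV \<times> {0..1}) F1" "continuous_on (UNIV \<times> {0..1}) F2"
      "\<And>x t. t \<in> {0..1} \<Longrightarrow> f1 (bpt x t) = bpt (F1 (x, t)) t"
      "\<And>x t. t \<in> {0..1} \<Longrightarrow> f2 (bpt x t) = bpt (F2 (x, t)) t"
    and eqv: "equivariant (gmul a) w (\<lambda>p. F1 p - F2 p)"
    and par: "even (v $ 1 + v $ 2) \<longleftrightarrow> even (w $ 1 + w $ 2)"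
    by (rule classifying_pair_lift[OF f cp]) (assumption | (rule that; simp))+
  have deform: "\<exists>g1. (g1, f2) \<in> S \<and>
      (\<forall>x. \<forall>t\<in>{0..1}. g1 (bpt x t) = f2 (bpt x t) \<longleftrightarrow> G (x, t) \<in> range real_vec)"
    if G: "equivariant (gmul a) w G" for G
  proof -
    obtain g1 where g1: "fiberwise_homotopic f1 g1"
      "\<And>x t. t \<in> {0..1} \<Longrightarrow> g1 (bpt x t) = bpt (F2 (x, t) + G (x, t)) t"
      by (rule fiberwise_deformation[OF f(1) F(1,3) eqv G]) (assumption | (rule that; simp))+
    have "g1 (bpt x t) = f2 (bpt x t) \<longleftrightarrow> G (x, t) \<in> range real_vec" if "t \<in> {0..1}" for x t
      using g1(2) F(4) that by (simp add: q2_eq_iff)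
    moreover have "(g1, f2) \<in> S" using g1(1) fiberwise_homotopic_refl[OF f(2)] by (simp add: S_def)
    ultimately show ?thesis by blast
  qed
  show ?thesis
  proof (cases "a = 0")
    case True
    \<comment> \<open>The endpoints satisfy A b = c + A w, as the gluing demands, and both have
      first coordinate 1/2. The whole segment therefore avoids the lattice.\<close>
    define b :: "real ^ 2" where "b = vector [1/2, of_int (w $ 2) - 1/2]"
    define c :: "real ^ 2" where "c = vector [1/2, 1/2 - of_int (w $ 1)]"
    have zero: "gmul a u = 0" for u by (simp add: True gmul_def vec2_eq_iff)
    have "equivariant (gmul a) w (\<lambda>p. c + snd p *\<^sub>R (b - c))"
      unfolding equivariant_def
      by (auto simp: zero b_def c_def vec2_eq_iff intro!: continuous_intros)
    from deform[OF this] obtain g1 where g1: "(g1, f2) \<in> S"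
      "\<And>x t. t \<in> {0..1} \<Longrightarrow> g1 (bpt x t) = f2 (bpt x t) \<longleftrightarrow> c + t *\<^sub>R (b - c) \<in> range real_vec" by auto
    have "c + t *\<^sub>R (b - c) \<notin> range real_vec" for t
    proof
      assume "c + t *\<^sub>R (b - c) \<in> range real_vec"
      then obtain u where "c + t *\<^sub>R (b - c) = real_vec u" by blast
      then have "(c + t *\<^sub>R (b - c)) $ 1 = real_vec u $ 1" by simp
      then have "real_of_int (2 * u $ 1) = of_int 1" by (simp add: b_def c_def)
      then have "2 * u $ 1 = 1" by (simp only: of_int_eq_iff)
      then show False by presburger
    qed
    then have "topspace (coincidence_space g1 f2) = {}"
      using g1(2) by (auto simp: coincidence_space_def topspace_torus_bundle)
    then have "N (g1, f2) = 0"
      by (simp add: N_def ecard_def path_components_of_eq_empty null_topspace_iff_trivial zero_enat_def)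
    then have "Inf (N ` S) \<le> 0" using g1(1) by (metis INF_lower)
    then show ?thesis using True by (simp add: MCC)
  next
    case False
    have "enat (nu_total (gmul a) v) \<le> N p" if "p \<in> S" for p
    proof -
      obtain g1 g2 where p: "p = (g1, g2)" by (cases p)
      then have hom: "fiberwise_homotopic f1 g1" "fiberwise_homotopic f2 g2" using that by (auto simp: S_def)
      show ?thesis
      proof (rule fiberwise_lift_pair[OF hom])
        fix H1 H2 G1 G2 M z
        assume H: "\<And>x t. t \<in> {0..1} \<Longrightarrow> f1 (bpt x t) = bpt (H1 (x, t)) t"
            "\<And>x t. t \<in> {0..1} \<Longrightarrow> f2 (bpt x t) = bpt (H2 (x, t)) t"
          and G: "\<And>x t. t \<in> {0..1} \<Longrightarrow> g1 (bpt x t) = bpt (G1 (x, t)) t"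
            "\<And>x t. t \<in> {0..1} \<Longrightarrow> g2 (bpt x t) = bpt (G2 (x, t)) t"
          and eqvH: "equivariant M z (\<lambda>p. H1 p - H2 p)" and eqvG: "equivariant M z (\<lambda>p. G1 p - G2 p)"
        \<comment> \<open>The lifts of this pair bring their own vector \<open>z\<close>; its parity
          is that of \<open>v\<close>, which is enough for the orbit count.\<close>
        have M: "M = gmul a" and parz: "even (z $ 1 + z $ 2) \<longleftrightarrow> even (v $ 1 + v $ 2)"
          using classifying_hom[OF H eqvH cp] classifying_parity[OF H eqvH cp] by simp_all
        interpret coincidence_lift g1 g2 a z "\<lambda>p. G1 p - G2 p"
          by unfold_locales (use False eqvG M G in \<open>auto simp: q2_eq_iff\<close>)
        show ?thesis
          using beta_orbits_le_path_components card_beta_orbits_cong[OF False parz] by (simp add: p N_def)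
      qed
    qed
    then have lower: "enat (nu_total (gmul a) v) \<le> Inf (N ` S)" by (rule INF_greatest)
    \<comment> \<open>The affine representative of the homotopy class.\<close>
    define G where "G = (\<lambda>p. rmul a (fst p) + snd p *\<^sub>R real_vec w)"
    have eqvG: "equivariant (gmul a) w G"
      unfolding equivariant_def G_def by (auto intro!: continuous_intros)
    from deform[OF this] obtain g1 where g1: "(g1, f2) \<in> S"
      "\<And>x t. t \<in> {0..1} \<Longrightarrow> g1 (bpt x t) = f2 (bpt x t) \<longleftrightarrow> G (x, t) \<in> range real_vec" by auto
    interpret coincidence_lift g1 f2 a w G
      by unfold_locales (use False eqvG g1(2) in auto)
    have "N (g1, f2) \<le> enat (nu_total (gmul a) v)"
      using path_components_le_beta_orbits card_beta_orbits_cong[OF False par[symmetric]]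
      by (simp add: N_def G_def)
    then have "Inf (N ` S) \<le> enat (nu_total (gmul a) v)" using g1(1) by (meson INF_lower order_trans)
    then show ?thesis using lower False by (simp add: MCC)
  qed
qed

theorem proposition1p21:
  fixes f1 f2 :: "bundle_pt \<Rightarrow> bundle_pt"
    and L :: "int ^ 2 \<Rightarrow> int ^ 2" and v :: "int ^ 2"
    and k l q r :: int
  assumes "fiberwise f1" and "fiberwise f2"
    and "classifying_pair (\<lambda>c. fiber_minus (f1 c) (f2 c)) L v"
    and "L (vector [1, 0]) = vector [k, l]"
    and "k\<^sup>2 + l\<^sup>2 = 4 * q + r" and "q \<ge> 0" and "r \<in> {0, 1, 2}"
  shows
    "(\<forall>u w. L (u + w) = L u + L w) \<and> (\<forall>u. L (A_bar *v u) = A_bar *v L u)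
     \<and> MCC_B f1 f2 =
         (if k\<^sup>2 + l\<^sup>2 = 0 then 0
          else if k\<^sup>2 + l\<^sup>2 = 4 * q \<and> 4 * q > 0 \<and> \<not> [v $ 1 = v $ 2] (mod 2) then enat (nat q)
          else if k\<^sup>2 + l\<^sup>2 > 0 \<and> even (k\<^sup>2 + l\<^sup>2) \<and> [v $ 1 = v $ 2] (mod 2) then enat (nat (q + 2))
          else enat (nat (q + 1)))
     \<and> (k\<^sup>2 + l\<^sup>2 = 4 * q \<and> 4 * q > 0 \<and> \<not> [v $ 1 = v $ 2] (mod 2) \<longrightarrow> q > 0)
     \<and> (L \<noteq> (\<lambda>u. 0) \<longrightarrow>
          beta L v ` coker L \<subseteq> coker L
        \<and> finite (coker L) \<and> int (card (coker L)) = k\<^sup>2 + l\<^sup>2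
        \<and> (\<forall>Q\<in>beta_orbits L v. card Q \<in> {1, 2, 4})
        \<and> (\<forall>g1 g2 L' v'.
              fiberwise g1 \<and> fiberwise g2
              \<and> classifying_pair (\<lambda>c. fiber_minus (g1 c) (g2 c)) L' v'
              \<and> L' \<noteq> (\<lambda>u. 0)
              \<and> card (coker L') = card (coker L)
              \<and> (even (v' $ 1 + v' $ 2) \<longleftrightarrow> even (v $ 1 + v $ 2))
              \<longrightarrow> nu_quadruple L' v' = nu_quadruple L v)
        \<and> ([v $ 1 = v $ 2] (mod 2) \<longrightarrow>
              (k\<^sup>2 + l\<^sup>2 = 4 * q \<and> 4 * q > 0 \<longrightarrow> nu_quadruple L v = (2, 1, q - 1, q + 2))
            \<and> (k\<^sup>2 + l\<^sup>2 = 4 * q + 1 \<longrightarrow> nu_quadruple L v = (1, 0, q, q + 1))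
            \<and> (k\<^sup>2 + l\<^sup>2 = 4 * q + 2 \<longrightarrow> nu_quadruple L v = (2, 0, q, q + 2)))
        \<and> (\<not> [v $ 1 = v $ 2] (mod 2) \<longrightarrow>
              (k\<^sup>2 + l\<^sup>2 = 4 * q \<and> 4 * q > 0 \<longrightarrow> nu_quadruple L v = (0, 0, q, q))
            \<and> (k\<^sup>2 + l\<^sup>2 = 4 * q + 1 \<longrightarrow> nu_quadruple L v = (1, 0, q, q + 1))
            \<and> (k\<^sup>2 + l\<^sup>2 = 4 * q + 2 \<longrightarrow> nu_quadruple L v = (0, 1, q, q + 1)))
        \<and> (\<forall>Q\<in>beta_orbits L v. odd (card Q) \<longrightarrow> (\<exists>U\<in>coker L. Q = {U} \<and> beta L v U = U))
        \<and> (even (nu L v 1) \<longleftrightarrow> even (card (coker L)))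
        \<and> nu L v 1 \<in> {0, 1, 2})"
proof -
  note fw = assms(1,2) and cp = assms(3)
  define a where "a = (vector [k, l] :: int ^ 2)"
  have L: "L = gmul a" using classifying_pair_gmul[OF fw cp] assms(4) by (simp add: a_def)
  have N: "gnorm a = k\<^sup>2 + l\<^sup>2" by (simp add: a_def gnorm_def)
  have a0: "a = 0 \<longleftrightarrow> k\<^sup>2 + l\<^sup>2 = 0" unfolding N[symmetric] by simp
  have L0: "L = (\<lambda>u. 0) \<longleftrightarrow> a = 0"
  proof
    assume "L = (\<lambda>u. 0)"
    then show "a = 0" using assms(4) by (simp add: a_def)
  qed (simp add: L gmul_def vec2_eq_iff fun_eq_iff)
  have v: "[v $ 1 = v $ 2] (mod 2) \<longleftrightarrow> even (v $ 1 + v $ 2)"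
    unfolding cong_def by presburger
  have lin: "(\<forall>u w. L (u + w) = L u + L w) \<and> (\<forall>u. L (A_bar *v u) = A_bar *v L u)"
    by (simp add: L gmul_def vec2_eq_iff algebra_simps)
  note nuq = nu_quadruple_gmul[of a q v, unfolded N, folded L]
  \<comment> \<open>The last entry of the table is the coincidence number, so both halves of the
    result are read off the same quadruples.\<close>
  have total: "snd (snd (snd (nu_quadruple L v))) = int (nu_total L v)"
    by (simp add: nu_quadruple_def)
  have r: "k\<^sup>2 + l\<^sup>2 = 4 * q \<or> k\<^sup>2 + l\<^sup>2 = 4 * q + 1 \<or> k\<^sup>2 + l\<^sup>2 = 4 * q + 2"
    using assms(5,7) by auto
  have MCC: "MCC_B f1 f2 =
         (if k\<^sup>2 + l\<^sup>2 = 0 then 0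
          else if k\<^sup>2 + l\<^sup>2 = 4 * q \<and> 4 * q > 0 \<and> \<not> [v $ 1 = v $ 2] (mod 2) then enat (nat q)
          else if k\<^sup>2 + l\<^sup>2 > 0 \<and> even (k\<^sup>2 + l\<^sup>2) \<and> [v $ 1 = v $ 2] (mod 2) then enat (nat (q + 2))
          else enat (nat (q + 1)))" (is "_ = ?m")
  proof (cases "a = 0")
    case True
    then show ?thesis using MCC_B_eq[OF fw] cp a0 unfolding L by simp
  next
    case False
    have "gnorm a > 0" using False gnorm_nonneg[of a] gnorm_eq_0_iff[of a] by linarith
    then have pos: "k\<^sup>2 + l\<^sup>2 > 0" unfolding N .
    have "enat (nat (int (nu_total L v))) = ?m"
      using r
    proof (elim disjE)
      assume c: "k\<^sup>2 + l\<^sup>2 = 4 * q"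
      then have "q > 0" using pos by simp
      then show ?thesis using nuq(1)[OF False c] total c pos by (simp add: v split: if_splits)
    next
      assume c: "k\<^sup>2 + l\<^sup>2 = 4 * q + 1"
      then have "odd (k\<^sup>2 + l\<^sup>2)" by presburger
      then show ?thesis using nuq(2)[OF False c] total c pos by simp
    next
      assume c: "k\<^sup>2 + l\<^sup>2 = 4 * q + 2"
      then have "even (k\<^sup>2 + l\<^sup>2)" by presburger
      then show ?thesis using nuq(3)[OF False c] total c pos by (simp add: v split: if_splits)
    qed
    then show ?thesis using MCC_B_eq[OF fw] cp False unfolding L by simp
  qed
  have orbits: "beta L v ` coker L \<subseteq> coker L
        \<and> finite (coker L) \<and> int (card (coker L)) = k\<^sup>2 + l\<^sup>2
        \<and> (\<forall>Q\<in>beta_orbits L v. card Q \<in> {1, 2, 4})"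
    and odd: "\<forall>Q\<in>beta_orbits L v. odd (card Q) \<longrightarrow> (\<exists>U\<in>coker L. Q = {U} \<and> beta L v U = U)"
    and invariant: "\<forall>g1 g2 L' v'.
              fiberwise g1 \<and> fiberwise g2
              \<and> classifying_pair (\<lambda>c. fiber_minus (g1 c) (g2 c)) L' v'
              \<and> L' \<noteq> (\<lambda>u. 0)
              \<and> card (coker L') = card (coker L)
              \<and> (even (v' $ 1 + v' $ 2) \<longleftrightarrow> even (v $ 1 + v $ 2))
              \<longrightarrow> nu_quadruple L' v' = nu_quadruple L v"
    and quadruple: "([v $ 1 = v $ 2] (mod 2) \<longrightarrow>
              (k\<^sup>2 + l\<^sup>2 = 4 * q \<and> 4 * q > 0 \<longrightarrow> nu_quadruple L v = (2, 1, q - 1, q + 2))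
            \<and> (k\<^sup>2 + l\<^sup>2 = 4 * q + 1 \<longrightarrow> nu_quadruple L v = (1, 0, q, q + 1))
            \<and> (k\<^sup>2 + l\<^sup>2 = 4 * q + 2 \<longrightarrow> nu_quadruple L v = (2, 0, q, q + 2)))
        \<and> (\<not> [v $ 1 = v $ 2] (mod 2) \<longrightarrow>
              (k\<^sup>2 + l\<^sup>2 = 4 * q \<and> 4 * q > 0 \<longrightarrow> nu_quadruple L v = (0, 0, q, q))
            \<and> (k\<^sup>2 + l\<^sup>2 = 4 * q + 1 \<longrightarrow> nu_quadruple L v = (1, 0, q, q + 1))
            \<and> (k\<^sup>2 + l\<^sup>2 = 4 * q + 2 \<longrightarrow> nu_quadruple L v = (0, 1, q, q + 1)))"
    and fixed: "(even (nu L v 1) \<longleftrightarrow> even (card (coker L))) \<and> nu L v 1 \<in> {0, 1, 2}"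
    if "L \<noteq> (\<lambda>u. 0)"
  proof -
    have a: "a \<noteq> 0" using that L0 by simp
    show "beta L v ` coker L \<subseteq> coker L
        \<and> finite (coker L) \<and> int (card (coker L)) = k\<^sup>2 + l\<^sup>2
        \<and> (\<forall>Q\<in>beta_orbits L v. card Q \<in> {1, 2, 4})"
      using beta_in_coker finite_coker_gmul[OF a] card_coker_gmul[OF a] card_beta_orbit[OF a]
      unfolding L N by blast
    show "\<forall>Q\<in>beta_orbits L v. odd (card Q) \<longrightarrow> (\<exists>U\<in>coker L. Q = {U} \<and> beta L v U = U)"
      using odd_beta_orbit[OF a] unfolding L by blast
    show "\<forall>g1 g2 L' v'.
              fiberwise g1 \<and> fiberwise g2
              \<and> classifying_pair (\<lambda>c. fiber_minus (g1 c) (g2 c)) L' v'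
              \<and> L' \<noteq> (\<lambda>u. 0)
              \<and> card (coker L') = card (coker L)
              \<and> (even (v' $ 1 + v' $ 2) \<longleftrightarrow> even (v $ 1 + v $ 2))
              \<longrightarrow> nu_quadruple L' v' = nu_quadruple L v"
    proof (intro allI impI; elim conjE)
      fix g1 g2 L' v'
      assume g: "fiberwise g1" "fiberwise g2"
          "classifying_pair (\<lambda>c. fiber_minus (g1 c) (g2 c)) L' v'"
        and L': "L' \<noteq> (\<lambda>u. 0)" "card (coker L') = card (coker L)"
        and par: "even (v' $ 1 + v' $ 2) \<longleftrightarrow> even (v $ 1 + v $ 2)"
      obtain b where b: "L' = gmul b" using classifying_pair_gmul[OF g] by blast
      have "b \<noteq> 0"
      proof
        assume "b = 0"
        then have "L' = (\<lambda>u. 0)" by (simp add: b gmul_def vec2_eq_iff fun_eq_iff)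
        then show False using L'(1) by contradiction
      qed
      then have "gnorm b = gnorm a"
        using L'(2) card_coker_gmul[of b] card_coker_gmul[OF a] by (simp add: L b)
      then show "nu_quadruple L' v' = nu_quadruple L v"
        unfolding L b using nu_quadruple_cong[OF \<open>b \<noteq> 0\<close> a _ par] by blast
    qed
    show "([v $ 1 = v $ 2] (mod 2) \<longrightarrow>
              (k\<^sup>2 + l\<^sup>2 = 4 * q \<and> 4 * q > 0 \<longrightarrow> nu_quadruple L v = (2, 1, q - 1, q + 2))
            \<and> (k\<^sup>2 + l\<^sup>2 = 4 * q + 1 \<longrightarrow> nu_quadruple L v = (1, 0, q, q + 1))
            \<and> (k\<^sup>2 + l\<^sup>2 = 4 * q + 2 \<longrightarrow> nu_quadruple L v = (2, 0, q, q + 2)))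
        \<and> (\<not> [v $ 1 = v $ 2] (mod 2) \<longrightarrow>
              (k\<^sup>2 + l\<^sup>2 = 4 * q \<and> 4 * q > 0 \<longrightarrow> nu_quadruple L v = (0, 0, q, q))
            \<and> (k\<^sup>2 + l\<^sup>2 = 4 * q + 1 \<longrightarrow> nu_quadruple L v = (1, 0, q, q + 1))
            \<and> (k\<^sup>2 + l\<^sup>2 = 4 * q + 2 \<longrightarrow> nu_quadruple L v = (0, 1, q, q + 1)))"
      unfolding v using nuq[OF a] by presburger
    have "int (nu L v 1) = (if odd (k\<^sup>2 + l\<^sup>2) then 1 else if even (v $ 1 + v $ 2) then 2 else 0)"
      using nu_1[OF a, of v] unfolding L N .
    moreover have "even (card (coker L)) \<longleftrightarrow> even (k\<^sup>2 + l\<^sup>2)"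
      using card_coker_gmul[OF a] unfolding L N by (metis even_of_nat_iff)
    ultimately show "(even (nu L v 1) \<longleftrightarrow> even (card (coker L))) \<and> nu L v 1 \<in> {0, 1, 2}"
      by (auto split: if_splits)
  qed
  have q: "k\<^sup>2 + l\<^sup>2 = 4 * q \<and> 4 * q > 0 \<and> \<not> [v $ 1 = v $ 2] (mod 2) \<longrightarrow> q > 0" by simp
  show ?thesis (is "_ \<and> _ \<and> _ \<and> _ \<and> (_ \<longrightarrow> ?orbits)")
  proof (rule conjI[OF lin[THEN conjunct1] conjI[OF lin[THEN conjunct2] conjI[OF MCC conjI[OF q impI]]]])
    assume nz: "L \<noteq> (\<lambda>u. 0)"
    show ?orbits
      using orbits[OF nz] invariant[OF nz] quadruple[OF nz] odd[OF nz] fixed[OF nz]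
      by (elim conjE, intro conjI) assumption+
  qed
qed

end
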